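(* For all nonnegative integers $k$ and $n$ with $n \geq \frac{k+7}{2}$, $$\mathrm{av}_n^k(1324) = [x^k]\left(P(x)^2 - \frac{R_n(x)}{1-x}\right),$$ where $$R_n(x) = 2(2+x)\,x^{n-1}P(x)^2$$ and $P(x)=\sum_{j\ge 0}p(j)x^j$ is the generating function of the partition numbers. In particular, for all such $n$ and $k$, $$\mathrm{av}_{n+1}^k(1324) - \mathrm{av}_n^k(1324) = [x^k]R_n(x) \geq 0.$$
   Context: A permutation $\pi$ of $[n]=\{1,\dots,n\}$, written $\pi_1\pi_2\ldots\pi_n$ with $\pi_i=\pi(i)$, contains the pattern $\tau\in\mathfrak S_m$ if there are indices $i_1<\dots<i_m$ such that $\pi(i_a)<\pi(i_b)$ if and only if $\tau(a)<\tau(b)$ for all $a,b\in[m]$; otherwise $\pi$ avoids $\tau$. An inversion of $\pi$ is a pair of indices $(i,j)$ with $i<j$ and $\pi_i>\pi_j$. $\mathrm{av}_n^k(\tau)$ denotes the number of permutations in $\mathfrak S_n$ that avoid $\tau$ and have exactly $k$ inversions. $p(j)$ is the number of integer partitions of $j$ (with $p(0)=1$). $[x^k]F(x)$ denotes the coefficient of $x^k$ in the formal power series $F(x)$. *)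

theory Defs
  imports
    "HOL-Combinatorics.Permutations"
    "HOL-Computational_Algebra.Formal_Power_Series"
    "HOL-Library.Multiset"
begin

text \<open>
  A permutation of \<open>[n]\<close> is a function \<open>\<pi> :: nat \<Rightarrow> nat\<close> with \<open>\<pi> permutes {1..n}\<close>; such a
  function is the identity outside \<open>{1..n}\<close>, so these functions correspond bijectively to the
  elements of the symmetric group.
\<close>

text \<open>
  The pattern has length \<open>m\<close>; the strictly increasing map \<open>\<iota>\<close> picks the indices
  \<open>\<iota> 1 < \<dots> < \<iota> m\<close> of an occurrence.
\<close>

definition contains_pattern :: "nat \<Rightarrow> (nat \<Rightarrow> nat) \<Rightarrow> nat \<Rightarrow> (nat \<Rightarrow> nat) \<Rightarrow> bool" where
  "contains_pattern n \<pi> m \<tau> \<longleftrightarrow>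
     (\<exists>\<iota>. \<iota> ` {1..m} \<subseteq> {1..n} \<and> strict_mono_on {1..m} \<iota> \<and>
       (\<forall>a\<in>{1..m}. \<forall>b\<in>{1..m}. \<pi> (\<iota> a) < \<pi> (\<iota> b) \<longleftrightarrow> \<tau> a < \<tau> b))"

definition inversions :: "nat \<Rightarrow> (nat \<Rightarrow> nat) \<Rightarrow> (nat \<times> nat) set" where
  "inversions n \<pi> = {(i, j). i \<in> {1..n} \<and> j \<in> {1..n} \<and> i < j \<and> \<pi> i > \<pi> j}"

definition av :: "nat \<Rightarrow> nat \<Rightarrow> nat \<Rightarrow> (nat \<Rightarrow> nat) \<Rightarrow> nat" where
  "av n k m \<tau> =
     card {\<pi>. \<pi> permutes {1..n} \<and> \<not> contains_pattern n \<pi> m \<tau> \<and> card (inversions n \<pi>) = k}"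

definition one_line :: "nat list \<Rightarrow> nat \<Rightarrow> nat" where
  "one_line xs i = (if i \<in> {1..length xs} then xs ! (i - 1) else i)"

abbreviation pattern_1324 :: "nat \<Rightarrow> nat" where
  "pattern_1324 \<equiv> one_line [1, 3, 2, 4]"

text \<open>
  An integer partition of \<open>j\<close> is a finite multiset of positive integers (its parts) with sum \<open>j\<close>.
\<close>

definition partition_number :: "nat \<Rightarrow> nat" where
  "partition_number j = card {M :: nat multiset. 0 \<notin># M \<and> sum_mset M = j}"

text \<open>The coefficients are rational only so that division by \<open>1 - x\<close> is available.\<close>

definition P :: "rat fps" where
  "P = Abs_fps (\<lambda>j. of_nat (partition_number j))"

text \<open>The truncated subtraction \<open>n - 1\<close> is harmless for \<open>n \<ge> 1\<close>, the only case of interest.\<close>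

definition R :: "nat \<Rightarrow> rat fps" where
  "R n = 2 * (2 + fps_X) * fps_X ^ (n - 1) * P\<^sup>2"

end

theory Submission
  imports Defs
begin

text \<open>
  Call a permutation decomposable if its diagram is a direct sum, that is, splits into a nonempty
  part and another nonempty part strictly above and to the right of it. Decomposable 1324-avoiders
  are easy: the first indecomposable block avoids 132, the last one avoids 213, and between them
  there are only fixed points (\<open>Dec_bij\<close>). The heart of the matter is to reduce the
  indecomposable avoiders with few inversions to decomposable ones.

  The key structural fact is \<open>few_inversions_reducible\<close>: if an indecomposable avoider
  of length \<open>n\<close> has at most \<open>2 n - 7\<close> inversions, then removing its
  lowest, highest, leftmost or rightmost point makes it decomposable. For each cut \<open>i\<close>,
  the number of points with position at most \<open>i\<close> and value above \<open>i\<close> is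
  positive by indecomposability, and these numbers add up to at most the number of inversions. With
  so few inversions some inner cut is crossed by just one point upwards, hence one point downwards
  (\<open>ex_cut\<close>). So the permutation consists of a lower left part, an upper right part,
  and one inverted pair linking them; a case distinction on which of the two linking points are
  extreme, counting the inversions that each configuration forces, finishes the argument, by
  induction in one case.

  The lowest and leftmost points cannot both be removable in this sense, nor can the highest and the
  rightmost (\<open>low_left_exclusive\<close>, \<open>high_right_exclusive\<close>). As the
  symmetries of the square that preserve 1324 and the inversion number permute the four directions,
  inclusion-exclusion expresses the number of indecomposable avoiders as \<open>4 L - 2 L_R - 2
  L_H\<close>, where \<open>L\<close> counts those with removable lowest point, and
  \<open>L_R\<close>, \<open>L_H\<close> those where in addition the rightmost or the highest point
  is removable (\<open>Ind_count\<close>). Each of these counts runs over the ways to insert extreme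
  points into a decomposable avoider. Inserting a suitable point into a decomposable avoider never
  creates a 1324, as long as the result is indecomposable (\<open>avoids_insert_min\<close>,
  \<open>avoids_insert_min_max\<close>), so every count becomes a sum over the sizes
  \<open>a\<close>, \<open>b\<close> of the two outer blocks of \<open>B a * B b\<close> times a
  generating function of lattice points, where \<open>B a\<close> enumerates indecomposable
  132-avoiders of length \<open>a\<close> by inversions.

  It remains to evaluate these sums modulo \<open>x^(2 n - 6)\<close>. Lehmer codes identify
  132-avoiders of length \<open>m\<close> with Young diagrams inside a staircase, inversions
  becoming cells. Hence \<open>B 1 + \<dots> + B m\<close> agrees with \<open>P\<close> below
  \<open>x^m\<close> (\<open>P_sum_B\<close>), and a diagram that fits in the staircase of size
  \<open>m + 1\<close> but not in that of size \<open>m\<close> has, unless it is large, a full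
  first row or a full first column, whence \<open>B (m + 1) \<equiv> 2 x^m (B 1 + \<dots> + B
  m)\<close> modulo \<open>x^(2 m - 2)\<close> (\<open>B_row_col\<close>). Replacing \<open>B
  a\<close> by the right-hand side whenever \<open>a + b > n\<close> turns everything into \<open>B
  i * B j\<close> times explicit power series, and for each pair \<open>(i, j)\<close> these series
  add up to \<open>(4 x^(n-1) + 2 x^n) / (1 - x)\<close> (\<open>pair_identity\<close>).
\<close>

section \<open>Point sets, inversions and direct sums\<close>

type_synonym point = "int \<times> int"

definition below :: "point \<Rightarrow> point \<Rightarrow> bool" (infix "\<lless>" 50) where
  "p \<lless> q \<longleftrightarrow> fst p < fst q \<and> snd p < snd q"

text \<open>
  Unlike the condition in \<open>ninv\<close>, this is symmetric in the two points, which makes it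
  easy to count inversions between two sets without knowing which set lies to the left.
\<close>

definition inverted :: "point \<Rightarrow> point \<Rightarrow> bool" where
  "inverted p q \<longleftrightarrow> fst p < fst q \<and> snd q < snd p \<or> fst q < fst p \<and> snd p < snd q"

definition cross :: "point set \<Rightarrow> point set \<Rightarrow> nat" where
  "cross A B = card {(p, q). p \<in> A \<and> q \<in> B \<and> inverted p q}"

definition ninv :: "point set \<Rightarrow> nat" where
  "ninv T = card {(p, q). p \<in> T \<and> q \<in> T \<and> fst p < fst q \<and> snd q < snd p}"

text \<open>
  The diagrams that look like permutations up to an increasing change of both coordinates. Subsets
  of permutation diagrams are of this kind, so that points can be removed without renumbering.
\<close>

definition generic :: "point set \<Rightarrow> bool" where
  "generic T \<longleftrightarrow> finite T \<and> inj_on fst T \<and> inj_on snd T"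

definition dsum :: "point set \<Rightarrow> bool" where
  "dsum T \<longleftrightarrow> (\<exists>A B. A \<noteq> {} \<and> B \<noteq> {} \<and> T = A \<union> B \<and> (\<forall>p\<in>A. \<forall>q\<in>B. p \<lless> q))"

definition avoids :: "point set \<Rightarrow> bool" where
  "avoids T \<longleftrightarrow> \<not> (\<exists>p\<in>T. \<exists>q\<in>T. \<exists>r\<in>T. \<exists>s\<in>T.
     fst p < fst q \<and> fst q < fst r \<and> fst r < fst s \<and> snd p < snd r \<and> snd r < snd q \<and> snd q < snd s)"

definition low :: "point set \<Rightarrow> point \<Rightarrow> bool" where
  "low T e \<longleftrightarrow> e \<in> T \<and> (\<forall>q\<in>T. snd e \<le> snd q)"
definition high :: "point set \<Rightarrow> point \<Rightarrow> bool" where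
  "high T e \<longleftrightarrow> e \<in> T \<and> (\<forall>q\<in>T. snd q \<le> snd e)"
definition left :: "point set \<Rightarrow> point \<Rightarrow> bool" where
  "left T e \<longleftrightarrow> e \<in> T \<and> (\<forall>q\<in>T. fst e \<le> fst q)"
definition right :: "point set \<Rightarrow> point \<Rightarrow> bool" where
  "right T e \<longleftrightarrow> e \<in> T \<and> (\<forall>q\<in>T. fst q \<le> fst e)"

lemma inverted_sym: "inverted p q \<longleftrightarrow> inverted q p"
  by (auto simp: inverted_def)

lemma below_not_inverted: "p \<lless> q \<Longrightarrow> \<not> inverted p q" "p \<lless> q \<Longrightarrow> \<not> inverted q p"
  by (auto simp: inverted_def below_def)

lemma generic_subset: "generic T \<Longrightarrow> S \<subseteq> T \<Longrightarrow> generic S"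
  unfolding generic_def using finite_subset inj_on_subset by blast

lemma avoids_subset: "avoids T \<Longrightarrow> S \<subseteq> T \<Longrightarrow> avoids S"
  unfolding avoids_def by blast

lemma avoidsD:
  "avoids T \<Longrightarrow> p \<in> T \<Longrightarrow> q \<in> T \<Longrightarrow> r \<in> T \<Longrightarrow> s \<in> T \<Longrightarrow> fst p < fst q \<Longrightarrow> fst q < fst r \<Longrightarrow> fst r < fst s
   \<Longrightarrow> snd p < snd r \<Longrightarrow> snd r < snd q \<Longrightarrow> snd q < snd s \<Longrightarrow> False"
  unfolding avoids_def by blast

lemma genericD:
  assumes "generic T" "p \<in> T" "q \<in> T" "p \<noteq> q"
  shows "fst p \<noteq> fst q" "snd p \<noteq> snd q"
  using assms unfolding generic_def inj_on_def by auto

lemma dsumI: "A \<noteq> {} \<Longrightarrow> B \<noteq> {} \<Longrightarrow> T = A \<union> B \<Longrightarrow> (\<And>p q. p \<in> A \<Longrightarrow> q \<in> B \<Longrightarrow> p \<lless> q) \<Longrightarrow> dsum T"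
  unfolding dsum_def by blast

lemma dsumE:
  assumes "dsum T"
  obtains A B where "A \<noteq> {}" "B \<noteq> {}" "T = A \<union> B" "A \<inter> B = {}" "\<forall>p\<in>A. \<forall>q\<in>B. p \<lless> q"
proof -
  from assms obtain A B where *: "A \<noteq> {}" "B \<noteq> {}" "T = A \<union> B" "\<forall>p\<in>A. \<forall>q\<in>B. p \<lless> q"
    unfolding dsum_def by blast
  moreover have "A \<inter> B = {}" using *(4) by (force simp: below_def)
  ultimately show ?thesis using that by blast
qed

lemma finite_cross: "finite A \<Longrightarrow> finite B \<Longrightarrow> finite {(p, q). p \<in> A \<and> q \<in> B \<and> inverted p q}"
  by (rule finite_subset[of _ "A \<times> B"]) auto

lemma cross_commute: "cross A B = cross B A"
  unfolding cross_def
  by (rule bij_betw_same_card[of "\<lambda>(p, q). (q, p)"])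
    (auto simp: bij_betw_def inj_on_def inverted_sym image_def)

lemma cross_Un2:
  assumes "finite A" "finite B" "finite C" "B \<inter> C = {}"
  shows "cross A (B \<union> C) = cross A B + cross A C"
proof -
  have "{(p, q). p \<in> A \<and> q \<in> B \<union> C \<and> inverted p q}
      = {(p, q). p \<in> A \<and> q \<in> B \<and> inverted p q} \<union> {(p, q). p \<in> A \<and> q \<in> C \<and> inverted p q}" by auto
  then show ?thesis unfolding cross_def
    using assms by (simp add: card_Un_disjoint[OF finite_cross finite_cross] disjoint_iff)
qed

lemma cross_Un1:
  assumes "finite A" "finite B" "finite C" "B \<inter> C = {}"
  shows "cross (B \<union> C) A = cross B A + cross C A"
  using cross_Un2[OF assms] by (simp add: cross_commute)

lemma cross_full:
  assumes "\<And>p q. p \<in> A \<Longrightarrow> q \<in> B \<Longrightarrow> inverted p q"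
  shows "cross A B = card A * card B"
proof -
  have "{(p, q). p \<in> A \<and> q \<in> B \<and> inverted p q} = A \<times> B" using assms by auto
  then show ?thesis unfolding cross_def by (simp add: card_cartesian_product)
qed

lemma cross_none:
  assumes "\<And>p q. p \<in> A \<Longrightarrow> q \<in> B \<Longrightarrow> \<not> inverted p q"
  shows "cross A B = 0"
proof -
  have "{(p, q). p \<in> A \<and> q \<in> B \<and> inverted p q} = {}" using assms by auto
  then show ?thesis unfolding cross_def by (simp only: card.empty)
qed

lemma ninv_Un:
  assumes "finite A" "finite B" "A \<inter> B = {}"
  shows "ninv (A \<union> B) = ninv A + ninv B + cross A B"
proof -
  let ?I = "\<lambda>S T. {(p, q). p \<in> S \<and> q \<in> T \<and> fst p < fst q \<and> snd q < snd p}"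
  have fin: "finite (?I S T)" if "finite S" "finite T" for S T :: "point set"
    by (rule finite_subset[of _ "S \<times> T"]) (use that in auto)
  have "?I (A \<union> B) (A \<union> B) = (?I A A \<union> ?I B B) \<union> (?I A B \<union> ?I B A)" by auto
  then have "card (?I (A \<union> B) (A \<union> B)) = card (?I A A \<union> ?I B B) + card (?I A B \<union> ?I B A)"
    using assms by (simp only: ) (intro card_Un_disjoint; auto simp: fin)
  moreover have "card (?I A A \<union> ?I B B) = card (?I A A) + card (?I B B)"
    using assms by (intro card_Un_disjoint; auto simp: fin)
  moreover have "card (?I A B \<union> ?I B A) = card {(p, q). p \<in> A \<and> q \<in> B \<and> inverted p q}"
  proof (rule bij_betw_same_card[of "\<lambda>(p, q). if p \<in> A then (p, q) else (q, p)"])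
    show "bij_betw (\<lambda>(p, q). if p \<in> A then (p, q) else (q, p)) (?I A B \<union> ?I B A)
       {(p, q). p \<in> A \<and> q \<in> B \<and> inverted p q}"
      unfolding bij_betw_def
    proof
      show "inj_on (\<lambda>(p, q). if p \<in> A then (p, q) else (q, p)) (?I A B \<union> ?I B A)"
        using assms(3) by (auto simp: inj_on_def split: if_splits)
      show "(\<lambda>(p, q). if p \<in> A then (p, q) else (q, p)) ` (?I A B \<union> ?I B A)
        = {(p, q). p \<in> A \<and> q \<in> B \<and> inverted p q}" (is "?f ` ?S = ?R")
      proof
        show "?f ` ?S \<subseteq> ?R"
        proof
          fix z assume "z \<in> ?f ` ?S"
          then obtain p q where z: "(p, q) \<in> ?S" "z = (if p \<in> A then (p, q) else (q, p))" by auto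
          then show "z \<in> ?R" using assms(3) by (cases "p \<in> A") (auto simp: inverted_def)
        qed
        show "?R \<subseteq> ?f ` ?S"
        proof
          fix z assume "z \<in> ?R"
          then obtain p q where z: "z = (p, q)" "p \<in> A" "q \<in> B" "inverted p q" by auto
          show "z \<in> ?f ` ?S"
          proof (cases "fst p < fst q \<and> snd q < snd p")
            case True
            then show ?thesis using z by (intro image_eqI[of _ _ "(p, q)"]) auto
          next
            case False
            have "q \<notin> A" using z assms(3) by auto
            then show ?thesis using z False
              by (intro image_eqI[of _ _ "(q, p)"]) (auto simp: inverted_def)
          qed
        qed
      qed
    qed
  qed
  ultimately show ?thesis unfolding ninv_def cross_def by simp
qed

lemma ninv_empty [simp]: "ninv {} = 0" by (simp add: ninv_def)

lemma ninv_single [simp]: "ninv {e} = 0"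
proof -
  have "{(p, q). p \<in> {e} \<and> q \<in> {e} \<and> fst p < fst q \<and> snd q < snd p} = {}" by auto
  then show ?thesis unfolding ninv_def by (simp only: card.empty)
qed

lemma ninv_insert: "finite T \<Longrightarrow> e \<notin> T \<Longrightarrow> ninv (insert e T) = ninv T + cross {e} T"
  using ninv_Un[of "{e}" T] by simp

lemma cross_single: "cross {e} B = card {q \<in> B. inverted e q}"
proof -
  have "{(p, q). p \<in> {e} \<and> q \<in> B \<and> inverted p q} = Pair e ` {q \<in> B. inverted e q}" by auto
  then show ?thesis unfolding cross_def by (simp only:) (simp add: card_image inj_on_def)
qed

lemma ex_high:
  assumes "finite T" "T \<noteq> {}" shows "\<exists>h. high T h"
proof -
  have "Max (snd ` T) \<in> snd ` T" using assms by simp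
  then obtain h where "h \<in> T" "snd h = Max (snd ` T)" by auto
  moreover have "snd q \<le> Max (snd ` T)" if "q \<in> T" for q using that assms by simp
  ultimately show ?thesis unfolding high_def by metis
qed

text \<open>
  The inversion graph of an indecomposable set is connected, hence has at least one edge less than
  vertices. The induction removes the highest point \<open>h\<close>. If the rest decomposes as
  \<open>A\<close> below \<open>B\<close>, then \<open>h\<close> lies to the left of some point of
  \<open>A\<close> and so of all of \<open>B\<close>; thus \<open>h\<close> is inverted with each
  point of \<open>B\<close>, and \<open>A\<close> with \<open>h\<close> added stays indecomposable.
\<close>

lemma indecomposable_ninv:
  assumes "generic T" "T \<noteq> {}" "\<not> dsum T"
  shows "card T \<le> ninv T + 1"
  using assms
proof (induction "card T" arbitrary: T rule: less_induct)
  case less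
  have fin: "finite T" using less.prems(1) by (simp add: generic_def)
  obtain h where h: "high T h" using ex_high fin less.prems by blast
  then have hT: "h \<in> T" and top: "\<And>q. q \<in> T \<Longrightarrow> q \<noteq> h \<Longrightarrow> snd q < snd h"
    using genericD(2)[OF less.prems(1)] unfolding high_def by (fastforce dest: le_neq_trans)+
  let ?S = "T - {h}"
  have finS: "finite ?S" using fin by simp
  have T: "T = insert h ?S" using hT by auto
  have cT: "card T = card ?S + 1" using T finS by (metis Diff_iff Suc_eq_plus1 card_insert_disjoint insertCI)
  have nT: "ninv T = ninv ?S + cross {h} ?S" using ninv_insert[OF finS, of h] T by simp
  show ?case
  proof (cases "?S = {}")
    case True
    then have "card ?S = 0" by (simp only: card.empty)
    then show ?thesis using cT by simp
  next
    case ne: False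
    show ?thesis
    proof (cases "dsum ?S")
      case False
      have "card ?S \<le> ninv ?S + 1"
        using less.hyps[of ?S] False ne cT generic_subset[OF less.prems(1)] by auto
      moreover have "cross {h} ?S \<noteq> 0"
      proof
        assume "cross {h} ?S = 0"
        then have "{q \<in> ?S. inverted h q} = {}" using finS by (simp add: cross_single)
        then have "q \<lless> h" if "q \<in> ?S" for q
          using that top[of q] genericD(1)[OF less.prems(1), of q h] hT
          by (fastforce simp: inverted_def below_def)
        then have "dsum T" using ne T by (intro dsumI[of ?S "{h}"]) auto
        then show False using less.prems by simp
      qed
      ultimately show ?thesis using nT cT by simp
    next
      case True
      then obtain A B where AB: "A \<noteq> {}" "B \<noteq> {}" "?S = A \<union> B" "A \<inter> B = {}"
        "\<forall>p\<in>A. \<forall>q\<in>B. p \<lless> q" by (rule dsumE)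
      have fAB: "finite A" "finite B" using finS AB(3) by (metis finite_Un)+
      have hn: "h \<notin> A" "h \<notin> B" using AB(3) by auto
      have 1: "\<not> dsum (insert h A)"
      proof
        assume "dsum (insert h A)"
        then obtain C D where CD: "C \<noteq> {}" "D \<noteq> {}" "insert h A = C \<union> D" "C \<inter> D = {}"
        "\<forall>p\<in>C. \<forall>q\<in>D. p \<lless> q" by (rule dsumE)
        have "h \<notin> C"
        proof
          assume "h \<in> C"
          obtain q where q: "q \<in> D" using CD by auto
          then have "h \<lless> q" "q \<in> T" "q \<noteq> h" using CD \<open>h \<in> C\<close> AB(3) T by blast+
          then show False using top[of q] by (auto simp: below_def)
        qed
        then have "C \<subseteq> A" using CD by auto
        then have "dsum T" using CD AB T by (intro dsumI[of C "D \<union> B"]) auto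
        then show False using less.prems by simp
      qed
      \<comment> \<open>Some point of \<open>A\<close> is not below \<open>h\<close>, hence to the right of it, and \<open>B\<close> is even further right.\<close>
      have 2: "inverted h q" if "q \<in> B" for q
      proof -
        have "\<exists>p\<in>A. \<not> p \<lless> h"
        proof (rule ccontr)
          assume "\<not> ?thesis"
          then have "dsum T" using AB T by (intro dsumI[of A "insert h B"]) auto
          then show False using less.prems by simp
        qed
        then obtain p where p: "p \<in> A" "\<not> p \<lless> h" by auto
        have "p \<in> T" "p \<noteq> h" "q \<in> T" "q \<noteq> h" using p that AB hn by auto
        then have "fst h < fst p" using p top[of p] genericD(1)[OF less.prems(1), of p h] hT
          by (auto simp: below_def)
        moreover have "fst p < fst q" using AB(5) p that by (auto simp: below_def)
        ultimately show ?thesis using top[of q] \<open>q \<in> T\<close> \<open>q \<noteq> h\<close> by (auto simp: inverted_def)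
      qed
      have cA: "card (insert h A) = card A + 1" using fAB hn by simp
      have cS: "card ?S = card A + card B" using fAB AB by (simp add: card_Un_disjoint)
      have "card B > 0" using fAB AB by auto
      then have "card (insert h A) \<le> ninv (insert h A) + 1"
        using less.hyps[of "insert h A"] 1 cA cS cT generic_subset[OF less.prems(1), of "insert h A"] AB hT by auto
      moreover have "T = insert h A \<union> B" using T AB by auto
      then have "ninv T = ninv (insert h A) + ninv B + cross (insert h A) B"
        using ninv_Un[of "insert h A" B] fAB AB hn by auto
      moreover have "cross (insert h A) B = cross {h} B + cross A B"
        using cross_Un1[of B "{h}" A] fAB hn by simp
      moreover have "cross {h} B = card B" using cross_full[of "{h}" B] 2 by simp
      ultimately show ?thesis using cA cS cT by linarith
    qed
  qed
qed

section \<open>Symmetries, and cuts crossed by one inverted pair\<close>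

lemma dsum_image_iff:
  assumes rel: "\<And>p q. p \<in> T \<Longrightarrow> q \<in> T \<Longrightarrow> f p \<lless> f q \<longleftrightarrow> p \<lless> q"
  shows "dsum (f ` T) \<longleftrightarrow> dsum T"
proof
  assume "dsum (f ` T)"
  then obtain A B where AB: "A \<noteq> {}" "B \<noteq> {}" "f ` T = A \<union> B" "A \<inter> B = {}" "\<forall>p\<in>A. \<forall>q\<in>B. p \<lless> q"
    by (rule dsumE)
  have im: "f p \<in> A \<union> B" if "p \<in> T" for p using that by (simp flip: AB(3))
  show "dsum T"
  proof (rule dsumI[of "{p \<in> T. f p \<in> A}" "{p \<in> T. f p \<in> B}"])
    have "A \<subseteq> f ` T" "B \<subseteq> f ` T" using AB(3) by blast+
    then show "{p \<in> T. f p \<in> A} \<noteq> {}" "{p \<in> T. f p \<in> B} \<noteq> {}"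
      using AB(1,2) by (fastforce simp: subset_iff)+
    show "T = {p \<in> T. f p \<in> A} \<union> {p \<in> T. f p \<in> B}" using im by auto
    fix p q assume "p \<in> {p \<in> T. f p \<in> A}" "q \<in> {p \<in> T. f p \<in> B}"
    then have "p \<in> T" "q \<in> T" "f p \<lless> f q" using AB(5) by auto
    then show "p \<lless> q" using rel by simp
  qed
next
  assume "dsum T"
  then obtain A B where AB: "A \<noteq> {}" "B \<noteq> {}" "T = A \<union> B" "A \<inter> B = {}" "\<forall>p\<in>A. \<forall>q\<in>B. p \<lless> q"
    by (rule dsumE)
  show "dsum (f ` T)"
  proof (rule dsumI[of "f ` A" "f ` B"])
    show "f ` A \<noteq> {}" "f ` B \<noteq> {}" "f ` T = f ` A \<union> f ` B" using AB(1-3) by auto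
    fix p q assume "p \<in> f ` A" "q \<in> f ` B"
    then obtain u v where "p = f u" "q = f v" "u \<in> A" "v \<in> B" by auto
    moreover from this have "u \<in> T" "v \<in> T" "u \<lless> v" using AB(3,5) by auto
    ultimately show "p \<lless> q" using rel by simp
  qed
qed

lemma dsum_image_rev:
  assumes rel: "\<And>p q. p \<in> T \<Longrightarrow> q \<in> T \<Longrightarrow> f p \<lless> f q \<longleftrightarrow> q \<lless> p"
  shows "dsum (f ` T) \<longleftrightarrow> dsum T"
proof
  assume "dsum (f ` T)"
  then obtain A B where AB: "A \<noteq> {}" "B \<noteq> {}" "f ` T = A \<union> B" "A \<inter> B = {}" "\<forall>p\<in>A. \<forall>q\<in>B. p \<lless> q"
    by (rule dsumE)
  have im: "f p \<in> A \<union> B" if "p \<in> T" for p using that by (simp flip: AB(3))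
  show "dsum T"
  proof (rule dsumI[of "{p \<in> T. f p \<in> B}" "{p \<in> T. f p \<in> A}"])
    have "A \<subseteq> f ` T" "B \<subseteq> f ` T" using AB(3) by blast+
    then show "{p \<in> T. f p \<in> B} \<noteq> {}" "{p \<in> T. f p \<in> A} \<noteq> {}"
      using AB(1,2) by (fastforce simp: subset_iff)+
    show "T = {p \<in> T. f p \<in> B} \<union> {p \<in> T. f p \<in> A}" using im by auto
    fix p q assume "p \<in> {p \<in> T. f p \<in> B}" "q \<in> {p \<in> T. f p \<in> A}"
    then have "p \<in> T" "q \<in> T" "f q \<lless> f p" using AB(5) by auto
    then show "p \<lless> q" using rel by simp
  qed
next
  assume "dsum T"
  then obtain A B where AB: "A \<noteq> {}" "B \<noteq> {}" "T = A \<union> B" "A \<inter> B = {}" "\<forall>p\<in>A. \<forall>q\<in>B. p \<lless> q"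
    by (rule dsumE)
  show "dsum (f ` T)"
  proof (rule dsumI[of "f ` B" "f ` A"])
    show "f ` B \<noteq> {}" "f ` A \<noteq> {}" "f ` T = f ` B \<union> f ` A" using AB(1-3) by auto
    fix p q assume "p \<in> f ` B" "q \<in> f ` A"
    then obtain u v where "p = f u" "q = f v" "u \<in> B" "v \<in> A" by auto
    moreover from this have "u \<in> T" "v \<in> T" "v \<lless> u" using AB(3,5) by auto
    ultimately show "p \<lless> q" using rel by simp
  qed
qed

text \<open>
  Inversions are counted through the symmetric number \<open>cross\<close>, because a symmetry may
  exchange left and right.
\<close>

lemma cross_image:
  assumes "inj_on f A" "inj_on f B" "\<And>p q. p \<in> A \<Longrightarrow> q \<in> B \<Longrightarrow> inverted (f p) (f q) \<longleftrightarrow> inverted p q"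
  shows "cross (f ` A) (f ` B) = cross A B"
proof -
  have "{(p, q). p \<in> f ` A \<and> q \<in> f ` B \<and> inverted p q}
     = map_prod f f ` {(p, q). p \<in> A \<and> q \<in> B \<and> inverted p q}"
    using assms(3) by (auto simp: map_prod_def image_iff) force
  moreover have "inj_on (map_prod f f) {(p, q). p \<in> A \<and> q \<in> B \<and> inverted p q}"
    using assms(1,2) by (auto simp: inj_on_def)
  ultimately show ?thesis unfolding cross_def by (simp add: card_image)
qed

lemma ninv_cross:
  assumes "finite T" shows "2 * ninv T = cross T T"
  using assms
proof (induction T)
  case empty
  then show ?case by (simp add: cross_def)
next
  case (insert e T)
  have "cross {e} {e} = 0" by (rule cross_none) (auto simp: inverted_def)
  then have "cross (insert e T) (insert e T) = cross T T + 2 * cross {e} T"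
    using cross_Un1[of "insert e T" "{e}" T] cross_Un2[of "{e}" "{e}" T] cross_Un2[of T "{e}" T] insert.hyps
    by (simp add: cross_commute[of T "{e}"])
  then show ?case using insert ninv_insert[OF insert.hyps] by simp
qed

lemma ninv_image:
  assumes "finite T" "inj_on f T" "\<And>p q. p \<in> T \<Longrightarrow> q \<in> T \<Longrightarrow> inverted (f p) (f q) \<longleftrightarrow> inverted p q"
  shows "ninv (f ` T) = ninv T"
  using cross_image[OF assms(2,2,3)] ninv_cross[of T] ninv_cross[of "f ` T"] assms(1) by simp

definition extreme :: "point set \<Rightarrow> point \<Rightarrow> bool" where
  "extreme T e \<longleftrightarrow> low T e \<or> high T e \<or> left T e \<or> right T e"

definition reducible :: "point set \<Rightarrow> bool" where
  "reducible T \<longleftrightarrow> (\<exists>e. extreme T e \<and> dsum (T - {e}))"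

text \<open>
  Rotation of the diagram by a half-turn, that is, the reverse-complement of the permutation.
\<close>

definition ng :: "point \<Rightarrow> point" where "ng p = (- fst p, - snd p)"

text \<open>
  Reflection in the diagonal, that is, the inverse permutation. Together with the half-turn it
  generates the four symmetries that preserve both the pattern 1324 and the number of inversions.
\<close>

definition sw :: "point \<Rightarrow> point" where "sw p = (snd p, fst p)"

lemma ng_simps [simp]: "fst (ng p) = - fst p" "snd (ng p) = - snd p" "ng (ng p) = p"
  "ng p = ng q \<longleftrightarrow> p = q" "inj_on ng S"
  by (auto simp: ng_def inj_on_def prod_eq_iff)

lemma ng_image [simp]: "ng ` ng ` S = S" "ng p \<in> ng ` S \<longleftrightarrow> p \<in> S"
  by (simp_all add: image_image inj_image_mem_iff)

lemma sw_simps [simp]: "fst (sw p) = snd p" "snd (sw p) = fst p" "sw (sw p) = p"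
  "sw p = sw q \<longleftrightarrow> p = q" "inj_on sw S"
  by (auto simp: sw_def inj_on_def prod_eq_iff)

lemma sw_image [simp]: "sw ` sw ` S = S" "sw p \<in> sw ` S \<longleftrightarrow> p \<in> S"
  by (simp_all add: image_image inj_image_mem_iff)

lemma sym_below [simp]: "sw p \<lless> sw q \<longleftrightarrow> p \<lless> q" "ng p \<lless> ng q \<longleftrightarrow> q \<lless> p"
  by (auto simp: below_def)

lemma sym_inverted [simp]: "inverted (sw p) (sw q) \<longleftrightarrow> inverted p q" "inverted (ng p) (ng q) \<longleftrightarrow> inverted p q"
  by (auto simp: inverted_def)

lemma sym_dsum [simp]: "dsum (sw ` T) \<longleftrightarrow> dsum T" "dsum (ng ` T) \<longleftrightarrow> dsum T"
  by (rule dsum_image_iff dsum_image_rev, simp)+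

lemma sym_ninv [simp]: "finite T \<Longrightarrow> ninv (sw ` T) = ninv T" "finite T \<Longrightarrow> ninv (ng ` T) = ninv T"
  by (rule ninv_image; simp)+

lemma sym_generic [simp]: "generic (sw ` T) \<longleftrightarrow> generic T" "generic (ng ` T) \<longleftrightarrow> generic T"
proof -
  have sw: "generic (sw ` S)" if "generic S" for S
    using that unfolding generic_def
    by (intro conjI inj_onI; elim conjE imageE; simp add: inj_on_eq_iff)
  have ng: "generic (ng ` S)" if "generic S" for S
    using that unfolding generic_def
    by (intro conjI inj_onI; elim conjE imageE; simp add: inj_on_eq_iff)
  show "generic (sw ` T) \<longleftrightarrow> generic T" "generic (ng ` T) \<longleftrightarrow> generic T"
    using sw ng by (metis sw_image(1)) (metis ng ng_image(1))
qed

lemma avoids_sw_imp: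
  assumes "avoids T" shows "avoids (sw ` T)"
  unfolding avoids_def
proof (intro notI, elim bexE conjE)
  fix p q r s assume "p \<in> sw ` T" "q \<in> sw ` T" "r \<in> sw ` T" "s \<in> sw ` T" and
    o: "fst p < fst q" "fst q < fst r" "fst r < fst s" "snd p < snd r" "snd r < snd q" "snd q < snd s"
  then have "sw p \<in> T" "sw q \<in> T" "sw r \<in> T" "sw s \<in> T" by auto
  then show False using avoidsD[OF assms, of "sw p" "sw r" "sw q" "sw s"] o by simp
qed

lemma avoids_ng_imp:
  assumes "avoids T" shows "avoids (ng ` T)"
  unfolding avoids_def
proof (intro notI, elim bexE conjE)
  fix p q r s assume "p \<in> ng ` T" "q \<in> ng ` T" "r \<in> ng ` T" "s \<in> ng ` T" and
    o: "fst p < fst q" "fst q < fst r" "fst r < fst s" "snd p < snd r" "snd r < snd q" "snd q < snd s"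
  then have "ng p \<in> T" "ng q \<in> T" "ng r \<in> T" "ng s \<in> T" by (auto simp: image_iff)
  then show False using avoidsD[OF assms, of "ng s" "ng r" "ng q" "ng p"] o by simp
qed

lemma sym_avoids [simp]: "avoids (sw ` T) \<longleftrightarrow> avoids T" "avoids (ng ` T) \<longleftrightarrow> avoids T"
  by (metis avoids_sw_imp sw_image(1)) (metis avoids_ng_imp ng_image(1))

lemma sym_card [simp]: "card (sw ` T) = card T" "card (ng ` T) = card T"
  by (simp_all add: card_image)

lemma sym_low [simp]: "low (sw ` T) (sw e) \<longleftrightarrow> left T e" "low (ng ` T) (ng e) \<longleftrightarrow> high T e"
  by (auto simp: low_def left_def high_def)
lemma sym_left [simp]: "left (sw ` T) (sw e) \<longleftrightarrow> low T e" "left (ng ` T) (ng e) \<longleftrightarrow> right T e"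
  by (auto simp: low_def left_def right_def)
lemma sym_high [simp]: "high (sw ` T) (sw e) \<longleftrightarrow> right T e" "high (ng ` T) (ng e) \<longleftrightarrow> low T e"
  by (auto simp: low_def right_def high_def)
lemma sym_right [simp]: "right (sw ` T) (sw e) \<longleftrightarrow> high T e" "right (ng ` T) (ng e) \<longleftrightarrow> left T e"
  by (auto simp: right_def left_def high_def)

lemma sym_remove: "sw ` T - {sw e} = sw ` (T - {e})" "ng ` T - {ng e} = ng ` (T - {e})"
  by auto

lemma reducible_sw_imp: "reducible T \<Longrightarrow> reducible (sw ` T)"
  unfolding reducible_def extreme_def
  by (metis sym_remove(1) sym_dsum(1) sym_low(1) sym_left(1) sym_high(1) sym_right(1))

lemma reducible_ng_imp: "reducible T \<Longrightarrow> reducible (ng ` T)"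
  unfolding reducible_def extreme_def
  by (metis sym_remove(2) sym_dsum(2) sym_low(2) sym_left(2) sym_high(2) sym_right(2))

lemma sym_reducible [simp]: "reducible (sw ` T) \<longleftrightarrow> reducible T" "reducible (ng ` T) \<longleftrightarrow> reducible T"
  by (metis reducible_sw_imp sw_image(1)) (metis reducible_ng_imp ng_image(1))

text \<open>
  A cut in the diagram that only two points cross: \<open>X\<close> lies in the lower left,
  \<open>Y\<close> in the upper right, \<open>a\<close> in the lower right and \<open>b\<close> in
  the upper left quadrant. Both reflection and half-turn give such a cut again, the former with
  \<open>a\<close> and \<open>b\<close> exchanged and the latter with \<open>X\<close> and
  \<open>Y\<close> exchanged as well.
\<close>

locale cut =
  fixes T X Y :: "point set" and a b :: point
  assumes gen: "generic T"
    and T_eq: "T = insert a (insert b (X \<union> Y))"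
    and X_ne: "X \<noteq> {}" and Y_ne: "Y \<noteq> {}"
    and XY: "x \<in> X \<Longrightarrow> y \<in> Y \<Longrightarrow> x \<lless> y"
    and Xab: "x \<in> X \<Longrightarrow> fst x < fst a" "x \<in> X \<Longrightarrow> snd x < snd b"
    and Yab: "y \<in> Y \<Longrightarrow> fst b < fst y" "y \<in> Y \<Longrightarrow> snd a < snd y"
    and ab: "fst b < fst a" "snd a < snd b"
begin

lemma swap_cut: "cut (sw ` T) (sw ` X) (sw ` Y) (sw b) (sw a)"
proof (unfold_locales, goal_cases)
  case 1
  then show ?case using gen by (simp only: sym_generic)
qed (use T_eq X_ne Y_ne XY Xab Yab ab in auto)

lemma neg_cut: "cut (ng ` T) (ng ` Y) (ng ` X) (ng b) (ng a)"
proof (unfold_locales, goal_cases)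
  case 1
  then show ?case using gen by (simp only: sym_generic)
qed (use T_eq X_ne Y_ne XY Xab Yab ab in auto)

lemma fin: "finite T" "finite X" "finite Y"
  using gen T_eq unfolding generic_def by auto

lemma sub: "X \<subseteq> T" "Y \<subseteq> T" "a \<in> T" "b \<in> T" using T_eq by auto

lemma notin: "a \<noteq> b" "a \<notin> X" "a \<notin> Y" "b \<notin> X" "b \<notin> Y" "X \<inter> Y = {}"
proof -
  show "a \<noteq> b" using ab(1) by auto
  show "a \<notin> X" using Xab(1)[of a] by auto
  show "b \<notin> X" using Xab(2)[of b] by auto
  show "a \<notin> Y" using Yab(2)[of a] by auto
  show "b \<notin> Y" using Yab(1)[of b] by auto
  show "X \<inter> Y = {}" using XY by (force simp: below_def)
qed

lemma XY_coord: "x \<in> X \<Longrightarrow> y \<in> Y \<Longrightarrow> fst x < fst y" "x \<in> X \<Longrightarrow> y \<in> Y \<Longrightarrow> snd x < snd y"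
  using XY by (auto simp: below_def)

lemma neq: "x \<in> X \<Longrightarrow> snd x \<noteq> snd a" "x \<in> X \<Longrightarrow> fst x \<noteq> fst b"
  "y \<in> Y \<Longrightarrow> fst y \<noteq> fst a" "y \<in> Y \<Longrightarrow> snd y \<noteq> snd b"
proof -
  show "snd x \<noteq> snd a" if "x \<in> X" using genericD(2)[OF gen, of x a] sub notin that by blast
  show "fst x \<noteq> fst b" if "x \<in> X" using genericD(1)[OF gen, of x b] sub notin that by blast
  show "fst y \<noteq> fst a" if "y \<in> Y" using genericD(1)[OF gen, of y a] sub notin that by blast
  show "snd y \<noteq> snd b" if "y \<in> Y" using genericD(2)[OF gen, of y b] sub notin that by blast
qed

lemma card_T: "card T = card X + card Y + 2"
  using fin notin T_eq by (simp add: card_Un_disjoint)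

lemma ninv_T: "ninv T = ninv X + cross {a} X + cross {b} X + ninv Y + cross {a} Y + cross {b} Y + 1"
proof -
  have "cross X Y = 0" using XY by (intro cross_none) (simp add: below_not_inverted)
  moreover have "cross {a} {b} = 1" using ab cross_full[of "{a}" "{b}"] by (simp add: inverted_def)
  moreover have "cross {a} (insert b (X \<union> Y)) = cross {a} {b} + (cross {a} X + cross {a} Y)"
    using cross_Un2[of "{a}" "{b}" "X \<union> Y"] cross_Un2[of "{a}" X Y] fin notin by simp
  moreover have "cross {b} (X \<union> Y) = cross {b} X + cross {b} Y"
    using cross_Un2[of "{b}" X Y] fin notin by simp
  ultimately show ?thesis
    using ninv_insert[of "insert b (X \<union> Y)" a] ninv_insert[of "X \<union> Y" b] ninv_Un[of X Y] fin notin T_eq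
    by simp
qed

lemma dsum_Xb: assumes "dsum (insert b X)" shows "dsum (T - {a})"
proof -
  obtain C D where CD: "C \<noteq> {}" "D \<noteq> {}" "insert b X = C \<union> D" "C \<inter> D = {}" "\<forall>p\<in>C. \<forall>q\<in>D. p \<lless> q"
    using assms by (rule dsumE)
  have "b \<notin> C"
  proof
    assume "b \<in> C"
    obtain q where q: "q \<in> D" using CD(2) by auto
    then have "b \<lless> q" "q \<in> insert b X" using \<open>b \<in> C\<close> CD(3,5) by auto
    then show False using Xab(2)[of q] by (auto simp: below_def)
  qed
  then have "C \<subseteq> X" using CD by auto
  then show ?thesis using CD XY T_eq notin by (intro dsumI[of C "D \<union> Y"]) auto
qed

end

lemma (in cut) dsum_Xa: assumes "dsum (insert a X)" shows "dsum (T - {b})"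
proof -
  have "dsum (insert (sw a) (sw ` X))" using assms sym_dsum(1)[of "insert a X"] by simp
  then show ?thesis using cut.dsum_Xb[OF swap_cut] by (simp only: sym_remove sym_dsum)
qed

lemma (in cut) dsum_Ya: assumes "dsum (insert a Y)" shows "dsum (T - {b})"
proof -
  have "dsum (insert (ng a) (ng ` Y))" using assms sym_dsum(2)[of "insert a Y"] by simp
  then show ?thesis using cut.dsum_Xb[OF neg_cut] by (simp only: sym_remove sym_dsum)
qed

section \<open>The linking pair has a point that is not extreme\<close>

lemma reducibleI: "dsum (T - {e}) \<Longrightarrow> extreme T e \<Longrightarrow> reducible T"
  unfolding reducible_def by blast

context cut
begin

lemma gen_XY:
  "p \<in> X \<union> Y \<Longrightarrow> q \<in> X \<union> Y \<Longrightarrow> snd p \<noteq> snd q \<Longrightarrow> fst p \<noteq> fst q"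
  "p \<in> X \<union> Y \<Longrightarrow> q \<in> X \<union> Y \<Longrightarrow> fst p \<noteq> fst q \<Longrightarrow> snd p \<noteq> snd q"
  using genericD[OF gen, of p q] sub by blast+

lemma not_right_A:
  assumes av: "avoids T" and nr: "\<not> right T a" and x: "x \<in> X" "x' \<in> X" "snd x < snd a" "snd a < snd x'"
  shows "fst x' < fst x"
proof (rule ccontr)
  assume "\<not> ?thesis"
  moreover have "fst x \<noteq> fst x'" by (rule gen_XY) (use x in auto)
  ultimately have lt: "fst x < fst x'" by simp
  from nr obtain q where q: "q \<in> T" "fst a < fst q" unfolding right_def using sub by force
  then have "q \<in> Y" using T_eq Xab(1)[of q] ab by auto
  then show False using avoidsD[OF av, of x x' a q] x sub q lt Xab(1)[of x'] XY_coord[of x' q] by auto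
qed

lemma not_low_A:
  assumes av: "avoids T" and nl: "\<not> low T a" and y: "y \<in> Y" "y' \<in> Y" "fst y < fst a" "fst a < fst y'"
  shows "snd y' < snd y"
proof (rule ccontr)
  assume "\<not> ?thesis"
  moreover have "snd y \<noteq> snd y'" by (rule gen_XY) (use y in auto)
  ultimately have lt: "snd y < snd y'" by simp
  from nl obtain q where q: "q \<in> T" "snd q < snd a" unfolding low_def using sub by force
  then have "q \<in> X" using T_eq Yab(2)[of q] ab by auto
  then show False using avoidsD[OF av, of q y a y'] y sub q lt Yab(2)[of y] XY_coord[of q y] by auto
qed

text \<open>
  If \<open>a\<close> is neither lowest nor rightmost, there is a point of \<open>X\<close> below it
  and a point of \<open>Y\<close> to its right. Together with \<open>a\<close>, the latter would
  complete an increasing pair of \<open>X\<close> around the height of \<open>a\<close> to a 1324,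
  so the points of \<open>X\<close> above \<open>a\<close> all lie to the left of those below
  \<open>a\<close>; symmetrically for \<open>Y\<close>. This forces many inversions inside
  \<open>X\<close> and \<open>Y\<close>.
\<close>

lemma a_split:
  assumes "avoids T" "\<not> low T a" "\<not> right T a"
  shows "X = {x \<in> X. snd a < snd x} \<union> {x \<in> X. snd x < snd a}"
    and "Y = {y \<in> Y. fst y < fst a} \<union> {y \<in> Y. fst a < fst y}"
    and "{x \<in> X. snd x < snd a} \<noteq> {}" and "{y \<in> Y. fst a < fst y} \<noteq> {}"
    and "\<And>x x'. x \<in> {x \<in> X. snd a < snd x} \<Longrightarrow> x' \<in> {x \<in> X. snd x < snd a} \<Longrightarrow> fst x < fst x' \<and> snd x' < snd x"
    and "\<And>y y'. y \<in> {y \<in> Y. fst y < fst a} \<Longrightarrow> y' \<in> {y \<in> Y. fst a < fst y} \<Longrightarrow> fst y < fst y' \<and> snd y' < snd y"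
    and "cross {a} X = card {x \<in> X. snd a < snd x}" and "cross {a} Y = card {y \<in> Y. fst y < fst a}"
proof -
  show "X = {x \<in> X. snd a < snd x} \<union> {x \<in> X. snd x < snd a}" using neq(1) by force
  show "Y = {y \<in> Y. fst y < fst a} \<union> {y \<in> Y. fst a < fst y}" using neq(3) by force
  obtain q where q: "q \<in> T" "snd q < snd a" using assms(2) unfolding low_def using sub by force
  then have "q \<in> X" using T_eq Yab(2)[of q] ab by auto
  then show "{x \<in> X. snd x < snd a} \<noteq> {}" using q by blast
  obtain q where q: "q \<in> T" "fst a < fst q" using assms(3) unfolding right_def using sub by force
  then have "q \<in> Y" using T_eq Xab(1)[of q] ab by auto
  then show "{y \<in> Y. fst a < fst y} \<noteq> {}" using q by blast
  have "{x \<in> X. inverted a x} = {x \<in> X. snd a < snd x}" using Xab(1) by (fastforce simp: inverted_def)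
  then show "cross {a} X = card {x \<in> X. snd a < snd x}" by (simp add: cross_single)
  have "{y \<in> Y. inverted a y} = {y \<in> Y. fst y < fst a}" using Yab(2) by (fastforce simp: inverted_def)
  then show "cross {a} Y = card {y \<in> Y. fst y < fst a}" by (simp add: cross_single)
qed (use not_right_A[OF assms(1,3)] not_low_A[OF assms(1,2)] in auto)

text \<open>
  If removing \<open>b\<close> does not help, then all four parts \<open>X1\<close>,
  \<open>X2\<close>, \<open>Y1\<close>, \<open>Y2\<close> into which \<open>a\<close> divides
  \<open>X\<close> and \<open>Y\<close> are nonempty. The inversions between \<open>X1\<close> and
  \<open>X2\<close>, between \<open>Y1\<close> and \<open>Y2\<close>, and between \<open>b\<close>
  and all of \<open>Y\<close> leave so few others that \<open>X1\<close> is a single point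
  \<open>z\<close> and that \<open>X2\<close> with \<open>b\<close> is decomposable. This
  decomposition extends to everything but \<open>z\<close>, and \<open>z\<close> turns out to be
  leftmost.
\<close>

lemma reducible_b_high:
  assumes av: "avoids T" and nd: "\<not> dsum T" and nl: "\<not> low T a" "\<not> right T a" and hb: "high T b"
    and few: "ninv T + 7 \<le> 2 * card T"
  shows "reducible T"
proof (cases "dsum (T - {b})")
  case True
  then show ?thesis using hb reducibleI[of T b] by (simp add: extreme_def)
next
  case nb: False
  define X1 where "X1 = {x \<in> X. snd a < snd x}"
  define X2 where "X2 = {x \<in> X. snd x < snd a}"
  define Y1 where "Y1 = {y \<in> Y. fst y < fst a}"
  define Y2 where "Y2 = {y \<in> Y. fst a < fst y}"
  note as = a_split[OF av nl, folded X1_def X2_def Y1_def Y2_def]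
  have sp: "X = X1 \<union> X2" "X1 \<inter> X2 = {}" "Y = Y1 \<union> Y2" "Y1 \<inter> Y2 = {}"
    "X2 \<noteq> {}" "Y2 \<noteq> {}"
    using as(1-4) by (auto simp: X1_def X2_def Y1_def Y2_def)
  have mem: "\<And>x. x \<in> X1 \<longleftrightarrow> x \<in> X \<and> snd a < snd x" "\<And>x. x \<in> X2 \<longleftrightarrow> x \<in> X \<and> snd x < snd a"
    "\<And>y. y \<in> Y1 \<longleftrightarrow> y \<in> Y \<and> fst y < fst a" "\<And>y. y \<in> Y2 \<longleftrightarrow> y \<in> Y \<and> fst a < fst y"
    by (auto simp: X1_def X2_def Y1_def Y2_def)
  note o1 = as(5) and o2 = as(6) and c = as(7,8)
  have f: "finite X1" "finite X2" "finite Y1" "finite Y2"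
    using fin by (simp_all add: X1_def X2_def Y1_def Y2_def)
  have X1: "X1 \<noteq> {}"
  proof
    assume "X1 = {}"
    then have "snd x < snd a" if "x \<in> X" for x using that sp(1) mem(2)[of x] \<open>X1 = {}\<close> by blast
    then have "dsum (insert a X)" using Xab(1) X_ne by (intro dsumI[of X "{a}"]) (auto simp: below_def)
    then show False using dsum_Xa nb by simp
  qed
  have Y1: "Y1 \<noteq> {}"
  proof
    assume "Y1 = {}"
    then have "fst a < fst y" if "y \<in> Y" for y using that sp(3) mem(4)[of y] \<open>Y1 = {}\<close> by blast
    then have "dsum (insert a Y)" using Yab(2) Y_ne by (intro dsumI[of "{a}" Y]) (auto simp: below_def)
    then show False using dsum_Ya nb by simp
  qed
  have "cross X1 X2 = card X1 * card X2" using o1 by (intro cross_full) (auto simp: inverted_def)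
  then have iX: "ninv X = ninv X1 + ninv X2 + card X1 * card X2" using ninv_Un[OF f(1,2) sp(2)] sp(1) by simp
  have "cross Y1 Y2 = card Y1 * card Y2" using o2 by (intro cross_full) (auto simp: inverted_def)
  then have iY: "ninv Y = ninv Y1 + ninv Y2 + card Y1 * card Y2" using ninv_Un[OF f(3,4) sp(4)] sp(3) by simp
  have cX: "card X = card X1 + card X2" and cY: "card Y = card Y1 + card Y2"
    using sp(1-4) f by (simp_all add: card_Un_disjoint)
  have "snd y < snd b" if "y \<in> Y" for y using hb that sub neq(4)[OF that] unfolding high_def by force
  then have bY: "cross {b} Y = card Y" using cross_full[of "{b}" Y] Yab(1) by (auto simp: inverted_def)
  have pos: "card X1 \<ge> 1" "card X2 \<ge> 1" "card Y1 \<ge> 1" "card Y2 \<ge> 1"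
    using X1 Y1 sp(5,6) f by (simp_all add: Suc_le_eq card_gt_0_iff)
  \<comment> \<open>The bound on the inversions, with the forced ones inserted.\<close>
  have main: "ninv X2 + card X1 * card X2 + cross {b} X + card Y1 * card Y2 + 4 \<le> card X1 + 2 * card X2 + card Y2"
    using few unfolding ninv_T card_T iX iY c bY cX cY by simp
  have "card Y1 * card Y2 \<ge> card Y2" using pos by simp
  then have main2: "ninv X2 + card X1 * card X2 + cross {b} X + 4 \<le> card X1 + 2 * card X2"
    using main by linarith
  have x1: "card X1 = 1"
  proof (rule ccontr)
    assume "card X1 \<noteq> 1"
    then obtain u where u: "card X1 = u + 2" using pos by (metis add.commute le_Suc_ex nat_1_add_1 not_less_eq_eq order_antisym_conv Suc_1 One_nat_def)
    obtain w where w: "card X2 = w + 1" using pos by (metis add.commute le_Suc_ex)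
    show False using main2 unfolding u w by (simp add: algebra_simps)
  qed
  then obtain z where z: "X1 = {z}" using card_1_singletonE by metis
  have small: "ninv X2 + cross {b} X + 3 \<le> card X2" using main2 x1 by simp
  have zX: "z \<in> X" using z sp(1) by auto
  have bX2: "b \<notin> X2" using notin sp(1) by auto
  have "cross {b} X2 \<le> cross {b} X"
    using cross_Un2[of "{b}" X1 X2] f sp(1,2) by simp
  then have "ninv (insert b X2) + 1 < card (insert b X2)"
    using ninv_insert[OF f(2) bX2] f bX2 small by simp
  moreover have "generic (insert b X2)" using generic_subset[OF gen, of "insert b X2"] sub sp(1) by auto
  ultimately have "dsum (insert b X2)" using indecomposable_ninv[of "insert b X2"] by fastforce
  then obtain C D where CD: "C \<noteq> {}" "D \<noteq> {}" "insert b X2 = C \<union> D" "C \<inter> D = {}" "\<forall>p\<in>C. \<forall>q\<in>D. p \<lless> q"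
    by (rule dsumE)
  have "b \<notin> C"
  proof
    assume "b \<in> C"
    obtain q where q: "q \<in> D" using CD(2) by auto
    then have "b \<lless> q" "q \<in> insert b X2" using \<open>b \<in> C\<close> CD(3,5) by auto
    then show False using Xab(2)[of q] sp(1) by (auto simp: below_def)
  qed
  then have CX2: "C \<subseteq> X2" using CD by auto
  have "dsum (T - {z})"
  proof (rule dsumI[of C "(D \<union> Y \<union> {a}) - {z}"])
    show "(D \<union> Y \<union> {a}) - {z} \<noteq> {}" using notin zX by auto
    have "z \<notin> C" using CX2 z sp(2) by auto
    moreover have "T = C \<union> (D \<union> Y \<union> {a}) \<union> {z}" using T_eq sp(1) CD(3) z by auto
    ultimately show "T - {z} = C \<union> ((D \<union> Y \<union> {a}) - {z})" by auto
    fix p q assume p: "p \<in> C" and q: "q \<in> (D \<union> Y \<union> {a}) - {z}"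
    have "p \<in> X" "p \<in> X2" "snd p < snd a" using p CX2 mem(2)[of p] by auto
    then show "p \<lless> q" using q CD(5) p XY[of p q] Xab(1)[of p] by (auto simp: below_def)
  qed (use CD in auto)
  moreover have "left T z"
    unfolding left_def
  proof (intro conjI ballI)
    show "z \<in> T" using zX sub by auto
    fix q assume "q \<in> T"
    then consider "q = a" | "q = b" | "q = z" | "q \<in> X2" | "q \<in> Y" using T_eq sp(1) z by auto
    then show "fst z \<le> fst q"
    proof cases
      case 2
      show ?thesis
      proof (rule ccontr)
        assume "\<not> ?thesis"
        then have "fst b < fst z" using 2 by simp
        then have "inverted b x" if "x \<in> X" for x
          using that Xab(2)[of x] o1[of z x] z sp(1) by (auto simp: inverted_def)
        then have "cross {b} X = card X" using cross_full[of "{b}" X] by simp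
        then show False using small cX by simp
      qed
    qed (use Xab(1)[OF zX] o1[of z q] z XY_coord[OF zX, of q] in auto)
  qed
  ultimately show ?thesis using reducibleI[of T z] by (simp add: extreme_def)
qed

text \<open>
  The counterpart of \<open>a_split\<close> for \<open>b\<close>.
\<close>

lemma not_extreme_b_split:
  assumes av: "avoids T" and nb: "\<not> left T b" "\<not> high T b"
  shows "\<exists>x\<in>X. fst x < fst b" "\<exists>y\<in>Y. snd b < snd y"
    "\<And>x x'. x \<in> X \<Longrightarrow> x' \<in> X \<Longrightarrow> fst x < fst b \<Longrightarrow> fst b < fst x' \<Longrightarrow> snd x' < snd x"
    "\<And>y y'. y \<in> Y \<Longrightarrow> y' \<in> Y \<Longrightarrow> snd y < snd b \<Longrightarrow> snd b < snd y' \<Longrightarrow> fst y' < fst y"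
proof -
  obtain q where q: "q \<in> T" "fst q < fst b" using nb(1) unfolding left_def using sub by force
  then have "q \<in> X" using T_eq Yab(1)[of q] ab by auto
  then show 1: "\<exists>x\<in>X. fst x < fst b" using q by blast
  obtain q where q: "q \<in> T" "snd b < snd q" using nb(2) unfolding high_def using sub by force
  then have "q \<in> Y" using T_eq Xab(2)[of q] ab by auto
  then show 2: "\<exists>y\<in>Y. snd b < snd y" using q by blast
  show "snd x' < snd x" if x: "x \<in> X" "x' \<in> X" "fst x < fst b" "fst b < fst x'" for x x'
  proof (rule ccontr)
    assume "\<not> ?thesis"
    moreover have "snd x \<noteq> snd x'" by (rule gen_XY) (use x in auto)
    ultimately have lt: "snd x < snd x'" by simp
    obtain y where y: "y \<in> Y" "snd b < snd y" using 2 by auto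
    show False using avoidsD[OF av, of x b x' y] x y sub lt Xab(2)[of x'] XY_coord[of x' y] by auto
  qed
  show "fst y' < fst y" if y: "y \<in> Y" "y' \<in> Y" "snd y < snd b" "snd b < snd y'" for y y'
  proof (rule ccontr)
    assume "\<not> ?thesis"
    moreover have "fst y \<noteq> fst y'" by (rule gen_XY) (use y in auto)
    ultimately have lt: "fst y < fst y'" by simp
    obtain x where x: "x \<in> X" "fst x < fst b" using 1 by auto
    show False using avoidsD[OF av, of x b y y'] x y sub lt Yab(1)[of y] XY_coord[of x y] by auto
  qed
qed

text \<open>
  If \<open>b\<close> and \<open>a\<close> are not extreme and no point of \<open>X\<close> is to
  the left of \<open>b\<close> and below \<open>a\<close>, then \<open>X\<close> consists of the
  points \<open>X3\<close> left of \<open>b\<close>, the points \<open>X2\<close> below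
  \<open>a\<close> and the remaining ones \<open>M\<close>, and any two points from different parts
  are inverted. So \<open>X\<close> and its links to \<open>a\<close>, \<open>b\<close> use up about
  twice as many inversions as it has points, and few are left for \<open>Y\<close>.
\<close>

lemma heavy_lower_half:
  assumes av: "avoids T" and na: "\<not> low T a" "\<not> right T a" and nb: "\<not> left T b" "\<not> high T b"
    and noC: "\<And>x. x \<in> X \<Longrightarrow> fst x < fst b \<Longrightarrow> snd a < snd x"
  shows "2 * card X \<le> ninv X + cross {a} X + cross {b} X + 1"
proof -
  define X1 where "X1 = {x \<in> X. snd a < snd x}"
  define X2 where "X2 = {x \<in> X. snd x < snd a}"
  define Y1 where "Y1 = {y \<in> Y. fst y < fst a}"
  define Y2 where "Y2 = {y \<in> Y. fst a < fst y}"
  note as = a_split[OF av na, folded X1_def X2_def Y1_def Y2_def]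
  have sp: "X = X1 \<union> X2" "X1 \<inter> X2 = {}" "Y = Y1 \<union> Y2" "Y1 \<inter> Y2 = {}"
    "X2 \<noteq> {}" "Y2 \<noteq> {}"
    using as(1-4) by (auto simp: X1_def X2_def Y1_def Y2_def)
  have mem: "\<And>x. x \<in> X1 \<longleftrightarrow> x \<in> X \<and> snd a < snd x" "\<And>x. x \<in> X2 \<longleftrightarrow> x \<in> X \<and> snd x < snd a"
    "\<And>y. y \<in> Y1 \<longleftrightarrow> y \<in> Y \<and> fst y < fst a" "\<And>y. y \<in> Y2 \<longleftrightarrow> y \<in> Y \<and> fst a < fst y"
    by (auto simp: X1_def X2_def Y1_def Y2_def)
  note o1 = as(5) and o2 = as(6) and c = as(7,8)
  note bs = not_extreme_b_split[OF av nb]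
  define X3 where "X3 = {x \<in> X. fst x < fst b}"
  define X4 where "X4 = {x \<in> X. fst b < fst x}"
  define M where "M = X1 - X3"
  have X34: "X = X3 \<union> X4" "X3 \<inter> X4 = {}"
  proof -
    have "x \<in> X3 \<or> x \<in> X4" if "x \<in> X" for x using neq(2)[of x] that unfolding X3_def X4_def by auto
    then show "X = X3 \<union> X4" unfolding X3_def X4_def by blast
  qed (auto simp: X3_def X4_def)
  have X3: "X3 \<subseteq> X1" "X3 \<noteq> {}" using noC bs(1) mem(1) unfolding X3_def by auto
  have X4: "X4 = M \<union> X2" "M \<inter> X2 = {}" "X1 = X3 \<union> M" "X3 \<inter> M = {}" using X34 X3 sp(1,2) unfolding M_def by blast+
  have f: "finite X1" "finite X2" "finite X3" "finite M" "finite X4"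
    using fin by (simp_all add: X1_def X2_def X3_def X4_def M_def)
  have "inverted b x \<longleftrightarrow> x \<in> X4" if "x \<in> X" for x
    using that Xab(2)[of x] unfolding X4_def inverted_def by auto
  then have "{x \<in> X. inverted b x} = X4" using X34 by auto
  then have c4: "cross {b} X = card X4" by (simp add: cross_single)
  have "inverted x x'" if "x \<in> X3" "x' \<in> X4" for x x'
    using bs(3)[of x x'] that unfolding X3_def X4_def inverted_def by auto
  then have "cross X3 X4 = card X3 * card X4" by (rule cross_full)
  moreover have "cross M X2 = card M * card X2" using o1 X4(3) by (intro cross_full) (auto simp: inverted_def)
  ultimately have i: "ninv X \<ge> card X3 * card X4 + card M * card X2"
    using ninv_Un[OF f(3,5) X34(2)] X34(1) ninv_Un[OF f(4,2) X4(2)] X4(1) by simp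
  have k: "card X = card X3 + card X4" "card X4 = card M + card X2" "card X1 = card X3 + card M"
    using X34 X4 f by (simp_all add: card_Un_disjoint)
  obtain u where u: "card X3 = u + 1" using X3 f by (metis Suc_eq_plus1 card_0_eq not0_implies_Suc)
  obtain v where v: "card X2 = v + 1" using sp(5) f by (metis Suc_eq_plus1 card_0_eq not0_implies_Suc)
  have "ninv X \<ge> (u + 1) * (card M + (v + 1)) + card M * (v + 1)" using i unfolding k u v .
  then show ?thesis unfolding c c4 k u v by (simp add: algebra_simps)
qed

end

lemma (in cut) heavy_upper_half:
  assumes av: "avoids T" and na: "\<not> low T a" "\<not> right T a" and nb: "\<not> left T b" "\<not> high T b"
    and noC: "\<And>y. y \<in> Y \<Longrightarrow> fst a < fst y \<Longrightarrow> snd y < snd b"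
  shows "2 * card Y \<le> ninv Y + cross {a} Y + cross {b} Y + 1"
proof -
  interpret N: cut "ng ` T" "ng ` Y" "ng ` X" "ng b" "ng a" by (rule neg_cut)
  have "cross {ng a} (ng ` Y) = cross {a} Y" "cross {ng b} (ng ` Y) = cross {b} Y"
    using cross_image[of ng "{a}" Y] cross_image[of ng "{b}" Y] by simp_all
  moreover have "2 * card (ng ` Y) \<le> ninv (ng ` Y) + cross {ng b} (ng ` Y) + cross {ng a} (ng ` Y) + 1"
  proof (rule N.heavy_lower_half)
    fix x assume "x \<in> ng ` Y" "fst x < fst (ng a)"
    then show "snd (ng b) < snd x" using noC by auto
  qed (simp_all add: av na nb)
  ultimately show ?thesis using fin by simp
qed

text \<open>
  By \<open>heavy_lower_half\<close> the upper half is light. Then some point of \<open>Y\<close> is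
  to the right of \<open>a\<close> and above \<open>b\<close>, for otherwise the upper half would be
  heavy too. Let \<open>Z\<close> be the set of all such points. The other points of
  \<open>Y\<close> are inverted with all of \<open>Z\<close>, so counting leaves room for at most
  one of them; it is highest or rightmost, and once it is removed \<open>Z\<close> lies above
  everything else.
\<close>

lemma (in cut) reducible_inner_low:
  assumes av: "avoids T" and nd: "\<not> dsum T" and na: "\<not> low T a" "\<not> right T a" and nb: "\<not> left T b" "\<not> high T b"
    and few: "ninv T + 7 \<le> 2 * card T"
    and noC: "\<And>x. x \<in> X \<Longrightarrow> fst x < fst b \<Longrightarrow> snd a < snd x"
  shows "reducible T"
proof -
  have light: "ninv Y + cross {a} Y + cross {b} Y + 3 \<le> 2 * card Y"
    using heavy_lower_half[OF av na nb noC] few unfolding ninv_T card_T by simp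
  \<comment> \<open>Both halves together cannot be heavy.\<close>
  have "\<exists>y\<in>Y. fst a < fst y \<and> snd b < snd y"
  proof (rule ccontr)
    assume n: "\<not> ?thesis"
    have "snd y < snd b" if "y \<in> Y" "fst a < fst y" for y using n neq(4)[of y] that by force
    from heavy_upper_half[OF av na nb this] light show False by linarith
  qed
  then obtain y0 where y0: "y0 \<in> Y" "fst a < fst y0" "snd b < snd y0" by auto
  define X1 where "X1 = {x \<in> X. snd a < snd x}"
  define X2 where "X2 = {x \<in> X. snd x < snd a}"
  define Y1 where "Y1 = {y \<in> Y. fst y < fst a}"
  define Y2 where "Y2 = {y \<in> Y. fst a < fst y}"
  note as = a_split[OF av na, folded X1_def X2_def Y1_def Y2_def]
  have sp: "X = X1 \<union> X2" "X1 \<inter> X2 = {}" "Y = Y1 \<union> Y2" "Y1 \<inter> Y2 = {}"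
    "X2 \<noteq> {}" "Y2 \<noteq> {}"
    using as(1-4) by (auto simp: X1_def X2_def Y1_def Y2_def)
  have mem: "\<And>x. x \<in> X1 \<longleftrightarrow> x \<in> X \<and> snd a < snd x" "\<And>x. x \<in> X2 \<longleftrightarrow> x \<in> X \<and> snd x < snd a"
    "\<And>y. y \<in> Y1 \<longleftrightarrow> y \<in> Y \<and> fst y < fst a" "\<And>y. y \<in> Y2 \<longleftrightarrow> y \<in> Y \<and> fst a < fst y"
    by (auto simp: X1_def X2_def Y1_def Y2_def)
  note o1 = as(5) and o2 = as(6) and c = as(7,8)
  note bs = not_extreme_b_split[OF av nb]
  define Y4 where "Y4 = {y \<in> Y. snd y < snd b}"
  define Z where "Z = {y \<in> Y. fst a < fst y \<and> snd b < snd y}"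
  have y0Z: "y0 \<in> Z" using y0 by (auto simp: Z_def)
  have Y1b: "snd b < snd y" if "y \<in> Y1" for y using o2[OF that, of y0] y0 mem(4)[of y0] by auto
  have Y4a: "fst a < fst y" if "y \<in> Y4" for y using bs(4)[of y y0] y0 that unfolding Y4_def by auto
  have Y2: "Y2 = Z \<union> Y4" "Z \<inter> Y4 = {}"
  proof -
    have "y \<in> Z \<or> y \<in> Y4" if "y \<in> Y2" for y using neq(4)[of y] that mem(4)[of y] unfolding Z_def Y4_def by auto
    moreover have "Z \<subseteq> Y2" "Y4 \<subseteq> Y2" using mem(4) Y4a unfolding Z_def Y4_def by auto
    ultimately show "Y2 = Z \<union> Y4" by blast
  qed (auto simp: Z_def Y4_def)
  have f: "finite Y1" "finite Y2" "finite Z" "finite Y4"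
    using fin by (simp_all add: Y1_def Y2_def Z_def Y4_def)
  have "inverted b y \<longleftrightarrow> snd y < snd b" if "y \<in> Y" for y using Yab(1)[OF that] by (auto simp: inverted_def)
  then have "{y \<in> Y. inverted b y} = Y4" unfolding Y4_def by auto
  then have c4: "cross {b} Y = card Y4" by (simp add: cross_single)
  have ZY4: "fst y < fst y' \<and> snd y' < snd y" if "y \<in> Z" "y' \<in> Y4" for y y'
    using bs(4)[of y' y] that unfolding Z_def Y4_def by auto
  have "cross Y1 Y2 = card Y1 * card Y2" using o2 by (intro cross_full) (auto simp: inverted_def)
  moreover have "cross Z Y4 = card Z * card Y4" using ZY4 by (intro cross_full) (auto simp: inverted_def)
  ultimately have i: "ninv Y \<ge> card Y1 * card Y2 + card Z * card Y4"
    using ninv_Un[OF f(1,2) sp(4)] sp(3) ninv_Un[OF f(3,4) Y2(2)] Y2(1) by simp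
  have k: "card Y = card Y1 + card Y2" "card Y2 = card Z + card Y4"
    using sp(3,4) Y2 f by (simp_all add: card_Un_disjoint)
  obtain z where z: "card Z = z + 1" using y0Z f by (metis Suc_eq_plus1 card_0_eq empty_iff not0_implies_Suc)
  have main: "card Y1 * (z + 1 + card Y4) + (z + 1) * card Y4 + card Y1 + card Y4 + 3 \<le> 2 * (card Y1 + (z + 1 + card Y4))"
    using light i unfolding c c4 k z by simp
  \<comment> \<open>With \<open>Y1\<close> of size \<open>u\<close> and \<open>Y4\<close> of size \<open>v\<close> the bound reads \<open>u (z + 1 + v) + (z + 1) v + 1 \<le> u + 2 z + v\<close>.\<close>
  have "card Y1 + card Y4 \<le> 1"
  proof (rule ccontr)
    assume "\<not> ?thesis"
    then consider "card Y1 \<ge> 1" "card Y4 \<ge> 1" | "card Y1 \<ge> 2" "card Y4 = 0" | "card Y4 \<ge> 2" "card Y1 = 0"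
      by linarith
    then consider u v where "card Y1 = u + 1" "card Y4 = v + 1" | u where "card Y1 = u + 2" "card Y4 = 0"
      | u where "card Y4 = u + 2" "card Y1 = 0"
      by (metis add.commute le_Suc_ex)
    then show False
      by cases (use main in \<open>simp_all add: algebra_simps\<close>)
  qed
  then consider "card Y1 = 0" "card Y4 = 0" | "card Y1 = 1" "card Y4 = 0" | "card Y4 = 1" "card Y1 = 0"
    by linarith
  then consider "Y1 = {}" "Y4 = {}" | y where "Y1 = {y}" "Y4 = {}" | y where "Y4 = {y}" "Y1 = {}"
    using f by (metis card_0_eq card_1_singletonE)
  moreover have split: "p \<lless> q" if "p \<in> insert a (insert b X)" "q \<in> Z" for p q
  proof -
    have q: "q \<in> Y" "fst a < fst q" "snd b < snd q" using that(2) by (auto simp: Z_def)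
    then show ?thesis using that(1) XY[of p q] Yab[of q] by (auto simp: below_def)
  qed
  ultimately show ?thesis
  proof cases
    case 1
    then have YZ: "Y = Z" using sp(3) Y2 by simp
    have "dsum T"
    proof (rule dsumI[of "insert a (insert b X)" Z])
      show "T = insert a (insert b X) \<union> Z" unfolding T_eq YZ by auto
    qed (use split y0Z in auto)
    then show ?thesis using nd by simp
  next
    case (2 y)
    have YZ: "Y = insert y Z" "y \<notin> Z" using sp(3,4) Y2 2 by auto
    have "y \<in> Y" using YZ by auto
    have "dsum (T - {y})"
    proof (rule dsumI[of "insert a (insert b X)" Z])
      show "T - {y} = insert a (insert b X) \<union> Z" unfolding T_eq using YZ notin by auto
    qed (use split y0Z in auto)
    moreover have "high T y"
      unfolding high_def
    proof (intro conjI ballI)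
      show "y \<in> T" using YZ sub by auto
      fix q assume "q \<in> T"
      then consider "q = a" | "q = b" | "q = y" | "q \<in> Z" | "q \<in> X" unfolding T_eq using YZ(1) by blast
      then show "snd q \<le> snd y"
      proof cases
        case 4
        then have "q \<in> Y2" "y \<in> Y1" using Y2(1) 2 by auto
        then show ?thesis using o2[of y q] by simp
      qed (use Y1b[of y] 2 ab XY_coord[of q y] \<open>y \<in> Y\<close> in auto)
    qed
    ultimately show ?thesis using reducibleI[of T y] by (simp add: extreme_def)
  next
    case (3 y)
    have YZ: "Y = insert y Z" "y \<notin> Z" using sp(3,4) Y2 3 by auto
    have "y \<in> Y" using YZ by auto
    have "dsum (T - {y})"
    proof (rule dsumI[of "insert a (insert b X)" Z])
      show "T - {y} = insert a (insert b X) \<union> Z" unfolding T_eq using YZ notin by auto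
    qed (use split y0Z in auto)
    moreover have "right T y"
      unfolding right_def
    proof (intro conjI ballI)
      show "y \<in> T" using YZ sub by auto
      fix q assume "q \<in> T"
      then consider "q = a" | "q = b" | "q = y" | "q \<in> Z" | "q \<in> X" unfolding T_eq using YZ(1) by blast
      then show "fst q \<le> fst y"
      proof cases
        case 4
        then show ?thesis using ZY4[of q y] 3 by simp
      qed (use Y4a[of y] 3 ab XY_coord[of q y] \<open>y \<in> Y\<close> in auto)
    qed
    ultimately show ?thesis using reducibleI[of T y] by (simp add: extreme_def)
  qed
qed

section \<open>Few inversions force a removable extreme point\<close>

text \<open>
  This is \<open>reducible_b_high\<close> reflected in the antidiagonal, which fixes the roles of
  \<open>a\<close> and \<open>b\<close>.
\<close>

lemma (in cut) reducible_b_left: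
  assumes "avoids T" "\<not> dsum T" "\<not> low T a" "\<not> right T a" "left T b" "ninv T + 7 \<le> 2 * card T"
  shows "reducible T"
proof -
  interpret S: cut "sw ` T" "sw ` X" "sw ` Y" "sw b" "sw a" by (rule swap_cut)
  interpret N: cut "ng ` sw ` T" "ng ` sw ` Y" "ng ` sw ` X" "ng (sw a)" "ng (sw b)" by (rule S.neg_cut)
  have "reducible (ng ` sw ` T)"
    by (rule N.reducible_b_high) (use assms fin in \<open>simp_all only: sym_avoids sym_dsum sym_low sym_right
      sym_high sym_left sym_card sym_ninv finite_imageI simp_thms\<close>)
  then show ?thesis by (simp only: sym_reducible)
qed

lemma (in cut) reducible_a_extreme:
  assumes "avoids T" "\<not> dsum T" "\<not> left T b" "\<not> high T b" "low T a \<or> right T a" "ninv T + 7 \<le> 2 * card T"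
  shows "reducible T"
proof -
  interpret S: cut "sw ` T" "sw ` X" "sw ` Y" "sw b" "sw a" by (rule swap_cut)
  have "reducible (sw ` T)"
    using assms(5)
  proof
    assume "low T a"
    show ?thesis
      by (rule S.reducible_b_left) (use assms fin \<open>low T a\<close> in \<open>simp_all only: sym_avoids sym_dsum sym_low sym_right
      sym_high sym_left sym_card sym_ninv finite_imageI simp_thms\<close>)
  next
    assume "right T a"
    show ?thesis
      by (rule S.reducible_b_high) (use assms fin \<open>right T a\<close> in \<open>simp_all only: sym_avoids sym_dsum sym_low sym_right
      sym_high sym_left sym_card sym_ninv finite_imageI simp_thms\<close>)
  qed
  then show ?thesis by (simp only: sym_reducible)
qed

text \<open>
  A point of \<open>X\<close> left of \<open>b\<close> and below \<open>a\<close> and a point of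
  \<open>Y\<close> right of \<open>a\<close> and above \<open>b\<close> would form a 1324 with
  \<open>b\<close> and \<open>a\<close>. So one half contains no such point, and up to a half-turn
  it is the lower one.
\<close>

lemma (in cut) reducible_inner:
  assumes av: "avoids T" and nd: "\<not> dsum T" and na: "\<not> low T a" "\<not> right T a" and nb: "\<not> left T b" "\<not> high T b"
    and few: "ninv T + 7 \<le> 2 * card T"
  shows "reducible T"
proof (cases "\<forall>x\<in>X. fst x < fst b \<longrightarrow> snd a < snd x")
  case True
  then show ?thesis using reducible_inner_low[OF assms] by blast
next
  case False
  then obtain x where x: "x \<in> X" "fst x < fst b" "snd x < snd a" using neq(1) by force
  have noC: "snd y < snd b" if "y \<in> Y" "fst a < fst y" for y
  proof (rule ccontr)
    assume "\<not> ?thesis"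
    then have "snd b < snd y" using neq(4)[OF that(1)] by simp
    then show False using avoidsD[OF av, of x b a y] x that sub ab by auto
  qed
  interpret N: cut "ng ` T" "ng ` Y" "ng ` X" "ng b" "ng a" by (rule neg_cut)
  have "reducible (ng ` T)"
  proof (rule N.reducible_inner_low)
    fix x assume "x \<in> ng ` Y" "fst x < fst (ng a)"
    then show "snd (ng b) < snd x" using noC by auto
  qed (use assms fin in \<open>simp_all only: sym_avoids sym_dsum sym_low sym_right
      sym_high sym_left sym_card sym_ninv finite_imageI simp_thms\<close>)
  then show ?thesis by (simp only: sym_reducible)
qed

text \<open>
  If neither \<open>a\<close> nor \<open>b\<close> is removable, then \<open>X\<close> with
  \<open>b\<close> and \<open>Y\<close> with \<open>a\<close> are indecomposable, so
  \<open>indecomposable_ninv\<close> applies to both. As \<open>a\<close> is lowest it is also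
  inverted with all of \<open>X\<close>, and \<open>b\<close> with all of \<open>Y\<close>, which is
  too much.
\<close>

lemma (in cut) reducible_low_high:
  assumes nd: "\<not> dsum T" and e: "low T a" "high T b" and few: "ninv T + 7 \<le> 2 * card T"
  shows "reducible T"
proof (rule ccontr)
  assume nr: "\<not> reducible T"
  have "\<not> dsum (insert b X)" using dsum_Xb reducibleI[of T a] nr e by (auto simp: extreme_def)
  then have "card (insert b X) \<le> ninv (insert b X) + 1"
    using generic_subset[OF gen, of "insert b X"] sub by (intro indecomposable_ninv) auto
  then have 1: "card X \<le> ninv X + cross {b} X" using ninv_insert[of X b] fin notin by simp
  have "\<not> dsum (insert a Y)" using dsum_Ya reducibleI[of T b] nr e by (auto simp: extreme_def)
  then have "card (insert a Y) \<le> ninv (insert a Y) + 1"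
    using generic_subset[OF gen, of "insert a Y"] sub by (intro indecomposable_ninv) auto
  then have 2: "card Y \<le> ninv Y + cross {a} Y" using ninv_insert[of Y a] fin notin by simp
  have "snd a < snd x" if "x \<in> X" for x using that e(1) sub neq(1)[OF that] unfolding low_def by force
  then have 3: "cross {a} X = card X" using cross_full[of "{a}" X] Xab(1) by (auto simp: inverted_def)
  have "snd y < snd b" if "y \<in> Y" for y using that e(2) sub neq(4)[OF that] unfolding high_def by force
  then have 4: "cross {b} Y = card Y" using cross_full[of "{b}" Y] Yab(1) by (auto simp: inverted_def)
  have "ninv X + card X + cross {b} X + ninv Y + cross {a} Y + card Y + 8 \<le> 2 * card X + 2 * card Y + 4"
    using few unfolding ninv_T card_T 3 4 by simp
  then show False using 1 2 by simp
qed

lemma (in cut) reducible_right_left: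
  assumes "\<not> dsum T" "right T a" "left T b" "ninv T + 7 \<le> 2 * card T"
  shows "reducible T"
proof -
  interpret S: cut "sw ` T" "sw ` X" "sw ` Y" "sw b" "sw a" by (rule swap_cut)
  have "reducible (sw ` T)"
    by (rule S.reducible_low_high) (use assms fin in \<open>simp_all only: sym_avoids sym_dsum sym_low sym_right
      sym_high sym_left sym_card sym_ninv finite_imageI simp_thms\<close>)
  then show ?thesis by (simp only: sym_reducible)
qed

text \<open>
  Here every point of \<open>Y\<close> is inverted with \<open>a\<close> and with \<open>b\<close>,
  so deleting \<open>Y\<close> lowers the number of inversions by at least twice the number of
  points and keeps the assumption on few inversions. By induction \<open>X\<close> with
  \<open>a\<close> and \<open>b\<close> has a removable point, and a decomposition of a subset that
  contains \<open>a\<close> and \<open>b\<close> extends to \<open>Y\<close>, because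
  \<open>a\<close> and \<open>b\<close> belong to its upper summand.
\<close>

lemma (in cut) reducible_right_high:
  assumes av: "avoids T" and nd: "\<not> dsum T" and e: "right T a" "high T b" and few: "ninv T + 7 \<le> 2 * card T"
    and IH: "\<And>S. generic S \<Longrightarrow> avoids S \<Longrightarrow> \<not> dsum S \<Longrightarrow> ninv S + 7 \<le> 2 * card S \<Longrightarrow> card S < card T \<Longrightarrow> reducible S"
  shows "reducible T"
proof -
  let ?L = "insert a (insert b X)"
  have LT: "?L \<subseteq> T" using sub by auto
  \<comment> \<open>A decomposition of a set that contains \<open>a\<close> and \<open>b\<close> has both in its upper summand, so \<open>Y\<close> can be added there.\<close>
  have lift: "dsum (S \<union> Y)"
    if S: "S \<subseteq> ?L" "a \<in> S" "b \<in> S" "dsum S" for S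
  proof -
    obtain C D where CD: "C \<noteq> {}" "D \<noteq> {}" "S = C \<union> D" "C \<inter> D = {}" "\<forall>p\<in>C. \<forall>q\<in>D. p \<lless> q"
      using S(4) by (rule dsumE)
    obtain q where q: "q \<in> D" using CD(2) by auto
    have q': "q = a \<or> q = b \<or> q \<in> X" using q CD(3) S(1) by auto
    have pq: "fst p < fst q \<and> snd p < snd q" if "p \<in> C" for p using CD(5) that q by (simp add: below_def)
    have "a \<notin> C" using pq[of a] q' Xab(1)[of q] ab by auto
    moreover have "b \<notin> C" using pq[of b] q' Xab(2)[of q] ab by auto
    ultimately have "C \<subseteq> X" using CD(3) S(1) by auto
    then have CX: "p \<in> X" if "p \<in> C" for p using that by auto
    show ?thesis
    proof (rule dsumI[of C "D \<union> Y"])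
      show "S \<union> Y = C \<union> (D \<union> Y)" using CD(3) by auto
      show "p \<lless> q" if "p \<in> C" "q \<in> D \<union> Y" for p q
        using that CD(5) CX[of p] XY[of p q] by auto
    qed (use CD in auto)
  qed
  have ndL: "\<not> dsum ?L"
  proof
    assume "dsum ?L"
    then have "dsum (?L \<union> Y)" by (intro lift) auto
    then show False using nd T_eq by simp
  qed
  have cL: "card ?L = card X + 2" using fin notin by simp
  have "card Y > 0" using fin Y_ne by (simp add: card_gt_0_iff)
  have nL: "ninv ?L = ninv X + cross {a} X + cross {b} X + 1"
  proof -
    have "cross {a} {b} = 1" using ab cross_full[of "{a}" "{b}"] by (simp add: inverted_def)
    moreover have "cross {a} (insert b X) = cross {a} {b} + cross {a} X"
      using cross_Un2[of "{a}" "{b}" X] fin notin by simp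
    ultimately show ?thesis using ninv_insert[of "insert b X" a] ninv_insert[of X b] fin notin by simp
  qed
  have "fst y < fst a" if "y \<in> Y" for y using that e(1) sub neq(3)[OF that] unfolding right_def by force
  then have 3: "cross {a} Y = card Y" using cross_full[of "{a}" Y] Yab(2) by (auto simp: inverted_def)
  have "snd y < snd b" if "y \<in> Y" for y using that e(2) sub neq(4)[OF that] unfolding high_def by force
  then have 4: "cross {b} Y = card Y" using cross_full[of "{b}" Y] Yab(1) by (auto simp: inverted_def)
  have "ninv ?L + 7 \<le> 2 * card ?L" using few unfolding nL cL ninv_T card_T 3 4 by simp
  then have "reducible ?L"
    using IH[of ?L] generic_subset[OF gen LT] avoids_subset[OF av LT] ndL cL card_T \<open>card Y > 0\<close> by linarith
  then obtain z where z: "extreme ?L z" "dsum (?L - {z})" unfolding reducible_def by auto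
  then have "z \<in> ?L" unfolding extreme_def low_def high_def left_def right_def by auto
  then consider "z = a" | "z = b" | "z \<in> X" "z \<noteq> a" "z \<noteq> b" by auto
  then show ?thesis
  proof cases
    case 1
    then have "?L - {z} = insert b X" using notin by auto
    then have "dsum (T - {a})" using z dsum_Xb by simp
    then show ?thesis using e reducibleI[of T a] by (simp add: extreme_def)
  next
    case 2
    then have "?L - {z} = insert a X" using notin by auto
    then have "dsum (T - {b})" using z dsum_Xa by simp
    then show ?thesis using e reducibleI[of T b] by (simp add: extreme_def)
  next
    case 3
    have "\<not> high ?L z" "\<not> right ?L z" using Xab[OF 3(1)] by (auto simp: high_def right_def)
    then have "low T z \<or> left T z"
      using z(1) 3(1) T_eq XY_coord[OF 3(1)] unfolding extreme_def low_def left_def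
      by (auto simp: less_imp_le)
    moreover have "dsum (T - {z})"
    proof -
      have "dsum ((?L - {z}) \<union> Y)" using z(2) 3 by (intro lift) auto
      moreover have "T - {z} = (?L - {z}) \<union> Y" unfolding T_eq using 3 notin by auto
      ultimately show ?thesis by simp
    qed
    ultimately show ?thesis using reducibleI[of T z] by (auto simp: extreme_def)
  qed
qed

lemma (in cut) reducible_low_left:
  assumes av: "avoids T" and nd: "\<not> dsum T" and e: "low T a" "left T b" and few: "ninv T + 7 \<le> 2 * card T"
    and IH: "\<And>S. generic S \<Longrightarrow> avoids S \<Longrightarrow> \<not> dsum S \<Longrightarrow> ninv S + 7 \<le> 2 * card S \<Longrightarrow> card S < card T \<Longrightarrow> reducible S"
  shows "reducible T"
proof -
  interpret N: cut "ng ` T" "ng ` Y" "ng ` X" "ng b" "ng a" by (rule neg_cut)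
  have "reducible (ng ` T)"
    by (rule N.reducible_right_high) (use assms fin IH in \<open>simp_all only: sym_avoids sym_dsum sym_low sym_right
      sym_high sym_left sym_card sym_ninv finite_imageI simp_thms\<close>)
  then show ?thesis by (simp only: sym_reducible)
qed

subsection \<open>Finding a cut crossed by one pair\<close>

text \<open>
  Replacing coordinates by ranks turns a generic set into the diagram of a permutation.
\<close>

lemma rank_bij:
  fixes f :: "'a \<Rightarrow> int"
  assumes "finite T" "inj_on f T"
  shows "bij_betw (\<lambda>p. card {q \<in> T. f q \<le> f p}) T {1..card T}"
proof -
  let ?r = "\<lambda>p. card {q \<in> T. f q \<le> f p}"
  have less: "?r p < ?r q" if "p \<in> T" "q \<in> T" "f p < f q" for p q
  proof (rule psubset_card_mono)
    have "q \<in> {u \<in> T. f u \<le> f q}" "q \<notin> {u \<in> T. f u \<le> f p}" using that by auto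
    moreover have "{u \<in> T. f u \<le> f p} \<subseteq> {u \<in> T. f u \<le> f q}" using that by auto
    ultimately show "{u \<in> T. f u \<le> f p} \<subset> {u \<in> T. f u \<le> f q}" by blast
  qed (use assms in simp)
  have inj: "inj_on ?r T"
  proof (rule inj_onI)
    fix p q assume pq: "p \<in> T" "q \<in> T" "?r p = ?r q"
    then have "f p = f q" using less[of p q] less[of q p] by fastforce
    then show "p = q" using assms(2) pq by (auto dest: inj_onD)
  qed
  have "?r ` T \<subseteq> {1..card T}"
  proof
    fix i assume "i \<in> ?r ` T"
    then obtain p where p: "p \<in> T" "i = ?r p" by auto
    have "card {p} \<le> ?r p" by (rule card_mono) (use assms p in auto)
    moreover have "?r p \<le> card T" by (rule card_mono) (use assms in auto)
    ultimately show "i \<in> {1..card T}" using p by simp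
  qed
  moreover have "card (?r ` T) = card {1..card T}" using card_image[OF inj] by simp
  ultimately have "?r ` T = {1..card T}" by (intro card_subset_eq) auto
  then show ?thesis using inj by (simp add: bij_betw_def)
qed

lemma rank_count:
  assumes "bij_betw r T {1..n}" "i \<le> n"
  shows "card {p \<in> T. r p \<le> i} = i"
proof -
  have "bij_betw r {p \<in> T. r p \<le> i} {1..i}"
  proof (rule bij_betw_imageI)
    show "inj_on r {p \<in> T. r p \<le> i}" using assms(1) by (auto simp: bij_betw_def inj_on_def)
    have "r ` T = {1..n}" using assms(1) by (simp add: bij_betw_def)
    then have "k \<in> r ` {p \<in> T. r p \<le> i}" if "k \<in> {1..i}" for k
      using that assms(2) by (auto simp: image_iff) (metis atLeastAtMost_iff imageE le_trans)
    moreover have "r p \<in> {1..i}" if "p \<in> T" "r p \<le> i" for p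
      using that \<open>r ` T = {1..n}\<close> by force
    ultimately show "r ` {p \<in> T. r p \<le> i} = {1..i}" by auto
  qed
  then show ?thesis using bij_betw_same_card by fastforce
qed

text \<open>
  Let \<open>D i\<close> be the set of points with horizontal rank at most \<open>i\<close> and
  vertical rank above \<open>i\<close>. Indecomposability makes each \<open>D i\<close> nonempty. A
  point of ranks \<open>(r, s)\<close> lies in \<open>s - r\<close> of these sets if \<open>r <
  s\<close>, and it has at least \<open>s - r\<close> points below it to the right; so the sizes of
  the \<open>D i\<close> add up to at most \<open>ninv T\<close>. If all the inner ones had two
  elements, the sum would be at least \<open>2 (n - 1) - 2\<close>.
\<close>

lemma ex_cut:
  assumes gen: "generic T" and nd: "\<not> dsum T" and c4: "4 \<le> card T" and few: "ninv T + 5 \<le> 2 * card T"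
  shows "\<exists>X Y a b. cut T X Y a b"
proof -
  define n where "n = card T"
  define xr :: "point \<Rightarrow> nat" where "xr p = card {q \<in> T. fst q \<le> fst p}" for p
  define yr :: "point \<Rightarrow> nat" where "yr p = card {q \<in> T. snd q \<le> snd p}" for p
  have fin: "finite T" "inj_on fst T" "inj_on snd T" using gen by (auto simp: generic_def)
  have bx: "bij_betw xr T {1..n}" and bxy: "bij_betw yr T {1..n}"
    using rank_bij[OF fin(1,2)] rank_bij[OF fin(1,3)] unfolding xr_def yr_def n_def by simp_all
  have rng: "1 \<le> xr p" "xr p \<le> n" "1 \<le> yr p" "yr p \<le> n" if "p \<in> T" for p
    using bij_betwE[OF bx] bij_betwE[OF bxy] that by auto
  have xless: "fst p < fst q" if "p \<in> T" "q \<in> T" "xr p < xr q" for p q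
  proof (rule ccontr)
    assume "\<not> ?thesis"
    then have "xr q \<le> xr p" unfolding xr_def using fin by (intro card_mono) auto
    then show False using that by simp
  qed
  have yless: "snd p < snd q" if "p \<in> T" "q \<in> T" "yr p < yr q" for p q
  proof (rule ccontr)
    assume "\<not> ?thesis"
    then have "yr q \<le> yr p" unfolding yr_def using fin by (intro card_mono) auto
    then show False using that by simp
  qed
  define X where "X i = {p \<in> T. xr p \<le> i \<and> yr p \<le> i}" for i
  define Y where "Y i = {p \<in> T. i < xr p \<and> i < yr p}" for i
  define D where "D i = {p \<in> T. xr p \<le> i \<and> i < yr p}" for i
  define U where "U i = {p \<in> T. yr p \<le> i \<and> i < xr p}" for i
  have finXY: "finite (X i)" "finite (Y i)" "finite (D i)" "finite (U i)" for i
    using fin unfolding X_def Y_def D_def U_def by simp_all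
  have XD: "card (X i) + card (D i) = i" if "i \<le> n" for i
  proof -
    have "{p \<in> T. xr p \<le> i} = X i \<union> D i" "X i \<inter> D i = {}" unfolding X_def D_def by auto
    then show ?thesis using rank_count[OF bx that] finXY[of i] by (simp add: card_Un_disjoint)
  qed
  have XU: "card (X i) + card (U i) = i" if "i \<le> n" for i
  proof -
    have "{p \<in> T. yr p \<le> i} = X i \<union> U i" "X i \<inter> U i = {}" unfolding X_def U_def by auto
    then show ?thesis using rank_count[OF bxy that] finXY[of i] by (simp add: card_Un_disjoint)
  qed
  have T4: "T = X i \<union> Y i \<union> D i \<union> U i" for i unfolding X_def Y_def D_def U_def by auto
  have cardT: "n = card (X i) + card (Y i) + card (D i) + card (U i)" for i
  proof -
    have "card (X i \<union> Y i \<union> D i \<union> U i) = card (X i) + card (Y i) + card (D i) + card (U i)"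
    proof -
      have "card (X i \<union> Y i \<union> D i \<union> U i) = card (X i \<union> Y i \<union> D i) + card (U i)"
        using finXY[of i] by (intro card_Un_disjoint) (auto simp: X_def Y_def D_def U_def)
      also have "card (X i \<union> Y i \<union> D i) = card (X i \<union> Y i) + card (D i)"
        using finXY[of i] by (intro card_Un_disjoint) (auto simp: X_def Y_def D_def U_def)
      also have "card (X i \<union> Y i) = card (X i) + card (Y i)"
        using finXY[of i] by (intro card_Un_disjoint) (auto simp: X_def Y_def D_def U_def)
      finally show ?thesis .
    qed
    then show ?thesis using T4[of i] n_def by simp
  qed
  have Dpos: "1 \<le> card (D i)" if "1 \<le> i" "i < n" for i
  proof (rule ccontr)
    assume "\<not> ?thesis"
    then have 0: "card (D i) = 0" by simp
    then have "card (U i) = 0" "card (X i) = i" using XD[of i] XU[of i] that by simp_all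
    then have e: "D i = {}" "U i = {}" using 0 finXY[of i] by simp_all
    have "card (Y i) \<noteq> 0" using cardT[of i] \<open>card (X i) = i\<close> e that by simp
    then have "X i \<noteq> {}" "Y i \<noteq> {}" using \<open>card (X i) = i\<close> that by auto
    moreover have "T = X i \<union> Y i" using T4[of i] e by simp
    moreover have "p \<lless> q" if "p \<in> X i" "q \<in> Y i" for p q
      using that xless[of p q] yless[of p q] unfolding X_def Y_def below_def by auto
    ultimately have "dsum T" by (intro dsumI[of "X i" "Y i"]) auto
    then show False using nd by simp
  qed
  \<comment> \<open>Double counting: the point \<open>p\<close> lies in \<open>D i\<close> for \<open>xr p \<le> i < yr p\<close>.\<close>
  have sumD: "(\<Sum>i\<in>{1..<n}. card (D i)) \<le> ninv T"
  proof -
    have "card (D i) = (\<Sum>p\<in>T. if xr p \<le> i \<and> i < yr p then 1 else 0)" for i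
      using fin by (simp add: D_def sum.If_cases Int_def)
    then have "(\<Sum>i\<in>{1..<n}. card (D i)) = (\<Sum>i\<in>{1..<n}. \<Sum>p\<in>T. if xr p \<le> i \<and> i < yr p then 1 else 0)" by simp
    also have "\<dots> = (\<Sum>p\<in>T. \<Sum>i\<in>{1..<n}. if xr p \<le> i \<and> i < yr p then 1 else 0)" by (rule sum.swap)
    also have "\<dots> = (\<Sum>p\<in>T. yr p - xr p)"
    proof (rule sum.cong[OF refl])
      fix p assume "p \<in> T"
      then have "{1..<n} \<inter> {i. xr p \<le> i \<and> i < yr p} = {xr p..<yr p}" using rng[of p] by auto
      then show "(\<Sum>i\<in>{1..<n}. if xr p \<le> i \<and> i < yr p then 1 else 0) = yr p - xr p"
        by (simp add: sum.If_cases)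
    qed
    also have "\<dots> \<le> (\<Sum>p\<in>T. card {q \<in> T. fst p < fst q \<and> snd q < snd p})"
    proof (rule sum_mono)
      fix p assume p: "p \<in> T"
      have "{q \<in> T. snd q \<le> snd p} \<subseteq> {q \<in> T. fst q \<le> fst p} \<union> {q \<in> T. fst p < fst q \<and> snd q < snd p}"
      proof
        fix q assume q: "q \<in> {q \<in> T. snd q \<le> snd p}"
        then show "q \<in> {q \<in> T. fst q \<le> fst p} \<union> {q \<in> T. fst p < fst q \<and> snd q < snd p}"
          using genericD(2)[OF gen p, of q] by (cases "p = q") auto
      qed
      then have "yr p \<le> card ({q \<in> T. fst q \<le> fst p} \<union> {q \<in> T. fst p < fst q \<and> snd q < snd p})"
        unfolding yr_def using fin by (intro card_mono) auto
      also have "\<dots> \<le> xr p + card {q \<in> T. fst p < fst q \<and> snd q < snd p}" unfolding xr_def by (rule card_Un_le)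
      finally show "yr p - xr p \<le> card {q \<in> T. fst p < fst q \<and> snd q < snd p}" by simp
    qed
    also have "\<dots> = ninv T"
    proof -
      have "{(p, q). p \<in> T \<and> q \<in> T \<and> fst p < fst q \<and> snd q < snd p}
        = (SIGMA p:T. {q \<in> T. fst p < fst q \<and> snd q < snd p})" by auto
      then show ?thesis unfolding ninv_def using fin by simp
    qed
    finally show ?thesis .
  qed
  have n4: "4 \<le> n" using c4 n_def by simp
  \<comment> \<open>The two outermost cuts are excluded so that both sides of the cut are nonempty.\<close>
  have "\<exists>i. 2 \<le> i \<and> i + 2 \<le> n \<and> card (D i) \<le> 1"
  proof (rule ccontr)
    assume no: "\<not> ?thesis"
    have "(\<Sum>i\<in>{1..<n}. 2) \<le> (\<Sum>i\<in>{1..<n}. card (D i) + (if i = 1 then 1 else 0) + (if i = n - 1 then 1 else 0))"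
    proof (rule sum_mono)
      fix i assume i: "i \<in> {1..<n}"
      show "2 \<le> card (D i) + (if i = 1 then 1 else 0) + (if i = n - 1 then 1 else 0)"
      proof (cases "i = 1 \<or> i = n - 1")
        case True
        then show ?thesis using Dpos[of i] i by auto
      next
        case False
        then show ?thesis using no i n4 by (auto simp: not_le) (metis False One_nat_def Suc_1 Suc_leI Suc_lessI add.commute add_2_eq_Suc' diff_Suc_1 le_antisym not_less_eq_eq)
      qed
    qed
    also have "\<dots> = (\<Sum>i\<in>{1..<n}. card (D i)) + 2"
      using n4 by (simp add: sum.distrib sum.delta)
    finally show False using sumD few n4 n_def by simp
  qed
  then obtain i where i: "2 \<le> i" "i + 2 \<le> n" "card (D i) \<le> 1" by auto
  then have cD: "card (D i) = 1" using Dpos[of i] by simp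
  then have cU: "card (U i) = 1" and cX: "card (X i) = i - 1" using XD[of i] XU[of i] i by simp_all
  have cY: "card (Y i) \<noteq> 0" using cardT[of i] cD cU cX i by simp
  obtain b where b: "D i = {b}" using cD card_1_singletonE by metis
  obtain a where a: "U i = {a}" using cU card_1_singletonE by metis
  have bD: "b \<in> T" "xr b \<le> i" "i < yr b" using b unfolding D_def by auto
  have aU: "a \<in> T" "yr a \<le> i" "i < xr a" using a unfolding U_def by auto
  have "cut T (X i) (Y i) a b"
  proof (unfold_locales, goal_cases)
    case 1 show ?case by (rule gen)
  next
    case 2 show ?case using T4[of i] a b by auto
  next
    case 3 show ?case using cX i by auto
  next
    case 4 show ?case using cY by auto
  next
    case (5 x y)
    then show ?case using xless[of x y] yless[of x y] unfolding X_def Y_def below_def by auto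
  next
    case (6 x) then show ?case using xless[of x a] aU unfolding X_def by auto
  next
    case (7 x) then show ?case using yless[of x b] bD unfolding X_def by auto
  next
    case (8 y) then show ?case using xless[of b y] bD unfolding Y_def by auto
  next
    case (9 y) then show ?case using yless[of a y] aU unfolding Y_def by auto
  next
    case 10 show ?case using xless[of b a] aU bD by auto
  next
    case 11 show ?case using yless[of a b] aU bD by auto
  qed
  then show ?thesis by blast
qed

text \<open>
  Take a cut from \<open>ex_cut\<close>. The cases depend on whether \<open>a\<close> is lowest or
  rightmost, and \<open>b\<close> leftmost or highest.
\<close>

theorem few_inversions_reducible:
  assumes "generic T" "avoids T" "\<not> dsum T" "ninv T + 7 \<le> 2 * card T"
  shows "reducible T"
  using assms
proof (induction "card T" arbitrary: T rule: less_induct)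
  case less
  note IH = less.hyps and gen = less.prems(1) and av = less.prems(2) and nd = less.prems(3) and few = less.prems(4)
  have "4 \<le> card T" using few by simp
  then obtain X Y a b where "cut T X Y a b" using ex_cut[OF gen nd] few by fastforce
  then interpret cut T X Y a b .
  show ?case
  proof (cases "low T a \<or> right T a")
    case a: True
    show ?thesis
    proof (cases "left T b \<or> high T b")
      case True
      then show ?thesis
        using a reducible_low_left[OF av nd _ _ few] reducible_low_high[OF nd _ _ few]
          reducible_right_left[OF nd _ _ few] reducible_right_high[OF av nd _ _ few] IH by blast
    next
      case False
      then show ?thesis using reducible_a_extreme[OF av nd _ _ a few] by blast
    qed
  next
    case na: False
    then show ?thesis
      using reducible_b_left[OF av nd _ _ _ few] reducible_b_high[OF av nd _ _ _ few]
        reducible_inner[OF av nd _ _ _ _ few] by blast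
  qed
qed

section \<open>Removing and inserting extreme points\<close>

lemma below_trans: "p \<lless> q \<Longrightarrow> q \<lless> r \<Longrightarrow> p \<lless> r"
  by (auto simp: below_def)

text \<open>
  Let \<open>e\<close> be the lowest and \<open>f\<close> the leftmost point, with decompositions
  \<open>A\<close> below \<open>B\<close> after removal of \<open>e\<close> and \<open>A'\<close>
  below \<open>B'\<close> after removal of \<open>f\<close>. Then \<open>f\<close> is in
  \<open>A\<close> and \<open>e\<close> in \<open>A'\<close>. One of \<open>B \<inter> A'\<close>
  and \<open>B' \<inter> A\<close> is empty, since their points would have to lie below each other.
  In the first case \<open>B\<close> is contained in \<open>B'\<close>, so it lies above
  \<open>e\<close> too and the whole set decomposes.
\<close>

lemma low_left_exclusive:
  assumes nd: "\<not> dsum T" and e: "low T e" "dsum (T - {e})" and f: "left T f" "dsum (T - {f})"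
  shows False
proof -
  obtain A B where AB: "A \<noteq> {}" "B \<noteq> {}" "T - {e} = A \<union> B" "A \<inter> B = {}" "\<forall>p\<in>A. \<forall>q\<in>B. p \<lless> q"
    using e(2) by (rule dsumE)
  obtain A' B' where AB': "A' \<noteq> {}" "B' \<noteq> {}" "T - {f} = A' \<union> B'" "A' \<inter> B' = {}" "\<forall>p\<in>A'. \<forall>q\<in>B'. p \<lless> q"
    using f(2) by (rule dsumE)
  have T: "e \<in> T" "f \<in> T" "\<And>q. q \<in> T \<Longrightarrow> snd e \<le> snd q" "\<And>q. q \<in> T \<Longrightarrow> fst f \<le> fst q"
    using e(1) f(1) by (auto simp: low_def left_def)
  obtain p0 where p0: "p0 \<in> A" using AB(1) by auto
  have "f \<notin> B"
  proof
    assume "f \<in> B"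
    then have "p0 \<lless> f" "p0 \<in> T" using p0 AB by auto
    then show False using T(4)[of p0] by (auto simp: below_def)
  qed
  obtain q0 where q0: "q0 \<in> A'" using AB'(1) by auto
  have "e \<notin> B'"
  proof
    assume "e \<in> B'"
    then have "q0 \<lless> e" "q0 \<in> T" using q0 AB' by auto
    then show False using T(3)[of q0] by (auto simp: below_def)
  qed
  have "f \<noteq> e"
  proof
    assume "f = e"
    then have "p \<lless> q" if "p \<in> {e} \<union> A" "q \<in> B" for p q
    proof -
      have "p0 \<lless> q" "p0 \<in> T" using p0 AB that by auto
      then have "e \<lless> q" using T(3)[of p0] T(4)[of p0] \<open>f = e\<close> by (auto simp: below_def)
      then show ?thesis using that AB(5) by auto
    qed
    then have "dsum T" using AB T(1) by (intro dsumI[of "{e} \<union> A" B]) auto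
    then show False using nd by simp
  qed
  have eA': "e \<in> A'" using AB'(3) T(1) \<open>f \<noteq> e\<close> \<open>e \<notin> B'\<close> by auto
  have fA: "f \<in> A" using AB(3) T(2) \<open>f \<noteq> e\<close> \<open>f \<notin> B\<close> by auto
  have "B \<inter> A' = {} \<or> B' \<inter> A = {}"
  proof (rule ccontr)
    assume "\<not> ?thesis"
    then obtain p q where "p \<in> B" "p \<in> A'" "q \<in> B'" "q \<in> A" by auto
    then have "q \<lless> p" "p \<lless> q" using AB(5) AB'(5) by auto
    then show False by (auto simp: below_def)
  qed
  then show False
  proof
    assume "B \<inter> A' = {}"
    then have BB: "q \<in> B'" if "q \<in> B" for q using that AB(3) AB'(3) \<open>f \<notin> B\<close> by blast
    have "dsum T"
    proof (rule dsumI[of "insert e A" B])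
      show "T = insert e A \<union> B" using AB(3) T(1) by auto
      show "p \<lless> q" if "p \<in> insert e A" "q \<in> B" for p q
        using that AB(5) AB'(5) eA' BB[of q] by auto
    qed (use AB in auto)
    then show False using nd by simp
  next
    assume "B' \<inter> A = {}"
    then have BB: "q \<in> B" if "q \<in> B'" for q using that AB(3) AB'(3) \<open>e \<notin> B'\<close> by blast
    have "dsum T"
    proof (rule dsumI[of "insert f A'" B'])
      show "T = insert f A' \<union> B'" using AB'(3) T(2) by auto
      show "p \<lless> q" if "p \<in> insert f A'" "q \<in> B'" for p q
        using that AB(5) AB'(5) fA BB[of q] by auto
    qed (use AB' in auto)
    then show False using nd by simp
  qed
qed

lemma high_right_exclusive:
  assumes "\<not> dsum T" "high T e" "dsum (T - {e})" "right T f" "dsum (T - {f})"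
  shows False
  by (rule low_left_exclusive[of "ng ` T" "ng e" "ng f"])
    (use assms in \<open>simp_all only: sym_dsum sym_low sym_left sym_remove simp_thms\<close>)

lemma dsum_insert_min:
  assumes "dsum (insert e T)" "\<forall>q\<in>insert e T. \<not> q \<lless> e"
  obtains A B where "e \<in> A" "B \<noteq> {}" "B \<subseteq> T" "insert e T = A \<union> B" "A \<inter> B = {}" "\<forall>p\<in>A. \<forall>q\<in>B. p \<lless> q"
proof -
  obtain A B where AB: "A \<noteq> {}" "B \<noteq> {}" "insert e T = A \<union> B" "A \<inter> B = {}" "\<forall>p\<in>A. \<forall>q\<in>B. p \<lless> q"
    using assms(1) by (rule dsumE)
  have "e \<notin> B"
  proof
    assume "e \<in> B"
    obtain p where "p \<in> A" using AB(1) by auto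
    then have "p \<lless> e" "p \<in> insert e T" using AB(3,5) \<open>e \<in> B\<close> by auto
    then show False using assms(2) by auto
  qed
  then have "e \<in> A" "B \<subseteq> T" using AB(3) by auto
  then show ?thesis using that AB by blast
qed

lemma dsum_insert_max:
  assumes "dsum (insert w T)" "\<forall>q\<in>insert w T. \<not> w \<lless> q"
  obtains A B where "w \<in> B" "A \<noteq> {}" "A \<subseteq> T" "insert w T = A \<union> B" "A \<inter> B = {}" "\<forall>p\<in>A. \<forall>q\<in>B. p \<lless> q"
proof -
  obtain A B where AB: "A \<noteq> {}" "B \<noteq> {}" "insert w T = A \<union> B" "A \<inter> B = {}" "\<forall>p\<in>A. \<forall>q\<in>B. p \<lless> q"
    using assms(1) by (rule dsumE)
  have "w \<notin> A"
  proof
    assume "w \<in> A"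
    obtain p where "p \<in> B" using AB(2) by auto
    then have "w \<lless> p" "p \<in> insert w T" using AB(3,5) \<open>w \<in> A\<close> by auto
    then show False using assms(2) by auto
  qed
  then have "w \<in> B" "A \<subseteq> T" using AB(3) by auto
  then show ?thesis using that AB by blast
qed

text \<open>
  In an occurrence of 1324 that uses \<open>e\<close>, the point \<open>e\<close> is the 1. As
  \<open>e\<close> is not below the whole upper summand \<open>B\<close>, it is not below any point
  of the lower summand \<open>A\<close>; so the other three points are in \<open>B\<close>, and
  \<open>e\<close> can be replaced by any point of \<open>A\<close>.
\<close>

lemma avoids_insert_min:
  assumes av: "avoids T" and d: "dsum T" and nd: "\<not> dsum (insert e T)" and mn: "\<forall>q\<in>T. \<not> q \<lless> e"
  shows "avoids (insert e T)"
  unfolding avoids_def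
proof (intro notI, elim bexE conjE)
  fix p q r s assume m: "p \<in> insert e T" "q \<in> insert e T" "r \<in> insert e T" "s \<in> insert e T" and
    o: "fst p < fst q" "fst q < fst r" "fst r < fst s" "snd p < snd r" "snd r < snd q" "snd q < snd s"
  obtain A B where AB: "A \<noteq> {}" "B \<noteq> {}" "T = A \<union> B" "A \<inter> B = {}" "\<forall>p\<in>A. \<forall>q\<in>B. p \<lless> q"
    using d by (rule dsumE)
  have "\<exists>b1\<in>B. \<not> e \<lless> b1"
  proof (rule ccontr)
    assume "\<not> ?thesis"
    then have "dsum (insert e T)" using AB by (intro dsumI[of "insert e A" B]) auto
    then show False using nd by simp
  qed
  then obtain b1 where b1: "b1 \<in> B" "\<not> e \<lless> b1" by auto
  have notA: "u \<notin> A" if "e \<lless> u" for u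
    using that b1 AB(5) below_trans[of e u b1] by blast
  have pq: "p \<lless> q" "p \<lless> r" "p \<lless> s" using o by (auto simp: below_def)
  have ne: "u \<noteq> e" if "p \<lless> u" for u using that m(1) mn by (auto simp: below_def)
  have qrs: "q \<in> T" "r \<in> T" "s \<in> T" using m ne pq by auto
  obtain a0 where a0: "a0 \<in> A" using AB(1) by auto
  show False
  proof (cases "p = e")
    case True
    then have "q \<in> B" "r \<in> B" "s \<in> B" using notA pq qrs AB(3) by auto
    then have "a0 \<lless> q" "a0 \<lless> r" using a0 AB(5) by auto
    then show False using avoidsD[OF av, of a0 q r s] qrs a0 AB(3) o by (auto simp: below_def)
  next
    case False
    then show False using avoidsD[OF av, of p q r s] qrs m o by auto
  qed
qed

text \<open>
  The same replacement argument, applied to \<open>e\<close> as the 1 and to \<open>w\<close> as the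
  4. The hypotheses supply one decomposition for each: one of \<open>T\<close> with \<open>w\<close>
  whose lower summand can stand in for \<open>e\<close>, and one of \<open>T\<close> with
  \<open>e\<close> whose upper summand can stand in for \<open>w\<close>.
\<close>

lemma avoids_insert_min_max:
  assumes av: "avoids T" and d: "dsum (insert e T)" "dsum (insert w T)" and nd: "\<not> dsum (insert e (insert w T))"
    and mn: "\<forall>q\<in>insert w T. \<not> q \<lless> e" and mx: "\<forall>q\<in>insert e T. \<not> w \<lless> q"
    and nin: "e \<notin> T" "w \<notin> T" "e \<noteq> w"
  shows "avoids (insert e (insert w T))"
  unfolding avoids_def
proof (intro notI, elim bexE conjE)
  fix p q r s assume m: "p \<in> insert e (insert w T)" "q \<in> insert e (insert w T)" "r \<in> insert e (insert w T)"
      "s \<in> insert e (insert w T)" and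
    o: "fst p < fst q" "fst q < fst r" "fst r < fst s" "snd p < snd r" "snd r < snd q" "snd q < snd s"
  have mn': "\<forall>q\<in>insert e T. \<not> q \<lless> e" using mn by (auto simp: below_def)
  have mx': "\<forall>q\<in>insert w T. \<not> w \<lless> q" using mx by (auto simp: below_def)
  obtain A B where AB: "e \<in> A" "B \<noteq> {}" "B \<subseteq> T" "insert e T = A \<union> B" "A \<inter> B = {}" "\<forall>p\<in>A. \<forall>q\<in>B. p \<lless> q"
    using d(1) mn' by (rule dsum_insert_min)
  obtain A' B' where AB': "w \<in> B'" "A' \<noteq> {}" "A' \<subseteq> T" "insert w T = A' \<union> B'" "A' \<inter> B' = {}" "\<forall>p\<in>A'. \<forall>q\<in>B'. p \<lless> q"
    using d(2) mx' by (rule dsum_insert_max)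
  have "\<exists>a1\<in>A. \<not> a1 \<lless> w"
  proof (rule ccontr)
    assume n: "\<not> ?thesis"
    have "dsum (insert e (insert w T))"
    proof (rule dsumI[of A "insert w B"])
      show "insert e (insert w T) = A \<union> insert w B" using AB(4) by auto
      show "p \<lless> q" if "p \<in> A" "q \<in> insert w B" for p q using that n AB(6) by auto
    qed (use AB in auto)
    then show False using nd by simp
  qed
  then obtain a1 where a1: "a1 \<in> A" "\<not> a1 \<lless> w" by auto
  have "\<exists>b1\<in>B'. \<not> e \<lless> b1"
  proof (rule ccontr)
    assume n: "\<not> ?thesis"
    have "dsum (insert e (insert w T))"
    proof (rule dsumI[of "insert e A'" B'])
      show "insert e (insert w T) = insert e A' \<union> B'" using AB'(4) by auto
      show "p \<lless> q" if "p \<in> insert e A'" "q \<in> B'" for p q using that n AB'(6) by auto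
    qed (use AB' in auto)
    then show False using nd by simp
  qed
  then obtain b1 where b1: "b1 \<in> B'" "\<not> e \<lless> b1" by auto
  have notB: "u \<notin> B" if "u \<lless> w" for u
    using that a1 AB(6) below_trans[of a1 u w] by blast
  have notA': "u \<notin> A'" if "e \<lless> u" for u
    using that b1 AB'(6) below_trans[of e u b1] by blast
  have bl: "p \<lless> q" "p \<lless> r" "p \<lless> s" "q \<lless> s" "r \<lless> s" using o by (auto simp: below_def)
  have ne: "u \<noteq> e" if "p \<lless> u" for u using that m(1) mn' mn by auto
  have nw: "u \<noteq> w" if "u \<lless> s" for u using that m(4) mx' mx by auto
  have T: "p \<in> insert e T" "q \<in> T" "r \<in> T" "s \<in> insert w T" using m ne nw bl by auto
  obtain b where b: "b \<in> B" using AB(2) by auto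
  obtain a where a: "a \<in> A'" using AB'(2) by auto
  have bT: "b \<in> T" and aT: "a \<in> T" using a b AB(3) AB'(3) by auto
  \<comment> \<open>Replacement of \<open>w\<close> by a point of \<open>B\<close>.\<close>
  have sw: "p \<lless> b \<and> q \<lless> b \<and> r \<lless> b" if "s = w"
    using that notB bl T AB(4,6) b by (metis UnE insertI2)
  \<comment> \<open>Replacement of \<open>e\<close> by a point of \<open>A'\<close>.\<close>
  have pe: "a \<lless> q \<and> a \<lless> r \<and> (s \<noteq> w \<longrightarrow> a \<lless> s)" if "p = e"
    using that notA' bl T AB'(4,6) a by (metis UnE insertI2 insertE)
  consider "p = e" "s = w" | "p = e" "s \<in> T" | "p \<in> T" "s = w" | "p \<in> T" "s \<in> T" using T by auto
  then show False
  proof cases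
    case 1 then show False using avoidsD[OF av, of a q r b] T aT bT o sw pe by (auto simp: below_def)
  next
    case 2 then show False using avoidsD[OF av, of a q r s] T aT bT o pe nin by (auto simp: below_def)
  next
    case 3 then show False using avoidsD[OF av, of p q r b] T aT bT o sw by (auto simp: below_def)
  next
    case 4 then show False using avoidsD[OF av, of p q r s] T o by auto
  qed
qed

text \<open>
  Hence an indecomposable set from which each of two points can be removed arises from a
  decomposable set by inserting both.
\<close>

lemma dsum_core:
  assumes d: "dsum (insert e T)" "dsum (insert w T)" and nd: "\<not> dsum (insert e (insert w T))"
    and mn: "\<forall>q\<in>insert w T. \<not> q \<lless> e" and mx: "\<forall>q\<in>insert e T. \<not> w \<lless> q"
    and nin: "e \<notin> T" "w \<notin> T" "e \<noteq> w"
  shows "dsum T"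
proof -
  have mn': "\<forall>q\<in>insert e T. \<not> q \<lless> e" using mn by (auto simp: below_def)
  have mx': "\<forall>q\<in>insert w T. \<not> w \<lless> q" using mx by (auto simp: below_def)
  obtain A B where AB: "e \<in> A" "B \<noteq> {}" "B \<subseteq> T" "insert e T = A \<union> B" "A \<inter> B = {}" "\<forall>p\<in>A. \<forall>q\<in>B. p \<lless> q"
    using d(1) mn' by (rule dsum_insert_min)
  obtain A' B' where AB': "w \<in> B'" "A' \<noteq> {}" "A' \<subseteq> T" "insert w T = A' \<union> B'" "A' \<inter> B' = {}" "\<forall>p\<in>A'. \<forall>q\<in>B'. p \<lless> q"
    using d(2) mx' by (rule dsum_insert_max)
  show ?thesis
  proof (cases "A = {e}")
    case True
    then have eT: "e \<lless> q" if "q \<in> T" for q using that AB(4,6) nin by auto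
    obtain a where a: "a \<in> A'" using AB'(2) by auto
    then have "e \<lless> w" using eT[of a] AB'(1,3,6) below_trans by blast
    then have "dsum (insert e (insert w T))" using eT by (intro dsumI[of "{e}" "insert w T"]) auto
    then show ?thesis using nd by simp
  next
    case False
    show ?thesis
    proof (rule dsumI[of "A - {e}" B])
      show "T = (A - {e}) \<union> B" using AB(3,4) nin(1) by auto
    qed (use False AB in auto)
  qed
qed

section \<open>Permutations as point sets\<close>

definition pt :: "(nat \<Rightarrow> nat) \<Rightarrow> nat \<Rightarrow> point" where "pt \<sigma> i = (int i, int (\<sigma> i))"

definition pts :: "nat \<Rightarrow> (nat \<Rightarrow> nat) \<Rightarrow> point set" where "pts n \<sigma> = pt \<sigma> ` {1..n}"

lemma pt_simps [simp]: "fst (pt \<sigma> i) = int i" "snd (pt \<sigma> i) = int (\<sigma> i)"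
  by (simp_all add: pt_def)

lemma inj_pt: "inj_on (pt \<sigma>) S"
  by (auto simp: inj_on_def pt_def)

lemma finite_pts [simp]: "finite (pts n \<sigma>)" by (simp add: pts_def)

lemma card_pts: "card (pts n \<sigma>) = n"
  by (simp add: pts_def card_image inj_pt)

lemma generic_pts: "\<sigma> permutes {1..n} \<Longrightarrow> generic (pts n \<sigma>)"
  unfolding generic_def pts_def
  using permutes_inj[of \<sigma> "{1..n}"] by (auto simp: inj_on_def pt_def)

lemma ninv_pts: "ninv (pts n \<sigma>) = card (inversions n \<sigma>)"
proof -
  have "{(p, q). p \<in> pts n \<sigma> \<and> q \<in> pts n \<sigma> \<and> fst p < fst q \<and> snd q < snd p}
    = map_prod (pt \<sigma>) (pt \<sigma>) ` inversions n \<sigma>"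
  proof (intro set_eqI iffI)
    fix u assume "u \<in> {(p, q). p \<in> pts n \<sigma> \<and> q \<in> pts n \<sigma> \<and> fst p < fst q \<and> snd q < snd p}"
    then obtain i j where "i \<in> {1..n}" "j \<in> {1..n}" "i < j" "\<sigma> j < \<sigma> i" "u = (pt \<sigma> i, pt \<sigma> j)"
      unfolding pts_def by auto
    then show "u \<in> map_prod (pt \<sigma>) (pt \<sigma>) ` inversions n \<sigma>"
      by (intro image_eqI[of _ _ "(i, j)"]) (auto simp: inversions_def)
  qed (auto simp: inversions_def pts_def)
  moreover have "inj_on (map_prod (pt \<sigma>) (pt \<sigma>)) (inversions n \<sigma>)"
    by (auto simp: inj_on_def pt_def)
  ultimately show ?thesis unfolding ninv_def by (simp add: card_image)
qed

lemma avoids_pts: "avoids (pts n \<sigma>) \<longleftrightarrow> \<not> contains_pattern n \<sigma> 4 pattern_1324"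
proof -
  have tau: "pattern_1324 1 = 1" "pattern_1324 2 = 3" "pattern_1324 3 = 2" "pattern_1324 4 = 4"
    by (simp_all add: one_line_def numeral_eq_Suc)
  have S: "{1..4} = {1, 2, 3, 4::nat}" by auto
  have "contains_pattern n \<sigma> 4 pattern_1324 \<longleftrightarrow>
    (\<exists>i\<in>{1..n}. \<exists>j\<in>{1..n}. \<exists>k\<in>{1..n}. \<exists>l\<in>{1..n}. i < j \<and> j < k \<and> k < l \<and> \<sigma> i < \<sigma> k \<and> \<sigma> k < \<sigma> j \<and> \<sigma> j < \<sigma> l)"
    (is "?L \<longleftrightarrow> ?R")
  proof
    assume ?L
    then obtain \<iota> where io: "\<iota> ` {1..4} \<subseteq> {1..n}" "strict_mono_on {1..4} \<iota>"
      "\<And>a b. a \<in> {1..4} \<Longrightarrow> b \<in> {1..4} \<Longrightarrow> \<sigma> (\<iota> a) < \<sigma> (\<iota> b) \<longleftrightarrow> pattern_1324 a < pattern_1324 b"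
      unfolding contains_pattern_def by blast
    have "\<iota> 1 < \<iota> 2" "\<iota> 2 < \<iota> 3" "\<iota> 3 < \<iota> 4"
      using io(2) by (auto simp: strict_mono_on_def)
    moreover have "\<sigma> (\<iota> 1) < \<sigma> (\<iota> 3)" "\<sigma> (\<iota> 3) < \<sigma> (\<iota> 2)" "\<sigma> (\<iota> 2) < \<sigma> (\<iota> 4)"
      using io(3)[of 1 3] io(3)[of 3 2] io(3)[of 2 4] tau by simp_all
    moreover have "\<iota> 1 \<in> {1..n}" "\<iota> 2 \<in> {1..n}" "\<iota> 3 \<in> {1..n}" "\<iota> 4 \<in> {1..n}"
      using io(1) unfolding S by auto
    ultimately show ?R by blast
  next
    assume ?R
    then obtain i j k l where h: "i \<in> {1..n}" "j \<in> {1..n}" "k \<in> {1..n}" "l \<in> {1..n}"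
      "i < j" "j < k" "k < l" "\<sigma> i < \<sigma> k" "\<sigma> k < \<sigma> j" "\<sigma> j < \<sigma> l" by blast
    define \<iota> where "\<iota> a = (if a = 1 then i else if a = 2 then j else if a = 3 then k else l)" for a :: nat
    have v: "\<iota> 1 = i" "\<iota> 2 = j" "\<iota> 3 = k" "\<iota> 4 = l" by (simp_all add: \<iota>_def)
    show ?L
      unfolding contains_pattern_def
    proof (intro exI[of _ \<iota>] conjI)
      show "\<iota> ` {1..4} \<subseteq> {1..n}" unfolding S using h v by auto
      show "strict_mono_on {1..4} \<iota>" unfolding S strict_mono_on_def using h v by auto
      show "\<forall>a\<in>{1..4}. \<forall>b\<in>{1..4}. \<sigma> (\<iota> a) < \<sigma> (\<iota> b) \<longleftrightarrow> pattern_1324 a < pattern_1324 b"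
        unfolding S using h v tau by auto
    qed
  qed
  then show ?thesis unfolding avoids_def pts_def by simp
qed

text \<open>
  A cut that no inversion crosses. The trivial cuts \<open>0\<close> and \<open>n\<close> are
  included, so that decompositions in which one inserted point forms a summand of its own are
  covered as well.
\<close>

definition zc :: "nat \<Rightarrow> (nat \<Rightarrow> nat) \<Rightarrow> nat \<Rightarrow> bool" where
  "zc n \<sigma> z \<longleftrightarrow> z \<le> n \<and> (\<forall>j\<in>{1..z}. \<forall>k\<in>{z<..n}. \<sigma> j < \<sigma> k)"

lemma zc_0 [simp]: "zc n \<sigma> 0" by (simp add: zc_def)
lemma zc_n [simp]: "zc n \<sigma> n" by (simp add: zc_def)

lemma zc_image:
  assumes p: "\<sigma> permutes {1..n}" and z: "zc n \<sigma> z"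
  shows "\<sigma> ` {1..z} = {1..z}"
proof -
  have zn: "z \<le> n" using z by (simp add: zc_def)
  have inj: "inj_on \<sigma> S" for S using permutes_inj[OF p] inj_on_subset by blast
  have c: "card (\<sigma> ` {1..z}) = z" using card_image[OF inj] by simp
  have "\<sigma> ` {1..z} \<subseteq> {1..z}"
  proof
    fix y assume "y \<in> \<sigma> ` {1..z}"
    then obtain j where j: "j \<in> {1..z}" "y = \<sigma> j" by auto
    have "\<sigma> j \<in> {1..n}" using permutes_in_image[OF p, of j] j zn by auto
    moreover have "\<not> \<sigma> j > z"
    proof
      assume gt: "\<sigma> j > z"
      have "\<sigma> ` {z<..n} \<subseteq> {z+1<..n}"
      proof
        fix u assume "u \<in> \<sigma> ` {z<..n}"
        then obtain k where k: "k \<in> {z<..n}" "u = \<sigma> k" by auto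
        then have "\<sigma> j < \<sigma> k" using z j by (auto simp: zc_def)
        moreover have "\<sigma> k \<in> {1..n}" using permutes_in_image[OF p, of k] k by auto
        ultimately show "u \<in> {z+1<..n}" using gt k by auto
      qed
      then have "card (\<sigma> ` {z<..n}) \<le> card {z+1<..n}" by (intro card_mono) auto
      then have "n - z \<le> n - (z + 1)" using card_image[OF inj, of "{z<..n}"] by simp
      then have "z = n" using zn by simp
      then show False using gt \<open>\<sigma> j \<in> {1..n}\<close> by simp
    qed
    ultimately show "y \<in> {1..z}" using j by auto
  qed
  then show ?thesis using c by (intro card_subset_eq) auto
qed

lemma zc_le:
  assumes "\<sigma> permutes {1..n}" "zc n \<sigma> z" "i \<in> {1..z}"
  shows "\<sigma> i \<in> {1..z}"
  using zc_image[OF assms(1,2)] assms(3) by blast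

lemma zc_gt:
  assumes "\<sigma> permutes {1..n}" "zc n \<sigma> z" "i \<in> {z<..n}"
  shows "\<sigma> i \<in> {z<..n}"
proof -
  have "\<sigma> i \<in> {1..n}" using permutes_in_image[OF assms(1), of i] assms(3) by auto
  moreover have "\<sigma> i \<notin> {1..z}"
  proof
    assume "\<sigma> i \<in> {1..z}"
    then have "\<sigma> i \<in> \<sigma> ` {1..z}" using zc_image[OF assms(1,2)] by simp
    then obtain j where "j \<in> {1..z}" "\<sigma> j = \<sigma> i" by auto
    moreover from this have "j = i" using injD[OF permutes_inj[OF assms(1)], of j i] by simp
    ultimately show False using assms(3) by simp
  qed
  ultimately show ?thesis by auto
qed

lemma initial_segment:
  fixes I J :: "nat set"
  assumes "{1..n} = I \<union> J" "\<And>i j. i \<in> I \<Longrightarrow> j \<in> J \<Longrightarrow> i < j"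
  obtains z where "z \<le> n" "I = {1..z}" "J = {z<..n}"
proof (cases "I = {}")
  case True
  then show ?thesis using assms(1) by (intro that[of 0]) auto
next
  case False
  have fin: "finite I" using assms(1) by (metis finite_Un finite_atLeastAtMost)
  let ?z = "Max I"
  have zI: "?z \<in> I" using fin False by simp
  have "?z \<le> n" using zI assms(1) by auto
  moreover have "I = {1..?z}"
  proof
    show "I \<subseteq> {1..?z}" using fin assms(1) by (auto simp: Max_ge)
    show "{1..?z} \<subseteq> I"
    proof
      fix i assume "i \<in> {1..?z}"
      then have "i \<in> {1..n}" and "\<not> ?z < i" using \<open>?z \<le> n\<close> by auto
      then have "i \<in> I \<union> J" unfolding assms(1) by simp
      then show "i \<in> I" using assms(2)[OF zI, of i] \<open>\<not> ?z < i\<close> by blast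
    qed
  qed
  moreover have "J = {?z<..n}"
  proof
    show "J \<subseteq> {?z<..n}" using assms(2)[OF zI] assms(1) by auto
    show "{?z<..n} \<subseteq> J"
    proof
      fix i assume "i \<in> {?z<..n}"
      then have "i \<in> {1..n}" "?z < i" by auto
      moreover have "i \<notin> I" using \<open>?z < i\<close> Max_ge[OF fin, of i] by (meson not_less)
      ultimately show "i \<in> J" using assms(1) by blast
    qed
  qed
  ultimately show ?thesis by (rule that)
qed

text \<open>
  Inserting a value shifts the other points apart. All notions in use are invariant under such maps.
\<close>

definition order_emb :: "(point \<Rightarrow> point) \<Rightarrow> bool" where
  "order_emb f \<longleftrightarrow> (\<forall>p q. (fst (f p) < fst (f q) \<longleftrightarrow> fst p < fst q) \<and> (snd (f p) < snd (f q) \<longleftrightarrow> snd p < snd q))"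

lemma emb_fst_snd:
  assumes "order_emb f"
  shows "fst (f p) < fst (f q) \<longleftrightarrow> fst p < fst q" "snd (f p) < snd (f q) \<longleftrightarrow> snd p < snd q"
  using assms unfolding order_emb_def by blast+

lemma emb_below: "order_emb f \<Longrightarrow> f p \<lless> f q \<longleftrightarrow> p \<lless> q"
  unfolding below_def by (simp only: emb_fst_snd)
lemma emb_inverted: "order_emb f \<Longrightarrow> inverted (f p) (f q) \<longleftrightarrow> inverted p q"
  unfolding inverted_def by (simp only: emb_fst_snd)
lemma emb_inj: "order_emb f \<Longrightarrow> inj f"
proof (rule injI)
  fix p q assume f: "order_emb f" and e: "f p = f q"
  then show "p = q" using emb_fst_snd[OF f, of p q] emb_fst_snd[OF f, of q p] by (auto simp: prod_eq_iff)
qed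
lemma emb_dsum: "order_emb f \<Longrightarrow> dsum (f ` T) \<longleftrightarrow> dsum T" by (simp add: dsum_image_iff emb_below)
lemma emb_ninv: "order_emb f \<Longrightarrow> finite T \<Longrightarrow> ninv (f ` T) = ninv T"
  by (intro ninv_image) (auto simp: emb_inverted intro: inj_on_subset[OF emb_inj])
lemma emb_avoids: "order_emb f \<Longrightarrow> avoids (f ` T) \<longleftrightarrow> avoids T"
  unfolding avoids_def by (simp only: bex_simps emb_fst_snd)

lemma block_split:
  assumes f: "order_emb f" and CD: "f ` pts n \<sigma> = C \<union> D" "\<forall>p\<in>C. \<forall>q\<in>D. p \<lless> q"
  obtains z where "zc n \<sigma> z" "C = f ` pt \<sigma> ` {1..z}" "D = f ` pt \<sigma> ` {z<..n}"
proof -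
  define I where "I = {i \<in> {1..n}. f (pt \<sigma> i) \<in> C}"
  define J where "J = {i \<in> {1..n}. f (pt \<sigma> i) \<in> D}"
  have "f (pt \<sigma> i) \<in> C \<union> D" if "i \<in> {1..n}" for i
    using that CD(1) by (auto simp: pts_def)
  then have 1: "{1..n} = I \<union> J" unfolding I_def J_def by blast
  have lt: "i < j \<and> \<sigma> i < \<sigma> j" if "i \<in> I" "j \<in> J" for i j
  proof -
    have "f (pt \<sigma> i) \<lless> f (pt \<sigma> j)" using that CD(2) by (auto simp: I_def J_def)
    then show ?thesis by (simp add: emb_below[OF f]) (simp add: below_def)
  qed
  then obtain z where z: "z \<le> n" "I = {1..z}" "J = {z<..n}" using initial_segment[OF 1] by metis
  have C: "C = f ` pt \<sigma> ` I"
  proof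
    show "f ` pt \<sigma> ` I \<subseteq> C" by (auto simp: I_def)
    show "C \<subseteq> f ` pt \<sigma> ` I"
    proof
      fix p assume p: "p \<in> C"
      then have "p \<in> f ` pts n \<sigma>" using CD(1) by auto
      then show "p \<in> f ` pt \<sigma> ` I" using p by (auto simp: pts_def I_def)
    qed
  qed
  have D: "D = f ` pt \<sigma> ` J"
  proof
    show "f ` pt \<sigma> ` J \<subseteq> D" by (auto simp: J_def)
    show "D \<subseteq> f ` pt \<sigma> ` J"
    proof
      fix p assume p: "p \<in> D"
      then have "p \<in> f ` pts n \<sigma>" using CD(1) by auto
      then show "p \<in> f ` pt \<sigma> ` J" using p by (auto simp: pts_def J_def)
    qed
  qed
  have "zc n \<sigma> z" using lt z by (simp add: zc_def)
  then show ?thesis using that C D z by simp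
qed

lemma zc_blocks:
  assumes f: "order_emb f" and z: "zc n \<sigma> z"
  shows "f ` pts n \<sigma> = f ` pt \<sigma> ` {1..z} \<union> f ` pt \<sigma> ` {z<..n}"
    "\<forall>p\<in>f ` pt \<sigma> ` {1..z}. \<forall>q\<in>f ` pt \<sigma> ` {z<..n}. p \<lless> q"
proof -
  have "{1..n} = {1..z} \<union> {z<..n}" using z by (auto simp: zc_def)
  then show "f ` pts n \<sigma> = f ` pt \<sigma> ` {1..z} \<union> f ` pt \<sigma> ` {z<..n}"
    unfolding pts_def by (simp add: image_Un)
  show "\<forall>p\<in>f ` pt \<sigma> ` {1..z}. \<forall>q\<in>f ` pt \<sigma> ` {z<..n}. p \<lless> q"
  proof (intro ballI)
    fix p q assume "p \<in> f ` pt \<sigma> ` {1..z}" "q \<in> f ` pt \<sigma> ` {z<..n}"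
    then obtain i j where ij: "i \<in> {1..z}" "j \<in> {z<..n}" "p = f (pt \<sigma> i)" "q = f (pt \<sigma> j)" by auto
    then have "\<sigma> i < \<sigma> j" "i < j" using z by (auto simp: zc_def)
    then have "pt \<sigma> i \<lless> pt \<sigma> j" by (simp add: below_def)
    then show "p \<lless> q" using ij emb_below[OF f] by simp
  qed
qed

lemma order_emb_id: "order_emb (\<lambda>p. p)" by (simp add: order_emb_def)

lemma dsum_pts: "dsum (pts n \<sigma>) \<longleftrightarrow> (\<exists>z. 0 < z \<and> z < n \<and> zc n \<sigma> z)"
proof
  assume "dsum (pts n \<sigma>)"
  then obtain A B where AB: "A \<noteq> {}" "B \<noteq> {}" "pts n \<sigma> = A \<union> B" "A \<inter> B = {}" "\<forall>p\<in>A. \<forall>q\<in>B. p \<lless> q"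
    by (rule dsumE)
  obtain z where z: "zc n \<sigma> z" "A = (\<lambda>p. p) ` pt \<sigma> ` {1..z}" "B = (\<lambda>p. p) ` pt \<sigma> ` {z<..n}"
    using block_split[OF order_emb_id, of n \<sigma> A B] AB(3,5) by auto
  then show "\<exists>z. 0 < z \<and> z < n \<and> zc n \<sigma> z" using AB(1,2) by (intro exI[of _ z]) auto
next
  assume "\<exists>z. 0 < z \<and> z < n \<and> zc n \<sigma> z"
  then obtain z where z: "0 < z" "z < n" "zc n \<sigma> z" by auto
  show "dsum (pts n \<sigma>)"
    using zc_blocks[OF order_emb_id z(3)] z
    by (intro dsumI[of "pt \<sigma> ` {1..z}" "pt \<sigma> ` {z<..n}"]) auto
qed

text \<open>
  A decomposition with minimal \<open>e\<close> has \<open>e\<close> in its lower summand, so it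
  comes from a cut of \<open>\<sigma>\<close> whose upper block lies above \<open>e\<close>. The
  parameter \<open>d\<close> is the first cut from which on that is true; the cut \<open>0\<close>
  is allowed and the cut \<open>n\<close> is not.
\<close>

lemma dsum_insert_e:
  assumes f: "order_emb f" and mn: "\<forall>q\<in>f ` pts n \<sigma>. \<not> q \<lless> e"
    and H: "\<And>z. zc n \<sigma> z \<Longrightarrow> (\<forall>i\<in>{z<..n}. e \<lless> f (pt \<sigma> i)) \<longleftrightarrow> d \<le> z"
    and e: "e \<notin> f ` pts n \<sigma>"
  shows "dsum (insert e (f ` pts n \<sigma>)) \<longleftrightarrow> (\<exists>z<n. zc n \<sigma> z \<and> d \<le> z)"
proof
  assume "dsum (insert e (f ` pts n \<sigma>))"
  moreover have "\<forall>q\<in>insert e (f ` pts n \<sigma>). \<not> q \<lless> e" using mn by (auto simp: below_def)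
  ultimately obtain A B where AB: "e \<in> A" "B \<noteq> {}" "B \<subseteq> f ` pts n \<sigma>" "insert e (f ` pts n \<sigma>) = A \<union> B"
    "A \<inter> B = {}" "\<forall>p\<in>A. \<forall>q\<in>B. p \<lless> q" by (rule dsum_insert_min)
  have "f ` pts n \<sigma> = (A - {e}) \<union> B" using AB(3,4) e by auto
  moreover have "\<forall>p\<in>A - {e}. \<forall>q\<in>B. p \<lless> q" using AB(6) by auto
  ultimately obtain z where z: "zc n \<sigma> z" "A - {e} = f ` pt \<sigma> ` {1..z}" "B = f ` pt \<sigma> ` {z<..n}"
    by (rule block_split[OF f])
  have "z < n" using z AB(2) by auto
  moreover have "d \<le> z" using H[OF z(1)] AB(1,6) z(3) by auto
  ultimately show "\<exists>z<n. zc n \<sigma> z \<and> d \<le> z" using z by auto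
next
  assume "\<exists>z<n. zc n \<sigma> z \<and> d \<le> z"
  then obtain z where z: "z < n" "zc n \<sigma> z" "d \<le> z" by auto
  show "dsum (insert e (f ` pts n \<sigma>))"
  proof (rule dsumI[of "insert e (f ` pt \<sigma> ` {1..z})" "f ` pt \<sigma> ` {z<..n}"])
    show "f ` pt \<sigma> ` {z<..n} \<noteq> {}" using z by auto
    show "insert e (f ` pts n \<sigma>) = insert e (f ` pt \<sigma> ` {1..z}) \<union> f ` pt \<sigma> ` {z<..n}"
      using zc_blocks(1)[OF f z(2)] by auto
    show "p \<lless> q" if "p \<in> insert e (f ` pt \<sigma> ` {1..z})" "q \<in> f ` pt \<sigma> ` {z<..n}" for p q
      using that zc_blocks(2)[OF f z(2)] H[OF z(2)] z(3) by blast
  qed auto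
qed

lemma dsum_insert_w:
  assumes f: "order_emb f" and mx: "\<forall>q\<in>f ` pts n \<sigma>. \<not> w \<lless> q"
    and H: "\<And>z. zc n \<sigma> z \<Longrightarrow> (\<forall>i\<in>{1..z}. f (pt \<sigma> i) \<lless> w) \<longleftrightarrow> z \<le> c"
    and w: "w \<notin> f ` pts n \<sigma>"
  shows "dsum (insert w (f ` pts n \<sigma>)) \<longleftrightarrow> (\<exists>z>0. zc n \<sigma> z \<and> z \<le> c)"
proof
  assume "dsum (insert w (f ` pts n \<sigma>))"
  moreover have "\<forall>q\<in>insert w (f ` pts n \<sigma>). \<not> w \<lless> q" using mx by (auto simp: below_def)
  ultimately obtain A B where AB: "w \<in> B" "A \<noteq> {}" "A \<subseteq> f ` pts n \<sigma>" "insert w (f ` pts n \<sigma>) = A \<union> B"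
    "A \<inter> B = {}" "\<forall>p\<in>A. \<forall>q\<in>B. p \<lless> q" by (rule dsum_insert_max)
  have "f ` pts n \<sigma> = A \<union> (B - {w})" using AB(3,4) w by auto
  moreover have "\<forall>p\<in>A. \<forall>q\<in>B - {w}. p \<lless> q" using AB(6) by auto
  ultimately obtain z where z: "zc n \<sigma> z" "A = f ` pt \<sigma> ` {1..z}" "B - {w} = f ` pt \<sigma> ` {z<..n}"
    by (rule block_split[OF f])
  have "z > 0" using z AB(2) by auto
  moreover have "z \<le> c" using H[OF z(1)] AB(1,6) z(2) by auto
  ultimately show "\<exists>z>0. zc n \<sigma> z \<and> z \<le> c" using z by auto
next
  assume "\<exists>z>0. zc n \<sigma> z \<and> z \<le> c"
  then obtain z where z: "z > 0" "zc n \<sigma> z" "z \<le> c" by auto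
  show "dsum (insert w (f ` pts n \<sigma>))"
  proof (rule dsumI[of "f ` pt \<sigma> ` {1..z}" "insert w (f ` pt \<sigma> ` {z<..n})"])
    show "f ` pt \<sigma> ` {1..z} \<noteq> {}" using z by auto
    show "insert w (f ` pts n \<sigma>) = f ` pt \<sigma> ` {1..z} \<union> insert w (f ` pt \<sigma> ` {z<..n})"
      using zc_blocks(1)[OF f z(2)] by auto
    show "p \<lless> q" if "p \<in> f ` pt \<sigma> ` {1..z}" "q \<in> insert w (f ` pt \<sigma> ` {z<..n})" for p q
      using that zc_blocks(2)[OF f z(2)] H[OF z(2)] z(3) by blast
  qed auto
qed

text \<open>
  If \<open>e\<close> lies below \<open>w\<close>, every cut between \<open>d\<close> and
  \<open>c\<close> is good, including the trivial ones, as \<open>e\<close> and \<open>w\<close>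
  make both summands nonempty.
\<close>

lemma dsum_insert_ew:
  assumes f: "order_emb f"
    and mn: "\<forall>q\<in>insert w (f ` pts n \<sigma>). \<not> q \<lless> e" and mx: "\<forall>q\<in>insert e (f ` pts n \<sigma>). \<not> w \<lless> q"
    and He: "\<And>z. zc n \<sigma> z \<Longrightarrow> (\<forall>i\<in>{z<..n}. e \<lless> f (pt \<sigma> i)) \<longleftrightarrow> d \<le> z"
    and Hw: "\<And>z. zc n \<sigma> z \<Longrightarrow> (\<forall>i\<in>{1..z}. f (pt \<sigma> i) \<lless> w) \<longleftrightarrow> z \<le> c"
    and nin: "e \<notin> f ` pts n \<sigma>" "w \<notin> f ` pts n \<sigma>" "e \<noteq> w"
  shows "dsum (insert e (insert w (f ` pts n \<sigma>))) \<longleftrightarrow> e \<lless> w \<and> (\<exists>z. zc n \<sigma> z \<and> d \<le> z \<and> z \<le> c)"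
proof
  assume ds: "dsum (insert e (insert w (f ` pts n \<sigma>)))"
  have mn': "\<forall>q\<in>insert e (insert w (f ` pts n \<sigma>)). \<not> q \<lless> e" using mn by (auto simp: below_def)
  obtain A B where AB: "e \<in> A" "B \<noteq> {}" "B \<subseteq> insert w (f ` pts n \<sigma>)"
     "insert e (insert w (f ` pts n \<sigma>)) = A \<union> B" "A \<inter> B = {}" "\<forall>p\<in>A. \<forall>q\<in>B. p \<lless> q"
    using ds mn' by (rule dsum_insert_min)
  have wB: "w \<in> B"
  proof (rule ccontr)
    assume "w \<notin> B"
    then have "w \<in> A" "B \<subseteq> f ` pts n \<sigma>" using AB(3,4) by auto
    moreover obtain q where "q \<in> B" using AB(2) by auto
    ultimately show False using AB(6) mx by auto
  qed
  have "f ` pts n \<sigma> = (A - {e}) \<union> (B - {w})"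
  proof
    show "f ` pts n \<sigma> \<subseteq> A - {e} \<union> (B - {w})" using AB(4) nin by auto
    have "w \<notin> A" "e \<notin> B" using AB(1,5) wB by auto
    then show "A - {e} \<union> (B - {w}) \<subseteq> f ` pts n \<sigma>" using AB(4) by auto
  qed
  moreover have "\<forall>p\<in>A - {e}. \<forall>q\<in>B - {w}. p \<lless> q" using AB(6) by auto
  ultimately obtain z where z: "zc n \<sigma> z" "A - {e} = f ` pt \<sigma> ` {1..z}" "B - {w} = f ` pt \<sigma> ` {z<..n}"
    by (rule block_split[OF f])
  have "\<forall>i\<in>{z<..n}. e \<lless> f (pt \<sigma> i)" using AB(1,6) z(3) by blast
  moreover have "\<forall>i\<in>{1..z}. f (pt \<sigma> i) \<lless> w" using wB AB(6) z(2) by blast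
  ultimately show "e \<lless> w \<and> (\<exists>z. zc n \<sigma> z \<and> d \<le> z \<and> z \<le> c)"
    using He[OF z(1)] Hw[OF z(1)] z(1) wB AB(1,6) by auto
next
  assume "e \<lless> w \<and> (\<exists>z. zc n \<sigma> z \<and> d \<le> z \<and> z \<le> c)"
  then obtain z where z: "e \<lless> w" "zc n \<sigma> z" "d \<le> z" "z \<le> c" by auto
  show "dsum (insert e (insert w (f ` pts n \<sigma>)))"
  proof (rule dsumI[of "insert e (f ` pt \<sigma> ` {1..z})" "insert w (f ` pt \<sigma> ` {z<..n})"])
    show "insert e (insert w (f ` pts n \<sigma>)) = insert e (f ` pt \<sigma> ` {1..z}) \<union> insert w (f ` pt \<sigma> ` {z<..n})"
      using zc_blocks(1)[OF f z(2)] by auto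
    show "p \<lless> q" if "p \<in> insert e (f ` pt \<sigma> ` {1..z})" "q \<in> insert w (f ` pt \<sigma> ` {z<..n})" for p q
      using that zc_blocks(2)[OF f z(2)] He[OF z(2)] Hw[OF z(2)] z by blast
  qed auto
qed

section \<open>Inserting a value, and joining two blocks\<close>

text \<open>
  The increasing enumeration of the natural numbers other than \<open>v\<close>.
\<close>

definition bump :: "nat \<Rightarrow> nat \<Rightarrow> nat" where
  "bump v y = (if y < v then y else Suc y)"

text \<open>
  The permutation that arises from \<open>\<sigma>\<close> by inserting the value \<open>v\<close>
  at position \<open>x\<close>.
\<close>

definition ins :: "nat \<Rightarrow> nat \<Rightarrow> (nat \<Rightarrow> nat) \<Rightarrow> nat \<Rightarrow> nat" where
  "ins x v \<sigma> i = (if i < x then bump v (\<sigma> i) else if i = x then v else bump v (\<sigma> (i - 1)))"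

definition shift :: "nat \<Rightarrow> nat \<Rightarrow> point \<Rightarrow> point" where
  "shift x v p = (if fst p < int x then fst p else fst p + 1, if snd p < int v then snd p else snd p + 1)"

lemma bump_less [simp]: "bump v y < bump v z \<longleftrightarrow> y < z"
  by (auto simp: bump_def)

lemma bump_inj [simp]: "bump v y = bump v z \<longleftrightarrow> y = z"
  by (auto simp: bump_def)

lemma bump_neq [simp]: "bump v y \<noteq> v" "v \<noteq> bump v y"
  by (auto simp: bump_def)

lemma bump_surj: "y \<noteq> v \<Longrightarrow> bump v (if y < v then y else y - 1) = y"
  by (auto simp: bump_def)

lemma bump_range: "1 \<le> v \<Longrightarrow> v \<le> Suc n \<Longrightarrow> {1..Suc n} = insert v (bump v ` {1..n})"
proof (intro set_eqI iffI)
  fix i assume v: "1 \<le> v" "v \<le> Suc n" and i: "i \<in> {1..Suc n}"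
  show "i \<in> insert v (bump v ` {1..n})"
  proof (cases "i = v")
    case False
    then show ?thesis using v i
      by (intro insertI2 image_eqI[of _ _ "if i < v then i else i - 1"]) (auto simp: bump_surj)
  qed simp
qed (auto simp: bump_def split: if_splits)

lemma ins_at [simp]: "ins x v \<sigma> x = v" by (simp add: ins_def)

lemma ins_bump [simp]: "ins x v \<sigma> (bump x i) = bump v (\<sigma> i)"
  by (auto simp: ins_def bump_def)

lemma order_emb_shift: "order_emb (shift x v)"
  by (auto simp: order_emb_def shift_def)

lemma order_emb_comp: "order_emb f \<Longrightarrow> order_emb g \<Longrightarrow> order_emb (\<lambda>p. f (g p))"
  by (subst order_emb_def) (simp only: emb_fst_snd simp_thms)

lemma shift_pt: "shift x v (pt \<sigma> i) = (int (bump x i), int (bump v (\<sigma> i)))"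
  by (simp add: shift_def bump_def)

lemma pts_ins:
  assumes "1 \<le> x" "x \<le> Suc n"
  shows "pts (Suc n) (ins x v \<sigma>) = insert (int x, int v) (shift x v ` pts n \<sigma>)"
proof -
  have "pt (ins x v \<sigma>) (bump x i) = shift x v (pt \<sigma> i)" for i
    by (simp add: shift_pt) (simp add: pt_def)
  then have "pt (ins x v \<sigma>) ` bump x ` {1..n} = shift x v ` pt \<sigma> ` {1..n}"
    by (simp add: image_image)
  then show ?thesis
    unfolding pts_def bump_range[OF assms] by (simp add: pt_def)
qed

lemma ins_notin: "(int x, int v) \<notin> shift x v ` pts n \<sigma>"
  by (auto simp: pts_def shift_pt)

lemma ins_permutes:
  assumes p: "\<sigma> permutes {1..n}" and x: "1 \<le> x" "x \<le> Suc n" and v: "1 \<le> v" "v \<le> Suc n"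
  shows "ins x v \<sigma> permutes {1..Suc n}"
proof (rule bij_imp_permutes)
  have s: "\<sigma> ` {1..n} = {1..n}" by (rule permutes_image[OF p])
  have "ins x v \<sigma> ` {1..Suc n} = insert v (bump v ` \<sigma> ` {1..n})"
    unfolding bump_range[OF x] by (simp add: image_image)
  also have "\<dots> = {1..Suc n}" unfolding s using bump_range[OF v] by simp
  finally have im: "ins x v \<sigma> ` {1..Suc n} = {1..Suc n}" .
  then show "bij_betw (ins x v \<sigma>) {1..Suc n} {1..Suc n}"
    by (simp add: bij_betw_def eq_card_imp_inj_on)
  fix i assume i: "i \<notin> {1..Suc n}"
  have o: "\<sigma> i = i" "\<sigma> (i - 1) = i - 1" using i by (auto intro!: permutes_not_in[OF p])
  show "ins x v \<sigma> i = i" using o i x v by (cases "i = 0") (auto simp: ins_def bump_def)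
qed

lemma ins_cong:
  assumes "ins x v \<sigma> = ins x v \<sigma>'"
  shows "\<sigma> = \<sigma>'"
proof
  fix i
  have "ins x v \<sigma> (bump x i) = ins x v \<sigma>' (bump x i)" using assms by simp
  then show "\<sigma> i = \<sigma>' i" by simp
qed

lemma ins_surj:
  assumes p: "\<pi> permutes {1..Suc n}" and x: "1 \<le> x" "x \<le> Suc n"
  obtains \<sigma> where "\<sigma> permutes {1..n}" "\<pi> = ins x (\<pi> x) \<sigma>"
proof -
  define v where "v = \<pi> x"
  define \<sigma> where "\<sigma> i = (let y = \<pi> (bump x i) in if y < v then y else y - 1)" for i
  have v: "1 \<le> v" "v \<le> Suc n" using permutes_in_image[OF p, of x] x by (auto simp: v_def)
  have inj: "inj \<pi>" by (rule permutes_inj[OF p])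
  have ne: "\<pi> (bump x i) \<noteq> v" for i unfolding v_def using injD[OF inj, of "bump x i" x] by auto
  have b: "bump v (\<sigma> i) = \<pi> (bump x i)" for i
    using bump_surj[OF ne] by (simp add: \<sigma>_def Let_def)
  have eq: "\<pi> = ins x v \<sigma>"
  proof
    fix i
    show "\<pi> i = ins x v \<sigma> i"
    proof (cases "i = x")
      case False
      then have "i = bump x (if i < x then i else i - 1)" by (simp add: bump_surj)
      then obtain k where "i = bump x k" by blast
      then show ?thesis using b by simp
    qed (simp add: v_def)
  qed
  have "\<sigma> permutes {1..n}"
  proof (rule bij_imp_permutes)
    have "inj \<sigma>"
    proof (rule injI)
      fix i j assume "\<sigma> i = \<sigma> j"
      then have "\<pi> (bump x i) = \<pi> (bump x j)" using b by metis
      then show "i = j" using injD[OF inj] by fastforce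
    qed
    moreover have "\<sigma> ` {1..n} \<subseteq> {1..n}"
    proof
      fix y assume "y \<in> \<sigma> ` {1..n}"
      then obtain i where i: "i \<in> {1..n}" "y = \<sigma> i" by auto
      have "bump x i \<in> {1..Suc n}" using i by (auto simp: bump_def)
      then have "\<pi> (bump x i) \<in> {1..Suc n}" using permutes_in_image[OF p] by blast
      then have "bump v y \<in> {1..Suc n}" using b i by simp
      then show "y \<in> {1..n}" using v by (auto simp: bump_def split: if_splits)
    qed
    ultimately show "bij_betw \<sigma> {1..n} {1..n}"
      by (metis bij_betw_def endo_inj_surj finite_atLeastAtMost inj_on_subset subset_UNIV)
    fix i assume i: "i \<notin> {1..n}"
    then have "bump x i \<notin> {1..Suc n}" using x by (auto simp: bump_def)
    then have "\<pi> (bump x i) = bump x i" by (rule permutes_not_in[OF p])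
    then show "\<sigma> i = i" using i x v by (auto simp: \<sigma>_def bump_def)
  qed
  then show ?thesis by (rule that[OF _ eq[unfolded v_def]])
qed

definition Av :: "nat \<Rightarrow> (nat \<Rightarrow> nat) set" where
  "Av n = {\<pi>. \<pi> permutes {1..n} \<and> avoids (pts n \<pi>)}"

definition Dec :: "nat \<Rightarrow> (nat \<Rightarrow> nat) set" where
  "Dec n = {\<pi> \<in> Av n. dsum (pts n \<pi>)}"

definition Ind :: "nat \<Rightarrow> (nat \<Rightarrow> nat) set" where
  "Ind n = {\<pi> \<in> Av n. \<not> dsum (pts n \<pi>)}"

definition wt :: "nat \<Rightarrow> (nat \<Rightarrow> nat) \<Rightarrow> rat fps" where
  "wt n \<pi> = fps_X ^ ninv (pts n \<pi>)"

lemma finite_Av [simp]: "finite (Av n)"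
  unfolding Av_def by (rule finite_subset[OF _ finite_permutations[of "{1..n}"]]) auto

lemma finite_Dec [simp]: "finite (Dec n)" by (simp add: Dec_def)
lemma finite_Ind [simp]: "finite (Ind n)" by (simp add: Ind_def)

text \<open>
  The possible first blocks of a decomposable 1324-avoider: a later point would complete a 132 in
  that block to a 1324. Dually, the last block avoids 213.
\<close>

definition I132 :: "nat \<Rightarrow> (nat \<Rightarrow> nat) set" where
  "I132 a = {\<alpha>. \<alpha> permutes {1..a} \<and> \<not> dsum (pts a \<alpha>) \<and>
     \<not> (\<exists>i\<in>{1..a}. \<exists>j\<in>{1..a}. \<exists>k\<in>{1..a}. i < j \<and> j < k \<and> \<alpha> i < \<alpha> k \<and> \<alpha> k < \<alpha> j)}"

definition I213 :: "nat \<Rightarrow> (nat \<Rightarrow> nat) set" where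
  "I213 b = {\<beta>. \<beta> permutes {1..b} \<and> \<not> dsum (pts b \<beta>) \<and>
     \<not> (\<exists>i\<in>{1..b}. \<exists>j\<in>{1..b}. \<exists>k\<in>{1..b}. i < j \<and> j < k \<and> \<beta> j < \<beta> i \<and> \<beta> i < \<beta> k)}"

lemma finite_I132 [simp]: "finite (I132 n)"
  unfolding I132_def by (rule finite_subset[OF _ finite_permutations[of "{1..n}"]]) auto
lemma finite_I213 [simp]: "finite (I213 n)"
  unfolding I213_def by (rule finite_subset[OF _ finite_permutations[of "{1..n}"]]) auto

text \<open>
  The direct sum of \<open>\<alpha>\<close>, an identity permutation and \<open>\<beta>\<close>.
  Since a permutation of \<open>{1..a}\<close> is the identity elsewhere, the middle block is
  already part of \<open>\<alpha>\<close> and only the starting point \<open>c\<close> of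
  \<open>\<beta>\<close> has to be known.
\<close>

definition join :: "nat \<Rightarrow> (nat \<Rightarrow> nat) \<Rightarrow> (nat \<Rightarrow> nat) \<Rightarrow> nat \<Rightarrow> nat" where
  "join c \<alpha> \<beta> i = (if i \<le> c then \<alpha> i else c + \<beta> (i - c))"

lemma I132_permutes: "\<alpha> \<in> I132 a \<Longrightarrow> \<alpha> permutes {1..a}" by (simp add: I132_def)
lemma I213_permutes: "\<alpha> \<in> I213 a \<Longrightarrow> \<alpha> permutes {1..a}" by (simp add: I213_def)

context
  fixes n a b c :: nat and \<alpha> \<beta> :: "nat \<Rightarrow> nat"
  assumes a: "1 \<le> a" and b: "1 \<le> b" and ac: "a \<le> c" and cb: "c + b = n"
    and A: "\<alpha> \<in> I132 a" and B: "\<beta> \<in> I213 b"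
begin

lemma alpha_le: "i \<le> a \<Longrightarrow> \<alpha> i \<le> a" and alpha_id: "a < i \<Longrightarrow> \<alpha> i = i"
  using permutes_in_image[OF I132_permutes[OF A], of i] permutes_not_in[OF I132_permutes[OF A], of i]
  by (cases "i = 0"; force)+

lemma beta_range: "i \<in> {1..b} \<Longrightarrow> \<beta> i \<in> {1..b}" and beta_id: "i \<notin> {1..b} \<Longrightarrow> \<beta> i = i"
  using permutes_in_image[OF I213_permutes[OF B], of i] permutes_not_in[OF I213_permutes[OF B], of i] by auto

lemma join_permutes: "join c \<alpha> \<beta> permutes {1..n}"
proof (rule bij_imp_permutes)
  have ap: "\<alpha> permutes {1..c}" using permutes_subset[OF I132_permutes[OF A]] ac by auto
  have "join c \<alpha> \<beta> ` {1..c} = \<alpha> ` {1..c}" by (rule image_cong) (auto simp: join_def)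
  then have 1: "join c \<alpha> \<beta> ` {1..c} = {1..c}" using permutes_image[OF ap] by simp
  have "{c<..n} = (\<lambda>i. c + i) ` {1..b}" using cb
  proof (intro set_eqI iffI)
    fix i assume "i \<in> {c<..n}"
    then show "i \<in> (\<lambda>i. c + i) ` {1..b}" using cb by (intro image_eqI[of _ _ "i - c"]) auto
  qed auto
  moreover have "join c \<alpha> \<beta> ` (\<lambda>i. c + i) ` {1..b} = (\<lambda>i. c + i) ` \<beta> ` {1..b}"
    unfolding image_image by (rule image_cong) (auto simp: join_def)
  ultimately have 2: "join c \<alpha> \<beta> ` {c<..n} = {c<..n}" using permutes_image[OF I213_permutes[OF B]] by simp
  have "{1..n} = {1..c} \<union> {c<..n}" using cb by auto
  then have "join c \<alpha> \<beta> ` {1..n} = {1..n}" using 1 2 by (simp add: image_Un)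
  then show "bij_betw (join c \<alpha> \<beta>) {1..n} {1..n}" by (simp add: bij_betw_def eq_card_imp_inj_on)
  fix i assume "i \<notin> {1..n}"
  then consider "i = 0" | "n < i" by force
  then show "join c \<alpha> \<beta> i = i"
  proof cases
    case 1
    then show ?thesis using permutes_not_in[OF I132_permutes[OF A], of 0] by (simp add: join_def)
  next
    case 2
    then have "i - c \<notin> {1..b}" using cb by auto
    then show ?thesis using beta_id[of "i - c"] 2 cb by (simp add: join_def)
  qed
qed

text \<open>
  So the sizes of the two outer blocks can be read off from the set of cuts, and this set is all
  that the insertion of extreme points depends on.
\<close>

lemma join_zc: "zc n (join c \<alpha> \<beta>) z \<longleftrightarrow> z = 0 \<or> z = n \<or> a \<le> z \<and> z \<le> c"
proof
  assume "z = 0 \<or> z = n \<or> a \<le> z \<and> z \<le> c"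
  moreover have "zc n (join c \<alpha> \<beta>) z" if z: "a \<le> z" "z \<le> c"
    unfolding zc_def
  proof (intro conjI ballI)
    show "z \<le> n" using z cb by simp
    fix j k assume j: "j \<in> {1..z}" and k: "k \<in> {z<..n}"
    have "join c \<alpha> \<beta> j \<le> z"
      using j z alpha_le[of j] alpha_id[of j] by (cases "j \<le> a") (auto simp: join_def)
    moreover have "join c \<alpha> \<beta> k > z"
    proof (cases "k \<le> c")
      case True
      then show ?thesis using k z alpha_id[of k] by (auto simp: join_def)
    next
      case False
      then have "k - c \<in> {1..b}" using k cb by auto
      then show ?thesis using beta_range[of "k - c"] False z by (simp add: join_def)
    qed
    ultimately show "join c \<alpha> \<beta> j < join c \<alpha> \<beta> k" by simp
  qed
  ultimately show "zc n (join c \<alpha> \<beta>) z" by auto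
next
  assume zc: "zc n (join c \<alpha> \<beta>) z"
  then have zn: "z \<le> n" and lt: "\<And>j k. j \<in> {1..z} \<Longrightarrow> k \<in> {z<..n} \<Longrightarrow> join c \<alpha> \<beta> j < join c \<alpha> \<beta> k"
    by (auto simp: zc_def)
  show "z = 0 \<or> z = n \<or> a \<le> z \<and> z \<le> c"
  proof (rule ccontr)
    assume "\<not> ?thesis"
    then have z: "0 < z" "z < n" "z < a \<or> c < z" using zn by auto
    from z(3) show False
    proof
      assume za: "z < a"
      have "zc a \<alpha> z"
        unfolding zc_def
      proof (intro conjI ballI)
        fix j k assume "j \<in> {1..z}" "k \<in> {z<..a}"
        then show "\<alpha> j < \<alpha> k" using lt[of j k] za ac cb by (simp add: join_def)
      qed (use za in simp)
      then have "dsum (pts a \<alpha>)" using dsum_pts za z(1) by blast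
      then show False using A by (simp add: I132_def)
    next
      assume zb: "c < z"
      have "zc b \<beta> (z - c)"
        unfolding zc_def
      proof (intro conjI ballI)
        fix j k assume "j \<in> {1..z - c}" "k \<in> {z - c<..b}"
        then have "c + j \<in> {1..z}" "c + k \<in> {z<..n}" "1 \<le> j" "1 \<le> k" using zb cb by auto
        then show "\<beta> j < \<beta> k" using lt[of "c + j" "c + k"] by (simp add: join_def)
      qed (use z cb in simp)
      moreover have "0 < z - c" "z - c < b" using z zb cb by auto
      ultimately have "dsum (pts b \<beta>)" using dsum_pts by blast
      then show False using B by (simp add: I213_def)
    qed
  qed
qed

lemma join_ninv: "ninv (pts n (join c \<alpha> \<beta>)) = ninv (pts a \<alpha>) + ninv (pts b \<beta>)"
proof -
  let ?t = "\<lambda>p :: point. (fst p + int c, snd p + int c)"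
  let ?s = "join c \<alpha> \<beta>"
  have emb: "order_emb ?t" by (simp add: order_emb_def)
  have r1: "pt ?s ` {1..c} = pts c \<alpha>" unfolding pts_def by (rule image_cong) (auto simp: pt_def join_def)
  have "{c<..n} = (\<lambda>i. i + c) ` {1..b}"
  proof (intro set_eqI iffI)
    fix i assume "i \<in> {c<..n}"
    then show "i \<in> (\<lambda>i. i + c) ` {1..b}" using cb by (intro image_eqI[of _ _ "i - c"]) auto
  qed (use cb in auto)
  moreover have "pt ?s ` (\<lambda>i. i + c) ` {1..b} = ?t ` pts b \<beta>"
    unfolding pts_def image_image by (rule image_cong) (auto simp: pt_def join_def)
  ultimately have r2: "pt ?s ` {c<..n} = ?t ` pts b \<beta>" by simp
  have zc: "zc n ?s c" using join_zc ac by simp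
  have bl: "pts n ?s = pts c \<alpha> \<union> ?t ` pts b \<beta>" "\<forall>p\<in>pts c \<alpha>. \<forall>q\<in>?t ` pts b \<beta>. p \<lless> q"
    using zc_blocks[OF order_emb_id zc] unfolding image_ident r1 r2 by blast+
  have "pts c \<alpha> \<inter> ?t ` pts b \<beta> = {}" using bl(2) by (force simp: below_def)
  moreover have "cross (pts c \<alpha>) (?t ` pts b \<beta>) = 0"
    using bl(2) by (intro cross_none) (metis below_not_inverted(1))
  ultimately have "ninv (pts n ?s) = ninv (pts c \<alpha>) + ninv (pts b \<beta>)"
    unfolding bl(1) by (subst ninv_Un) (simp_all add: emb_ninv[OF emb])
  moreover have "inversions c \<alpha> = inversions a \<alpha>"
  proof -
    have "j \<le> a" if "i < j" "\<alpha> j < \<alpha> i" for i j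
      using that alpha_id[of j] alpha_id[of i] alpha_le[of i] by (cases "i \<le> a"; cases "j \<le> a") auto
    then show ?thesis using ac unfolding inversions_def by fastforce
  qed
  ultimately show ?thesis by (simp add: ninv_pts)
qed

lemma join_avoids: "avoids (pts n (join c \<alpha> \<beta>))"
  unfolding avoids_def
proof (intro notI, elim bexE conjE)
  let ?s = "join c \<alpha> \<beta>"
  fix p q r s assume "p \<in> pts n ?s" "q \<in> pts n ?s" "r \<in> pts n ?s" "s \<in> pts n ?s" and
    o: "fst p < fst q" "fst q < fst r" "fst r < fst s" "snd p < snd r" "snd r < snd q" "snd q < snd s"
  then obtain i j k l where h: "i \<in> {1..n}" "j \<in> {1..n}" "k \<in> {1..n}" "l \<in> {1..n}" "p = pt ?s i" "q = pt ?s j"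
    "r = pt ?s k" "s = pt ?s l" unfolding pts_def by blast
  then have lt: "i < j" "j < k" "k < l" "?s i < ?s k" "?s k < ?s j" "?s j < ?s l" using o by auto
  have no: "\<not> (j \<le> z \<and> z < k)" if "a \<le> z" "z \<le> c" for z
  proof
    assume jz: "j \<le> z \<and> z < k"
    have "zc n ?s z" using join_zc that by blast
    then have "?s j < ?s k" unfolding zc_def using jz h(2,3) by simp
    then show False using lt by simp
  qed
  consider "k \<le> a" | "c < j" using no[of a] no[of j] ac lt by force
  then show False
  proof cases
    case 1
    then have "\<alpha> i < \<alpha> k" "\<alpha> k < \<alpha> j" "i \<in> {1..a}" "j \<in> {1..a}" "k \<in> {1..a}"
      using lt h ac by (auto simp: join_def)
    then show False using A lt unfolding I132_def by blast
  next
    case 2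
    then have "?s j = c + \<beta> (j - c)" "?s k = c + \<beta> (k - c)" "?s l = c + \<beta> (l - c)"
      using lt(1-3) by (simp_all add: join_def)
    then have "\<beta> (k - c) < \<beta> (j - c)" "\<beta> (j - c) < \<beta> (l - c)" using lt(5,6) by simp_all
    moreover have "j - c \<in> {1..b}" "k - c \<in> {1..b}" "l - c \<in> {1..b}" "j - c < k - c" "k - c < l - c"
      using 2 lt(1-3) h(2-4) cb by auto
    ultimately show False using B unfolding I213_def by blast
  qed
qed

lemma join_Dec: "join c \<alpha> \<beta> \<in> Dec n"
proof -
  have "dsum (pts n (join c \<alpha> \<beta>))" unfolding dsum_pts
    using a b ac cb by (intro exI[of _ a]) (auto simp: join_zc)
  then show ?thesis using join_permutes join_avoids by (simp add: Dec_def Av_def)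
qed

end

section \<open>Decomposable avoiders\<close>

text \<open>
  Let \<open>a\<close> be the first and \<open>c\<close> the last proper cut. An inversion between
  two positions that do not both lie in the first or both in the last block would be completed to a
  1324 by the first and the last entry; so all cuts between \<open>a\<close> and \<open>c\<close>
  are proper and the middle part is the identity.
\<close>

lemma Dec_join:
  assumes "\<sigma> \<in> Dec n"
  obtains a b \<alpha> \<beta> where "1 \<le> a" "1 \<le> b" "a + b \<le> n" "\<alpha> \<in> I132 a" "\<beta> \<in> I213 b" "\<sigma> = join (n - b) \<alpha> \<beta>"
proof -
  have p: "\<sigma> permutes {1..n}" and av: "avoids (pts n \<sigma>)" and ds: "dsum (pts n \<sigma>)"
    using assms by (auto simp: Dec_def Av_def)
  have no: False if "i < j" "j < k" "k < l" "\<sigma> i < \<sigma> k" "\<sigma> k < \<sigma> j" "\<sigma> j < \<sigma> l" "1 \<le> i" "l \<le> n" for i j k l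
    by (rule avoidsD[OF av, of "pt \<sigma> i" "pt \<sigma> j" "pt \<sigma> k" "pt \<sigma> l"]) (use that in \<open>auto simp: pts_def\<close>)
  define Z where "Z = {z. 0 < z \<and> z < n \<and> zc n \<sigma> z}"
  have Z: "finite Z" "Z \<noteq> {}" using ds unfolding dsum_pts Z_def by auto
  define a where "a = Min Z"
  define c where "c = Max Z"
  define b where "b = n - c"
  have aZ: "0 < a" "a < n" "zc n \<sigma> a" using Min_in[OF Z] unfolding a_def Z_def by auto
  have cZ: "0 < c" "c < n" "zc n \<sigma> c" using Max_in[OF Z] unfolding c_def Z_def by auto
  have ac: "a \<le> c" using Z unfolding a_def c_def by simp
  have cb: "c + b = n" "1 \<le> b" "n - b = c" using cZ by (auto simp: b_def)
  have minZ: "\<not> zc n \<sigma> z" if "0 < z" "z < a" for z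
  proof
    assume "zc n \<sigma> z"
    then have "z \<in> Z" using that aZ by (simp add: Z_def)
    then have "a \<le> z" unfolding a_def using Z by simp
    then show False using that by simp
  qed
  have maxZ: "\<not> zc n \<sigma> z" if "c < z" "z < n" for z
  proof
    assume "zc n \<sigma> z"
    then have "z \<in> Z" using that by (simp add: Z_def)
    then have "z \<le> c" unfolding c_def using Z by simp
    then show False using that by simp
  qed
  have inj: "\<sigma> i \<noteq> \<sigma> j" if "i \<noteq> j" for i j using injD[OF permutes_inj[OF p]] that by blast
  have lta: "\<sigma> j < \<sigma> k" if "1 \<le> j" "j \<le> a" "a < k" "k \<le> n" for j k using aZ(3) that by (simp add: zc_def)
  have ltc: "\<sigma> j < \<sigma> k" if "1 \<le> j" "j \<le> c" "c < k" "k \<le> n" for j k using cZ(3) that by (simp add: zc_def)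
  \<comment> \<open>No inversion has its right end after \<open>a\<close> and its left end up to \<open>c\<close>: the first and the last entry would complete it to a 1324.\<close>
  have mid: "\<sigma> j < \<sigma> k" if "1 \<le> j" "j < k" "k \<le> n" "a < k" "j \<le> c" for j k
  proof (cases "j \<le> a \<or> c < k")
    case True
    then show ?thesis using lta ltc that by auto
  next
    case False
    show ?thesis
    proof (rule ccontr)
      assume "\<not> ?thesis"
      then have "\<sigma> k < \<sigma> j" using inj[of j k] that by simp
      moreover have "\<sigma> 1 < \<sigma> k" using lta[of 1 k] aZ that False by simp
      moreover have "\<sigma> j < \<sigma> n" using ltc[of j n] cZ that False by simp
      ultimately show False using no[of 1 j k n] False aZ cZ that by simp
    qed
  qed
  have zcm: "zc n \<sigma> z" if "a \<le> z" "z \<le> c" for z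
    unfolding zc_def using that mid cZ by auto
  have id: "\<sigma> i = i" if "a < i" "i \<le> c" for i
  proof -
    have 1: "zc n \<sigma> i" and 2: "zc n \<sigma> (i - 1)" using zcm that by auto
    show ?thesis using zc_le[OF p 1, of i] zc_gt[OF p 2, of i] that cZ by auto
  qed
  define \<alpha> where "\<alpha> i = (if i \<in> {1..a} then \<sigma> i else i)" for i
  define \<beta> where "\<beta> i = (if i \<in> {1..b} then \<sigma> (c + i) - c else i)" for i
  have "\<alpha> ` {1..a} = \<sigma> ` {1..a}" by (rule image_cong) (auto simp: \<alpha>_def)
  then have im: "\<alpha> ` {1..a} = {1..a}" using zc_image[OF p aZ(3)] by simp
  have ap: "\<alpha> permutes {1..a}"
  proof (rule bij_imp_permutes)
    show "bij_betw \<alpha> {1..a} {1..a}" using im by (simp add: bij_betw_def eq_card_imp_inj_on)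
  qed (auto simp: \<alpha>_def)
  have gt: "c < \<sigma> i \<and> \<sigma> i \<le> n" if "c < i" "i \<le> n" for i using zc_gt[OF p cZ(3), of i] that by auto
  have bp: "\<beta> permutes {1..b}"
  proof (rule bij_imp_permutes)
    have "inj_on \<beta> {1..b}"
    proof (rule inj_onI)
      fix i j assume i: "i \<in> {1..b}" and j: "j \<in> {1..b}" and e: "\<beta> i = \<beta> j"
      have "\<sigma> (c + i) - c = \<sigma> (c + j) - c" using e i j by (simp add: \<beta>_def)
      moreover have "c < \<sigma> (c + i)" "c < \<sigma> (c + j)" using gt[of "c + i"] gt[of "c + j"] i j cb by auto
      ultimately have "\<sigma> (c + i) = \<sigma> (c + j)" by linarith
      then show "i = j" using inj[of "c + i" "c + j"] by auto
    qed
    moreover have "\<beta> ` {1..b} \<subseteq> {1..b}"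
    proof
      fix y assume "y \<in> \<beta> ` {1..b}"
      then obtain i where "i \<in> {1..b}" "y = \<sigma> (c + i) - c" by (auto simp: \<beta>_def)
      then show "y \<in> {1..b}" using gt[of "c + i"] cb by auto
    qed
    ultimately show "bij_betw \<beta> {1..b} {1..b}"
      by (metis bij_betw_def endo_inj_surj finite_atLeastAtMost)
  qed (auto simp: \<beta>_def)
  have 1: "\<alpha> \<in> I132 a"
    unfolding I132_def
  proof (intro CollectI conjI ap notI)
    assume "dsum (pts a \<alpha>)"
    then obtain z where z: "0 < z" "z < a" "zc a \<alpha> z" unfolding dsum_pts by auto
    have "zc n \<sigma> z"
      unfolding zc_def
    proof (intro conjI ballI)
      fix j k assume j: "j \<in> {1..z}" and k: "k \<in> {z<..n}"
      show "\<sigma> j < \<sigma> k"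
      proof (cases "k \<le> a")
        case True
        then have "\<alpha> j < \<alpha> k" using z j k by (simp add: zc_def)
        then show ?thesis using True z j k by (simp add: \<alpha>_def)
      next
        case False
        then show ?thesis using lta[of j k] j k z by simp
      qed
    qed (use z aZ in simp)
    then show False using minZ z by blast
  next
    assume "\<exists>i\<in>{1..a}. \<exists>j\<in>{1..a}. \<exists>k\<in>{1..a}. i < j \<and> j < k \<and> \<alpha> i < \<alpha> k \<and> \<alpha> k < \<alpha> j"
    then obtain i j k where h: "i \<in> {1..a}" "j \<in> {1..a}" "k \<in> {1..a}" "i < j" "j < k" "\<sigma> i < \<sigma> k" "\<sigma> k < \<sigma> j"
      by (auto simp: \<alpha>_def)
    then show False using no[of i j k n] lta[of j n] aZ by simp
  qed
  have 2: "\<beta> \<in> I213 b"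
    unfolding I213_def
  proof (intro CollectI conjI bp notI)
    assume "dsum (pts b \<beta>)"
    then obtain z where z: "0 < z" "z < b" "zc b \<beta> z" unfolding dsum_pts by auto
    have "zc n \<sigma> (c + z)"
      unfolding zc_def
    proof (intro conjI ballI)
      fix j k assume j: "j \<in> {1..c + z}" and k: "k \<in> {c + z<..n}"
      show "\<sigma> j < \<sigma> k"
      proof (cases "c < j")
        case True
        then have "j - c \<in> {1..z}" "k - c \<in> {z<..b}" using j k cb by auto
        then have "\<beta> (j - c) < \<beta> (k - c)" using z(3) by (simp add: zc_def)
        moreover have "j - c \<in> {1..b}" "k - c \<in> {1..b}" using True j k cb z by auto
        ultimately show ?thesis using True j k by (simp add: \<beta>_def)
      next
        case False
        then show ?thesis using ltc[of j k] j k z by simp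
      qed
    qed (use z cb in simp)
    then show False using maxZ z cb by simp
  next
    assume "\<exists>i\<in>{1..b}. \<exists>j\<in>{1..b}. \<exists>k\<in>{1..b}. i < j \<and> j < k \<and> \<beta> j < \<beta> i \<and> \<beta> i < \<beta> k"
    then obtain i j k where h: "i \<in> {1..b}" "j \<in> {1..b}" "k \<in> {1..b}" "i < j" "j < k" "\<beta> j < \<beta> i" "\<beta> i < \<beta> k"
      by auto
    then have "\<sigma> (c + j) < \<sigma> (c + i)" "\<sigma> (c + i) < \<sigma> (c + k)"
      using gt[of "c + i"] gt[of "c + j"] gt[of "c + k"] cb by (auto simp: \<beta>_def)
    then show False using no[of 1 "c + i" "c + j" "c + k"] ltc[of 1 "c + j"] h cZ cb by simp
  qed
  have "\<sigma> = join c \<alpha> \<beta>"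
  proof
    fix i
    consider "i = 0" | "1 \<le> i" "i \<le> a" | "a < i" "i \<le> c" | "c < i" "i \<le> n" | "n < i" by linarith
    then show "\<sigma> i = join c \<alpha> \<beta> i"
    proof cases
      case 1
      then show ?thesis using permutes_not_in[OF p, of 0] by (simp add: join_def \<alpha>_def)
    next
      case 4
      then have "i - c \<in> {1..b}" using cb by auto
      then show ?thesis using gt[of i] 4 by (simp add: join_def \<beta>_def)
    next
      case 5
      then have "i - c \<notin> {1..b}" "c < i" using cb by auto
      then show ?thesis using permutes_not_in[OF p, of i] 5 by (simp add: join_def \<beta>_def)
    qed (use ac id in \<open>auto simp: join_def \<alpha>_def\<close>)
  qed
  moreover have "a + b \<le> n" using ac cb by simp
  ultimately show ?thesis using that[of a b \<alpha> \<beta>] 1 2 aZ cb by simp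
qed

definition Pr :: "nat \<Rightarrow> (nat \<times> nat) set" where
  "Pr n = {(a, b). 1 \<le> a \<and> 1 \<le> b \<and> a + b \<le> n}"

lemma finite_Pr [simp]: "finite (Pr n)"
  by (rule finite_subset[of _ "{..n} \<times> {..n}"]) (auto simp: Pr_def)

definition B :: "nat \<Rightarrow> rat fps" where "B a = (\<Sum>\<alpha>\<in>I132 a. wt a \<alpha>)"
definition B' :: "nat \<Rightarrow> rat fps" where "B' b = (\<Sum>\<beta>\<in>I213 b. wt b \<beta>)"

lemma Dec_bij:
  "bij_betw (\<lambda>((a, b), (\<alpha>, \<beta>)). join (n - b) \<alpha> \<beta>) (SIGMA (a, b):Pr n. I132 a \<times> I213 b) (Dec n)"
proof (rule bij_betw_imageI)
  let ?J = "\<lambda>((a, b), (\<alpha>, \<beta>)). join (n - b) \<alpha> \<beta>"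
  show "inj_on ?J (SIGMA (a, b):Pr n. I132 a \<times> I213 b)"
  proof (rule inj_onI)
    fix u u' assume u: "u \<in> (SIGMA (a, b):Pr n. I132 a \<times> I213 b)" "u' \<in> (SIGMA (a, b):Pr n. I132 a \<times> I213 b)"
      and e: "?J u = ?J u'"
    obtain a b \<alpha> \<beta> where U: "u = ((a, b), (\<alpha>, \<beta>))" "1 \<le> a" "1 \<le> b" "a + b \<le> n" "\<alpha> \<in> I132 a" "\<beta> \<in> I213 b"
      using u(1) by (auto simp: Pr_def)
    obtain a' b' \<alpha>' \<beta>' where U': "u' = ((a', b'), (\<alpha>', \<beta>'))" "1 \<le> a'" "1 \<le> b'" "a' + b' \<le> n"
      "\<alpha>' \<in> I132 a'" "\<beta>' \<in> I213 b'"
      using u(2) by (auto simp: Pr_def)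
    have e: "join (n - b) \<alpha> \<beta> = join (n - b') \<alpha>' \<beta>'" using e U(1) U'(1) by simp
    have z: "zc n (join (n - b) \<alpha> \<beta>) z \<longleftrightarrow> z = 0 \<or> z = n \<or> a \<le> z \<and> z \<le> n - b" for z
      by (rule join_zc) (use U in auto)
    have z': "zc n (join (n - b) \<alpha> \<beta>) z \<longleftrightarrow> z = 0 \<or> z = n \<or> a' \<le> z \<and> z \<le> n - b'" for z
      unfolding e by (rule join_zc) (use U' in auto)
    have "a' \<le> a" using z[of a] z'[of a] U(2-4) by auto
    moreover have "a \<le> a'" using z[of a'] z'[of a'] U'(2-4) by auto
    ultimately have aa: "a' = a" by simp
    have "n - b \<le> n - b'" using z[of "n - b"] z'[of "n - b"] U(2-4) by auto
    moreover have "n - b' \<le> n - b" using z[of "n - b'"] z'[of "n - b'"] U'(2-4) by auto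
    ultimately have bb: "b' = b" using U(4) U'(4) by auto
    have "\<alpha> i = \<alpha>' i" for i
    proof (cases "i \<le> n - b")
      case True
      then show ?thesis using fun_cong[OF e, of i] bb by (simp add: join_def)
    next
      case False
      then have "i \<notin> {1..a}" using U(4) by auto
      then show ?thesis using permutes_not_in[OF I132_permutes[OF U(5)]] permutes_not_in[OF I132_permutes[OF U'(5)]] aa by simp
    qed
    moreover have "\<beta> i = \<beta>' i" for i
    proof (cases "i = 0")
      case True
      then show ?thesis using permutes_not_in[OF I213_permutes[OF U(6)], of 0] permutes_not_in[OF I213_permutes[OF U'(6)], of 0] by simp
    next
      case False
      then show ?thesis using fun_cong[OF e, of "n - b + i"] bb by (simp add: join_def)
    qed
    ultimately show "u = u'" using U(1) U'(1) aa bb by (simp add: fun_eq_iff)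
  qed
  show "?J ` (SIGMA (a, b):Pr n. I132 a \<times> I213 b) = Dec n"
  proof
    show "?J ` (SIGMA (a, b):Pr n. I132 a \<times> I213 b) \<subseteq> Dec n"
    proof
      fix \<sigma> assume "\<sigma> \<in> ?J ` (SIGMA (a, b):Pr n. I132 a \<times> I213 b)"
      then obtain a b \<alpha> \<beta> where h: "1 \<le> a" "1 \<le> b" "a + b \<le> n" "\<alpha> \<in> I132 a" "\<beta> \<in> I213 b"
        "\<sigma> = join (n - b) \<alpha> \<beta>" by (auto simp: Pr_def)
      then have "a \<le> n - b" "n - b + b = n" by auto
      then show "\<sigma> \<in> Dec n" unfolding h(6) using join_Dec[OF h(1,2) _ _ h(4,5)] by blast
    qed
    show "Dec n \<subseteq> ?J ` (SIGMA (a, b):Pr n. I132 a \<times> I213 b)"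
    proof
      fix \<sigma> assume "\<sigma> \<in> Dec n"
      then obtain a b \<alpha> \<beta> where "1 \<le> a" "1 \<le> b" "a + b \<le> n" "\<alpha> \<in> I132 a" "\<beta> \<in> I213 b" "\<sigma> = join (n - b) \<alpha> \<beta>"
        by (rule Dec_join)
      then show "\<sigma> \<in> ?J ` (SIGMA (a, b):Pr n. I132 a \<times> I213 b)"
        by (intro image_eqI[of _ _ "((a, b), (\<alpha>, \<beta>))"]) (auto simp: Pr_def)
    qed
  qed
qed

text \<open>
  The weights that occur below depend on a decomposable avoider only through its set of cuts, that
  is, through the sizes \<open>a\<close>, \<open>b\<close> of the outer blocks. So a sum over them
  factors into the two block series.
\<close>

lemma Dec_sum:
  fixes F :: "(nat \<Rightarrow> nat) \<Rightarrow> rat fps"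
  assumes F: "\<And>\<sigma> a b. \<sigma> \<in> Dec n \<Longrightarrow> 1 \<le> a \<Longrightarrow> 1 \<le> b \<Longrightarrow> a + b \<le> n \<Longrightarrow>
     (\<And>z. zc n \<sigma> z \<longleftrightarrow> z = 0 \<or> z = n \<or> a \<le> z \<and> z \<le> n - b) \<Longrightarrow> F \<sigma> = wt n \<sigma> * g a b"
  shows "(\<Sum>\<sigma>\<in>Dec n. F \<sigma>) = (\<Sum>(a, b)\<in>Pr n. B a * B' b * g a b)"
proof -
  let ?J = "\<lambda>((a, b), (\<alpha>, \<beta>)). join (n - b) \<alpha> \<beta>"
  have "(\<Sum>\<sigma>\<in>Dec n. F \<sigma>) = (\<Sum>u\<in>(SIGMA (a, b):Pr n. I132 a \<times> I213 b). F (?J u))"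
    by (rule sum.reindex_bij_betw[OF Dec_bij, symmetric])
  also have "\<dots> = (\<Sum>(a, b)\<in>Pr n. \<Sum>u\<in>I132 a \<times> I213 b. F (?J ((a, b), u)))"
    unfolding case_prod_unfold by (subst sum.Sigma) (simp_all add: case_prod_unfold)
  also have "\<dots> = (\<Sum>(a, b)\<in>Pr n. B a * B' b * g a b)"
  proof (rule sum.cong[OF refl], goal_cases)
    case (1 ab)
    obtain a b where ab_eq: "ab = (a, b)" by (cases ab)
    have ab: "(a, b) \<in> Pr n" using 1 ab_eq by simp
    have "F (?J ((a, b), u)) = (wt a (fst u) * wt b (snd u)) * g a b" if uin: "u \<in> I132 a \<times> I213 b" for u
    proof -
      obtain \<alpha> \<beta> where u: "u = (\<alpha>, \<beta>)" "\<alpha> \<in> I132 a" "\<beta> \<in> I213 b" using uin by auto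
      have h: "1 \<le> a" "1 \<le> b" "a \<le> n - b" "n - b + b = n" "a + b \<le> n" using ab by (auto simp: Pr_def)
      have "F (join (n - b) \<alpha> \<beta>) = wt n (join (n - b) \<alpha> \<beta>) * g a b"
        using join_Dec[OF h(1-4) u(2,3)] join_zc[OF h(1-4) u(2,3)] h by (intro F) auto
      then show ?thesis using join_ninv[OF h(1-4) u(2,3)] u by (simp add: wt_def power_add)
    qed
    then have "(\<Sum>u\<in>I132 a \<times> I213 b. F (?J ((a, b), u))) = (\<Sum>u\<in>I132 a \<times> I213 b. wt a (fst u) * wt b (snd u) * g a b)"
      by (rule sum.cong[OF refl])
    also have "\<dots> = B a * B' b * g a b"
    proof -
      have "B a * B' b = (\<Sum>u\<in>I132 a \<times> I213 b. wt a (fst u) * wt b (snd u))"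
        by (simp add: B_def B'_def sum_product sum.cartesian_product case_prod_unfold)
      then show ?thesis by (simp add: sum_distrib_right)
    qed
    finally show ?case by (simp add: ab_eq)
  qed
  finally show ?thesis .
qed

section \<open>The lowest point is removable\<close>

text \<open>
  The letter M is for movable: the extreme point in the given direction can be removed to leave a
  direct sum.
\<close>

definition Mlow :: "point set \<Rightarrow> bool" where "Mlow T \<longleftrightarrow> (\<exists>e. low T e \<and> dsum (T - {e}))"
definition Mhigh :: "point set \<Rightarrow> bool" where "Mhigh T \<longleftrightarrow> (\<exists>e. high T e \<and> dsum (T - {e}))"
definition Mleft :: "point set \<Rightarrow> bool" where "Mleft T \<longleftrightarrow> (\<exists>e. left T e \<and> dsum (T - {e}))"
definition Mright :: "point set \<Rightarrow> bool" where "Mright T \<longleftrightarrow> (\<exists>e. right T e \<and> dsum (T - {e}))"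

lemma Mlow_insert:
  assumes "\<forall>q\<in>S. snd e < snd q"
  shows "Mlow (insert e S) \<longleftrightarrow> dsum S"
proof -
  have "low (insert e S) e' \<longleftrightarrow> e' = e" for e'
    using assms by (auto simp: low_def)
  moreover have "insert e S - {e} = S" using assms by auto
  ultimately show ?thesis by (simp add: Mlow_def)
qed

lemma Mhigh_insert:
  assumes "\<forall>q\<in>S. snd q < snd e"
  shows "Mhigh (insert e S) \<longleftrightarrow> dsum S"
proof -
  have "high (insert e S) e' \<longleftrightarrow> e' = e" for e'
    using assms by (auto simp: high_def)
  moreover have "insert e S - {e} = S" using assms by auto
  ultimately show ?thesis by (simp add: Mhigh_def)
qed

lemma Mright_insert:
  assumes "\<forall>q\<in>S. fst q < fst e"
  shows "Mright (insert e S) \<longleftrightarrow> dsum S"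
proof -
  have "right (insert e S) e' \<longleftrightarrow> e' = e" for e'
    using assms by (auto simp: right_def)
  moreover have "insert e S - {e} = S" using assms by auto
  ultimately show ?thesis by (simp add: Mright_def)
qed

lemma cross_emb_pts:
  assumes "order_emb f"
  shows "cross {e} (f ` pts n \<sigma>) = card {i \<in> {1..n}. inverted e (f (pt \<sigma> i))}"
proof -
  have "{q \<in> f ` pts n \<sigma>. inverted e q} = (\<lambda>i. f (pt \<sigma> i)) ` {i \<in> {1..n}. inverted e (f (pt \<sigma> i))}"
    by (auto simp: pts_def)
  moreover have "inj (\<lambda>i. f (pt \<sigma> i))"
    using inj_compose[OF emb_inj[OF assms] inj_pt[of \<sigma> UNIV]] by (simp add: comp_def)
  ultimately show ?thesis unfolding cross_single
    by (simp add: card_image inj_on_subset)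
qed

lemma perm_range: "\<sigma> permutes {1..n} \<Longrightarrow> i \<in> {1..n} \<Longrightarrow> 1 \<le> \<sigma> i \<and> \<sigma> i \<le> n"
  using permutes_in_image[of \<sigma> "{1..n}" i] by auto

context
  fixes n x :: nat and \<sigma> :: "nat \<Rightarrow> nat"
  assumes p: "\<sigma> permutes {1..n}" and x: "1 \<le> x" "x \<le> Suc n"
begin

lemma low_ins_pts: "pts (Suc n) (ins x 1 \<sigma>) = insert (int x, 1) (shift x 1 ` pts n \<sigma>)"
  using pts_ins[OF x, of 1 \<sigma>] by simp

lemma low_ins_lt: "\<forall>q\<in>shift x 1 ` pts n \<sigma>. snd (int x, 1 :: int) < snd q"
proof
  fix q assume "q \<in> shift x 1 ` pts n \<sigma>"
  then obtain i where i: "i \<in> {1..n}" "q = shift x 1 (pt \<sigma> i)" by (auto simp: pts_def)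
  show "snd (int x, 1 :: int) < snd q" using perm_range[OF p i(1)] unfolding i(2) shift_pt by (simp add: bump_def)
qed

lemma low_ins_notin: "(int x, 1) \<notin> shift x 1 ` pts n \<sigma>"
  using low_ins_lt by (metis less_irrefl)

lemma low_ins_Mlow: "Mlow (pts (Suc n) (ins x 1 \<sigma>)) \<longleftrightarrow> dsum (pts n \<sigma>)"
  unfolding low_ins_pts Mlow_insert[OF low_ins_lt] by (rule emb_dsum[OF order_emb_shift])

lemma low_ins_dsum: "dsum (pts (Suc n) (ins x 1 \<sigma>)) \<longleftrightarrow> (\<exists>z<n. zc n \<sigma> z \<and> x - 1 \<le> z)"
  unfolding low_ins_pts
proof (rule dsum_insert_e[OF order_emb_shift])
  show "\<forall>q\<in>shift x 1 ` pts n \<sigma>. \<not> q \<lless> (int x, 1)"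
    using low_ins_lt by (auto simp: below_def)
  show "(int x, 1) \<notin> shift x 1 ` pts n \<sigma>" by (rule low_ins_notin)
  fix z assume "zc n \<sigma> z"
  then have zn: "z \<le> n" by (simp add: zc_def)
  have "(int x, 1) \<lless> shift x 1 (pt \<sigma> i) \<longleftrightarrow> x \<le> i" if "i \<in> {z<..n}" for i
    using perm_range[OF p, of i] that unfolding shift_pt by (auto simp: below_def bump_def)
  then have "(\<forall>i\<in>{z<..n}. (int x, 1) \<lless> shift x 1 (pt \<sigma> i)) \<longleftrightarrow> (\<forall>i\<in>{z<..n}. x \<le> i)" by simp
  also have "\<dots> \<longleftrightarrow> x - 1 \<le> z"
  proof
    assume h: "\<forall>i\<in>{z<..n}. x \<le> i"
    show "x - 1 \<le> z" using h[THEN bspec, of "Suc z"] x zn by (cases "z = n") auto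
  qed auto
  finally show "(\<forall>i\<in>{z<..n}. (int x, 1) \<lless> shift x 1 (pt \<sigma> i)) \<longleftrightarrow> x - 1 \<le> z" .
qed

lemma low_ins_ninv: "ninv (pts (Suc n) (ins x 1 \<sigma>)) = ninv (pts n \<sigma>) + (x - 1)"
proof -
  have "inverted (int x, 1) (shift x 1 (pt \<sigma> i)) \<longleftrightarrow> i < x" if "i \<in> {1..n}" for i
    using perm_range[OF p that] unfolding shift_pt by (auto simp: inverted_def bump_def)
  then have "{i \<in> {1..n}. inverted (int x, 1) (shift x 1 (pt \<sigma> i))} = {1..<x}" using x by auto
  then have "cross {(int x, 1)} (shift x 1 ` pts n \<sigma>) = x - 1"
    by (simp add: cross_emb_pts[OF order_emb_shift])
  moreover note low_ins_notin
  ultimately show ?thesis unfolding low_ins_pts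
    by (subst ninv_insert) (simp_all add: emb_ninv[OF order_emb_shift])
qed

lemma low_ins_avoids:
  assumes "avoids (pts n \<sigma>)" "dsum (pts n \<sigma>)" "\<not> dsum (pts (Suc n) (ins x 1 \<sigma>))"
  shows "avoids (pts (Suc n) (ins x 1 \<sigma>))"
  unfolding low_ins_pts
proof (rule avoids_insert_min)
  show "avoids (shift x 1 ` pts n \<sigma>)" using assms emb_avoids[OF order_emb_shift] by blast
  show "dsum (shift x 1 ` pts n \<sigma>)" using assms emb_dsum[OF order_emb_shift] by blast
  show "\<not> dsum (insert (int x, 1) (shift x 1 ` pts n \<sigma>))" using assms(3) unfolding low_ins_pts .
  show "\<forall>q\<in>shift x 1 ` pts n \<sigma>. \<not> q \<lless> (int x, 1)" using low_ins_lt by (auto simp: below_def)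
qed

lemma low_ins_in_Ind:
  assumes "\<sigma> \<in> Dec n" "\<not> dsum (pts (Suc n) (ins x 1 \<sigma>))"
  shows "ins x 1 \<sigma> \<in> Ind (Suc n)"
  using ins_permutes[OF p x, of 1] low_ins_avoids assms by (simp add: Ind_def Av_def Dec_def)

end

lemma ex_low_ins:
  assumes "\<pi> permutes {1..Suc n}"
  obtains x \<sigma> where "1 \<le> x" "x \<le> Suc n" "\<sigma> permutes {1..n}" "\<pi> = ins x 1 \<sigma>" "\<pi> x = 1"
proof -
  obtain x where x: "\<pi> x = 1" using permutes_surj[OF assms] by (metis surj_def)
  then have "x \<in> {1..Suc n}" using permutes_in_image[OF assms, of x] by simp
  then have x': "1 \<le> x" "x \<le> Suc n" by auto
  obtain \<sigma> where "\<sigma> permutes {1..n}" "\<pi> = ins x (\<pi> x) \<sigma>" using ins_surj[OF assms x'] .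
  then show ?thesis using that x x' by metis
qed

lemma Av_ins_sub:
  assumes "ins x v \<sigma> \<in> Av (Suc n)" "\<sigma> permutes {1..n}" "1 \<le> x" "x \<le> Suc n"
  shows "\<sigma> \<in> Av n"
proof -
  have "avoids (shift x v ` pts n \<sigma>)"
  proof (rule avoids_subset)
    show "avoids (pts (Suc n) (ins x v \<sigma>))" using assms(1) by (simp add: Av_def)
  qed (auto simp: pts_ins[OF assms(3,4)])
  then show ?thesis using emb_avoids[OF order_emb_shift] assms(2) by (simp add: Av_def)
qed

lemma low_ins_same:
  assumes "ins x 1 \<sigma> = ins x' 1 \<sigma>'" "\<sigma> permutes {1..n}" "1 \<le> x" "x \<le> Suc n"
  shows "x = x'" "\<sigma> = \<sigma>'"
proof -
  have "inj (ins x 1 \<sigma>)" using ins_permutes[OF assms(2-4), of 1] by (simp add: permutes_inj)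
  moreover have "ins x 1 \<sigma> x = 1" by simp
  moreover have "ins x 1 \<sigma> x' = 1" using assms(1) by simp
  ultimately show "x = x'" by (metis injD)
  then show "\<sigma> = \<sigma>'" using ins_cong assms(1) by blast
qed

text \<open>
  The lowest point at position \<open>d + 1\<close> contributes \<open>d\<close> inversions. The
  result is indecomposable iff \<open>d\<close> exceeds the last proper cut \<open>n - b\<close> of
  the decomposable permutation it is inserted into, which gives the range of \<open>d\<close>.
\<close>

lemma Mlow_sum:
  "(\<Sum>\<pi>\<in>{\<pi> \<in> Ind (Suc n). Mlow (pts (Suc n) \<pi>)}. wt (Suc n) \<pi>)
     = (\<Sum>(a, b)\<in>Pr n. B a * B' b * (\<Sum>d\<in>{n - b<..n}. fps_X ^ d))"
proof -
  let ?S = "SIGMA \<sigma>:Dec n. {x \<in> {1..Suc n}. \<not> dsum (pts (Suc n) (ins x 1 \<sigma>))}"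
  have Dp: "\<sigma> permutes {1..n}" if "\<sigma> \<in> Dec n" for \<sigma> using that by (simp add: Dec_def Av_def)
  have bij: "bij_betw (\<lambda>(\<sigma>, x). ins x 1 \<sigma>) ?S {\<pi> \<in> Ind (Suc n). Mlow (pts (Suc n) \<pi>)}"
  proof (rule bij_betw_imageI)
    show "inj_on (\<lambda>(\<sigma>, x). ins x 1 \<sigma>) ?S"
    proof (rule inj_onI, clarify)
      fix \<sigma> x \<sigma>' x' assume h: "\<sigma> \<in> Dec n" "x \<in> {1..Suc n}" "ins x 1 \<sigma> = ins x' 1 \<sigma>'"
      then show "\<sigma> = \<sigma>' \<and> x = x'" using low_ins_same[OF h(3) Dp[OF h(1)]] by auto
    qed
    show "(\<lambda>(\<sigma>, x). ins x 1 \<sigma>) ` ?S = {\<pi> \<in> Ind (Suc n). Mlow (pts (Suc n) \<pi>)}"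
    proof (intro equalityI subsetI)
      fix \<pi> assume "\<pi> \<in> (\<lambda>(\<sigma>, x). ins x 1 \<sigma>) ` ?S"
      then obtain \<sigma> x where h: "\<sigma> \<in> Dec n" "1 \<le> x" "x \<le> Suc n" "\<not> dsum (pts (Suc n) (ins x 1 \<sigma>))" "\<pi> = ins x 1 \<sigma>"
        by auto
      then show "\<pi> \<in> {\<pi> \<in> Ind (Suc n). Mlow (pts (Suc n) \<pi>)}"
        using low_ins_in_Ind[OF Dp[OF h(1)] h(2,3) h(1,4)] low_ins_Mlow[OF Dp[OF h(1)] h(2,3)]
        by (simp add: Dec_def)
    next
      fix \<pi> assume pi: "\<pi> \<in> {\<pi> \<in> Ind (Suc n). Mlow (pts (Suc n) \<pi>)}"
      then have "\<pi> permutes {1..Suc n}" by (simp add: Ind_def Av_def)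
      then obtain x \<sigma> where x: "1 \<le> x" "x \<le> Suc n" "\<sigma> permutes {1..n}" "\<pi> = ins x 1 \<sigma>" "\<pi> x = 1"
        by (rule ex_low_ins)
      have "\<sigma> \<in> Av n" by (rule Av_ins_sub[OF _ x(3,1,2), of 1]) (use pi x in \<open>simp add: Ind_def\<close>)
      then have "\<sigma> \<in> Dec n" using low_ins_Mlow[OF x(3,1,2)] pi x(4) by (simp add: Dec_def)
      then show "\<pi> \<in> (\<lambda>(\<sigma>, x). ins x 1 \<sigma>) ` ?S"
        using x pi by (intro image_eqI[of _ _ "(\<sigma>, x)"]) (auto simp: Ind_def)
    qed
  qed
  have "(\<Sum>\<pi>\<in>{\<pi> \<in> Ind (Suc n). Mlow (pts (Suc n) \<pi>)}. wt (Suc n) \<pi>) = (\<Sum>(\<sigma>, x)\<in>?S. wt (Suc n) (ins x 1 \<sigma>))"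
    using sum.reindex_bij_betw[OF bij, of "wt (Suc n)"] by (simp add: case_prod_unfold)
  also have "\<dots> = (\<Sum>\<sigma>\<in>Dec n. \<Sum>x\<in>{x \<in> {1..Suc n}. \<not> dsum (pts (Suc n) (ins x 1 \<sigma>))}. wt (Suc n) (ins x 1 \<sigma>))"
    by (subst sum.Sigma) auto
  also have "\<dots> = (\<Sum>(a, b)\<in>Pr n. B a * B' b * (\<Sum>d\<in>{n - b<..n}. fps_X ^ d))"
  proof (rule Dec_sum)
    fix \<sigma> a b assume s: "\<sigma> \<in> Dec n" and ab: "1 \<le> a" "1 \<le> b" "a + b \<le> n"
      and z: "\<And>z. zc n \<sigma> z \<longleftrightarrow> z = 0 \<or> z = n \<or> a \<le> z \<and> z \<le> n - b"
    have "dsum (pts (Suc n) (ins x 1 \<sigma>)) \<longleftrightarrow> x - 1 \<le> n - b" if "x \<in> {1..Suc n}" for x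
    proof -
      have "dsum (pts (Suc n) (ins x 1 \<sigma>)) \<longleftrightarrow> (\<exists>z<n. zc n \<sigma> z \<and> x - 1 \<le> z)"
        by (rule low_ins_dsum[OF Dp[OF s]]) (use that in auto)
      also have "\<dots> \<longleftrightarrow> x - 1 \<le> n - b"
      proof
        assume "x - 1 \<le> n - b"
        then show "\<exists>z<n. zc n \<sigma> z \<and> x - 1 \<le> z" using ab by (intro exI[of _ "n - b"]) (auto simp: z)
      qed (auto simp: z)
      finally show ?thesis .
    qed
    then have "{x \<in> {1..Suc n}. \<not> dsum (pts (Suc n) (ins x 1 \<sigma>))} = {x \<in> {1..Suc n}. n - b < x - 1}"
      by (intro Collect_cong) (simp only: not_le cong: conj_cong)
    also have "\<dots> = Suc ` {n - b<..n}"
    proof (intro equalityI subsetI)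
      fix x assume "x \<in> {x \<in> {1..Suc n}. n - b < x - 1}"
      then show "x \<in> Suc ` {n - b<..n}" by (intro image_eqI[of _ _ "x - 1"]) auto
    qed auto
    finally have "{x \<in> {1..Suc n}. \<not> dsum (pts (Suc n) (ins x 1 \<sigma>))} = Suc ` {n - b<..n}" .
    then have "(\<Sum>x\<in>{x \<in> {1..Suc n}. \<not> dsum (pts (Suc n) (ins x 1 \<sigma>))}. wt (Suc n) (ins x 1 \<sigma>))
        = (\<Sum>d\<in>{n - b<..n}. wt (Suc n) (ins (Suc d) 1 \<sigma>))" by (simp add: sum.reindex)
    also have "\<dots> = (\<Sum>d\<in>{n - b<..n}. wt n \<sigma> * fps_X ^ d)"
    proof (rule sum.cong[OF refl])
      fix d assume "d \<in> {n - b<..n}"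
      then show "wt (Suc n) (ins (Suc d) 1 \<sigma>) = wt n \<sigma> * fps_X ^ d"
        using low_ins_ninv[OF Dp[OF s], of "Suc d"] by (simp add: wt_def power_add)
    qed
    finally show "(\<Sum>x\<in>{x \<in> {1..Suc n}. \<not> dsum (pts (Suc n) (ins x 1 \<sigma>))}. wt (Suc n) (ins x 1 \<sigma>))
        = wt n \<sigma> * (\<Sum>d\<in>{n - b<..n}. fps_X ^ d)" by (simp add: sum_distrib_left)
  qed
  finally show ?thesis .
qed

lemma Dec_gf: "(\<Sum>\<sigma>\<in>Dec n. wt n \<sigma>) = (\<Sum>(a, b)\<in>Pr n. B a * B' b)"
  using Dec_sum[of n "wt n" "\<lambda>a b. 1"] by simp

section \<open>Inserting a lowest and a maximal point\<close>

lemma bump_simps: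
  "i < g \<Longrightarrow> bump g i = i" "g \<le> i \<Longrightarrow> bump g i = Suc i" "x < bump x y \<longleftrightarrow> x \<le> y" "bump x y < x \<longleftrightarrow> y < x"
  by (auto simp: bump_def)

text \<open>
  Into \<open>\<tau>\<close> a value \<open>v\<close> is inserted at position \<open>y\<close>,
  giving a point \<open>w\<close> with nothing above and to the right of it, and then a lowest point
  \<open>e\<close> at position \<open>x\<close>. The parameters \<open>c\<close> and
  \<open>d\<close> describe how the two points interact with the cuts of \<open>\<tau>\<close>: the
  upper block of a cut \<open>z\<close> is above \<open>e\<close> iff \<open>d \<le> z\<close>, and
  the lower block is below \<open>w\<close> iff \<open>z \<le> c\<close>. This treats a rightmost
  and a highest \<open>w\<close> alike.
\<close>

locale low_max =
  fixes m x y v c d :: nat and \<tau> :: "nat \<Rightarrow> nat"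
  assumes p: "\<tau> permutes {1..m}" and x: "1 \<le> x" "x \<le> Suc (Suc m)" and y: "1 \<le> y" "y \<le> Suc m"
    and v: "1 \<le> v" "v \<le> Suc m"
    and w_max: "\<And>i. i \<in> {1..m} \<Longrightarrow> y < bump y i \<Longrightarrow> v < bump v (\<tau> i) \<Longrightarrow> False"
    and He: "\<And>z. z \<le> m \<Longrightarrow> (\<forall>i\<in>{z<..m}. x \<le> bump y i) \<longleftrightarrow> d \<le> z"
    and Hw: "\<And>z. zc m \<tau> z \<Longrightarrow> (\<forall>i\<in>{1..z}. bump y i < y \<and> bump v (\<tau> i) < v) \<longleftrightarrow> z \<le> c"
begin

definition f :: "point \<Rightarrow> point" where "f p = shift x 1 (shift y v p)"
definition e :: point where "e = (int x, 1)"
definition w :: point where "w = (int (bump x y), int (bump 1 v))"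
definition T :: "point set" where "T = f ` pts m \<tau>"

lemma ew_emb: "order_emb f"
proof -
  have "f = (\<lambda>p. shift x 1 (shift y v p))" by (simp add: fun_eq_iff f_def)
  then show ?thesis using order_emb_comp[OF order_emb_shift order_emb_shift] by simp
qed

lemma ew_pt: "f (pt \<tau> i) = (int (bump x (bump y i)), int (bump 1 (bump v (\<tau> i))))"
  unfolding f_def by (simp add: shift_pt) (simp add: shift_def bump_def)

lemma ew_pts: "pts (Suc (Suc m)) (ins x 1 (ins y v \<tau>)) = insert e (insert w T)"
proof -
  have "pts (Suc m) (ins y v \<tau>) = insert (int y, int v) (shift y v ` pts m \<tau>)"
    by (rule pts_ins[OF y])
  moreover have "shift x 1 (int y, int v) = w" by (simp add: w_def shift_def bump_def)
  ultimately show ?thesis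
    unfolding pts_ins[OF x] by (simp add: T_def f_def e_def image_image)
qed

lemma ew_low: "q \<in> insert w T \<Longrightarrow> snd e < snd q"
proof -
  assume "q \<in> insert w T"
  then consider "q = w" | i where "i \<in> {1..m}" "q = f (pt \<tau> i)" by (auto simp: T_def pts_def)
  then show ?thesis
  proof cases
    case 1
    then show ?thesis using v by (simp add: e_def w_def bump_def)
  next
    case (2 i)
    then show ?thesis using perm_range[OF p, of i] v unfolding 2(2) ew_pt e_def by (simp add: bump_def)
  qed
qed

lemma ew_min: "\<forall>q\<in>insert w T. \<not> q \<lless> e" "e \<notin> insert w T"
proof -
  have "snd e < snd q" if "q \<in> insert w T" for q using ew_low that .
  then show "\<forall>q\<in>insert w T. \<not> q \<lless> e" "e \<notin> insert w T"
    unfolding below_def by (meson less_asym less_irrefl)+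
qed

lemma ew_max: "\<forall>q\<in>insert e T. \<not> w \<lless> q"
proof
  fix q assume "q \<in> insert e T"
  then show "\<not> w \<lless> q"
  proof
    assume "q = e"
    then show ?thesis using ew_low[of w] by (auto simp: below_def)
  next
    assume "q \<in> T"
    then obtain i where i: "i \<in> {1..m}" "q = f (pt \<tau> i)" by (auto simp: T_def pts_def)
    show ?thesis using w_max[OF i(1)] unfolding i(2) w_def ew_pt below_def by auto
  qed
qed

lemma ew_w_notin: "w \<notin> T"
  unfolding T_def pts_def w_def by (auto simp: ew_pt)

lemma ew_He: "zc m \<tau> z \<Longrightarrow> (\<forall>i\<in>{z<..m}. e \<lless> f (pt \<tau> i)) \<longleftrightarrow> d \<le> z"
proof -
  assume "zc m \<tau> z"
  then have "z \<le> m" by (simp add: zc_def)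
  moreover have "e \<lless> f (pt \<tau> i) \<longleftrightarrow> x \<le> bump y i" if "i \<in> {z<..m}" for i
  proof -
    have "f (pt \<tau> i) \<in> insert w T" using that by (auto simp: T_def pts_def)
    then have "e \<lless> f (pt \<tau> i) \<longleftrightarrow> fst e < fst (f (pt \<tau> i))" using ew_low by (simp add: below_def)
    then show ?thesis by (simp add: e_def ew_pt bump_simps(3))
  qed
  ultimately show ?thesis using He[of z] by auto
qed

lemma ew_Hw: "zc m \<tau> z \<Longrightarrow> (\<forall>i\<in>{1..z}. f (pt \<tau> i) \<lless> w) \<longleftrightarrow> z \<le> c"
  using Hw[of z] unfolding ew_pt w_def below_def by simp

lemma ew_dsum_e: "dsum (insert e T) \<longleftrightarrow> (\<exists>z<m. zc m \<tau> z \<and> d \<le> z)"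
  unfolding T_def by (rule dsum_insert_e[OF ew_emb _ ew_He]) (use ew_min in \<open>auto simp: T_def\<close>)

lemma ew_dsum_w: "dsum (insert w T) \<longleftrightarrow> (\<exists>z>0. zc m \<tau> z \<and> z \<le> c)"
  unfolding T_def by (rule dsum_insert_w[OF ew_emb _ ew_Hw]) (use ew_max ew_w_notin in \<open>auto simp: T_def\<close>)

lemma ew_dsum_ew: "dsum (insert e (insert w T)) \<longleftrightarrow> e \<lless> w \<and> (\<exists>z. zc m \<tau> z \<and> d \<le> z \<and> z \<le> c)"
  unfolding T_def by (rule dsum_insert_ew[OF ew_emb _ _ ew_He ew_Hw])
    (use ew_min ew_max ew_w_notin in \<open>auto simp: T_def\<close>)

lemma ew_Mlow: "Mlow (insert e (insert w T)) \<longleftrightarrow> dsum (insert w T)"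
  using ew_low by (intro Mlow_insert) auto

lemma ew_permutes: "ins x 1 (ins y v \<tau>) permutes {1..Suc (Suc m)}"
  using ins_permutes[OF ins_permutes[OF p y v] x, of 1] by simp

lemma ew_avoids:
  assumes "avoids (pts m \<tau>)" "dsum (insert e T)" "dsum (insert w T)" "\<not> dsum (insert e (insert w T))"
  shows "avoids (insert e (insert w T))"
  by (rule avoids_insert_min_max)
    (use assms ew_min ew_max ew_w_notin emb_avoids[OF ew_emb] in \<open>auto simp: T_def\<close>)

lemma ew_core:
  assumes "dsum (insert e T)" "dsum (insert w T)" "\<not> dsum (insert e (insert w T))"
  shows "dsum (pts m \<tau>)"
proof -
  have "dsum T" by (rule dsum_core[OF assms]) (use ew_min ew_max ew_w_notin in auto)
  then show ?thesis using emb_dsum[OF ew_emb] by (simp add: T_def)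
qed

lemma ew_ninv:
  "ninv (insert e (insert w T)) = ninv (pts m \<tau>) + card {i \<in> {1..m}. inverted w (f (pt \<tau> i))}
     + (if inverted e w then 1 else 0) + card {i \<in> {1..m}. bump y i < x}"
proof -
  have "ninv T = ninv (pts m \<tau>)" unfolding T_def by (rule emb_ninv[OF ew_emb]) simp
  moreover have "finite T" by (simp add: T_def)
  moreover have "cross {w} T = card {i \<in> {1..m}. inverted w (f (pt \<tau> i))}"
    unfolding T_def by (rule cross_emb_pts[OF ew_emb])
  moreover have "cross {e} T = card {i \<in> {1..m}. inverted e (f (pt \<tau> i))}"
    unfolding T_def by (rule cross_emb_pts[OF ew_emb])
  moreover have "inverted e (f (pt \<tau> i)) \<longleftrightarrow> bump y i < x" if "i \<in> {1..m}" for i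
  proof -
    have "f (pt \<tau> i) \<in> insert w T" using that by (auto simp: T_def pts_def)
    then have "snd e < snd (f (pt \<tau> i))" by (rule ew_low)
    then have "inverted e (f (pt \<tau> i)) \<longleftrightarrow> fst (f (pt \<tau> i)) < fst e" by (auto simp: inverted_def)
    then show ?thesis by (simp add: e_def ew_pt bump_simps(4))
  qed
  then have "{i \<in> {1..m}. inverted e (f (pt \<tau> i))} = {i \<in> {1..m}. bump y i < x}" by auto
  moreover have "cross {e} {w} = (if inverted e w then 1 else 0)"
    using cross_full[of "{e}" "{w}"] cross_none[of "{e}" "{w}"] by (cases "inverted e w") simp_all
  moreover have "cross {e} (insert w T) = cross {e} {w} + cross {e} T"
    using cross_Un2[of "{e}" "{w}" T] \<open>finite T\<close> ew_w_notin by simp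
  ultimately show ?thesis
    using ew_min(2) ew_w_notin by (simp add: ninv_insert)
qed

end

lemma perm_count_ge:
  assumes p: "\<tau> permutes {1..m}" and "1 \<le> v"
  shows "card {i \<in> {1..m}. v \<le> \<tau> i} = m - (v - 1)"
proof -
  have "\<tau> ` {i \<in> {1..m}. v \<le> \<tau> i} = {v..m}"
  proof (intro equalityI subsetI)
    fix u assume u: "u \<in> {v..m}"
    then have "u \<in> \<tau> ` {1..m}" using permutes_image[OF p] assms(2) by auto
    then show "u \<in> \<tau> ` {i \<in> {1..m}. v \<le> \<tau> i}" using u by auto
  next
    fix u assume "u \<in> \<tau> ` {i \<in> {1..m}. v \<le> \<tau> i}"
    then show "u \<in> {v..m}" using perm_range[OF p] by auto
  qed
  moreover have "inj_on \<tau> {i \<in> {1..m}. v \<le> \<tau> i}" using permutes_inj[OF p] inj_on_subset by blast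
  ultimately have "card {i \<in> {1..m}. v \<le> \<tau> i} = card {v..m}" using card_image by metis
  then show ?thesis using assms(2) by simp
qed

text \<open>
  The insertion data are determined by the result, once the position of \<open>w\<close> is known.
\<close>

lemma ew_same:
  assumes eq: "ins x 1 (ins y v \<tau>) = ins x' 1 (ins y v' \<tau>')" and p: "\<tau> permutes {1..m}"
    and x: "1 \<le> x" "x \<le> Suc (Suc m)" and y: "1 \<le> y" "y \<le> Suc m" and v: "1 \<le> v" "v \<le> Suc m"
  shows "x = x'" "v = v'" "\<tau> = \<tau>'"
proof -
  have "ins y v \<tau> permutes {1..Suc m}" by (rule ins_permutes[OF p y v])
  from low_ins_same[OF eq this x] have *: "x = x'" "ins y v \<tau> = ins y v' \<tau>'" by auto
  show "x = x'" by fact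
  show "v = v'" using fun_cong[OF *(2), of y] by simp
  then show "\<tau> = \<tau>'" using *(2) ins_cong by blast
qed

lemma low_right:
  assumes p: "\<tau> permutes {1..m}" and x: "1 \<le> x" "x \<le> Suc m" and v: "1 \<le> v" "v \<le> Suc m"
  shows "low_max m x (Suc m) v (v - 1) (x - 1) \<tau>"
proof
  show "\<tau> permutes {1..m}" "1 \<le> x" "x \<le> Suc (Suc m)" "1 \<le> Suc m" "Suc m \<le> Suc m" "1 \<le> v" "v \<le> Suc m"
    using assms by auto
  show "\<And>i. i \<in> {1..m} \<Longrightarrow> Suc m < bump (Suc m) i \<Longrightarrow> v < bump v (\<tau> i) \<Longrightarrow> False" by (simp add: bump_simps)
  show "(\<forall>i\<in>{z<..m}. x \<le> bump (Suc m) i) \<longleftrightarrow> x - 1 \<le> z" if "z \<le> m" for z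
  proof
    assume h: "\<forall>i\<in>{z<..m}. x \<le> bump (Suc m) i"
    show "x - 1 \<le> z" using h[THEN bspec, of "Suc z"] x that by (cases "z = m") (auto simp: bump_simps)
  qed (auto simp: bump_simps)
  show "(\<forall>i\<in>{1..z}. bump (Suc m) i < Suc m \<and> bump v (\<tau> i) < v) \<longleftrightarrow> z \<le> v - 1" if z: "zc m \<tau> z" for z
  proof -
    have zm: "z \<le> m" using z by (simp add: zc_def)
    have "(\<forall>i\<in>{1..z}. bump (Suc m) i < Suc m \<and> bump v (\<tau> i) < v) \<longleftrightarrow> (\<forall>i\<in>{1..z}. \<tau> i < v)"
      using zm by (auto simp: bump_simps)
    also have "\<dots> \<longleftrightarrow> (\<forall>u\<in>\<tau> ` {1..z}. u < v)" by simp
    also have "\<dots> \<longleftrightarrow> (\<forall>u\<in>{1..z}. u < v)" unfolding zc_image[OF p z] ..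
    also have "\<dots> \<longleftrightarrow> z \<le> v - 1" using v by (cases "z = 0") auto
    finally show ?thesis .
  qed
qed

text \<open>
  The threshold for \<open>e\<close> depends on which of the two points comes first, because
  \<open>x\<close> counts \<open>w\<close> if \<open>w\<close> is to the left.
\<close>

lemma low_high:
  assumes p: "\<tau> permutes {1..m}" and x: "1 \<le> x" "x \<le> Suc (Suc m)" and g: "1 \<le> g" "g \<le> Suc m"
  shows "low_max m x g (Suc m) (g - 1) (if x \<le> g then x - 1 else x - 2) \<tau>"
proof
  show "\<tau> permutes {1..m}" "1 \<le> x" "x \<le> Suc (Suc m)" "1 \<le> Suc m" "Suc m \<le> Suc m" "1 \<le> g" "g \<le> Suc m"
    using assms by auto
  have t: "bump (Suc m) (\<tau> i) = \<tau> i \<and> \<tau> i < Suc m" if "i \<in> {1..m}" for i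
    using perm_range[OF p that] by (simp add: bump_simps)
  show "\<And>i. i \<in> {1..m} \<Longrightarrow> g < bump g i \<Longrightarrow> Suc m < bump (Suc m) (\<tau> i) \<Longrightarrow> False" using t by force
  show "(\<forall>i\<in>{z<..m}. x \<le> bump g i) \<longleftrightarrow> (if x \<le> g then x - 1 else x - 2) \<le> z" if "z \<le> m" for z
  proof
    assume h: "\<forall>i\<in>{z<..m}. x \<le> bump g i"
    show "(if x \<le> g then x - 1 else x - 2) \<le> z"
      using h[THEN bspec, of "Suc z"] x g that by (cases "z = m") (auto simp: bump_def split: if_splits)
  qed (auto simp: bump_def split: if_splits)
  show "(\<forall>i\<in>{1..z}. bump g i < g \<and> bump (Suc m) (\<tau> i) < Suc m) \<longleftrightarrow> z \<le> g - 1" if z: "zc m \<tau> z" for z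
  proof -
    have zm: "z \<le> m" using z by (simp add: zc_def)
    then have "(\<forall>i\<in>{1..z}. bump g i < g \<and> bump (Suc m) (\<tau> i) < Suc m) \<longleftrightarrow> (\<forall>i\<in>{1..z}. i < g)"
      using t by (auto simp: bump_simps)
    also have "\<dots> \<longleftrightarrow> z \<le> g - 1" using g by (cases "z = 0") auto
    finally show ?thesis .
  qed
qed

section \<open>Two extreme points are removable\<close>

context low_max
begin

lemma ew_good:
  assumes "\<tau> \<in> Av m" "dsum (insert e T)" "dsum (insert w T)" "\<not> dsum (insert e (insert w T))"
  shows "ins x 1 (ins y v \<tau>) \<in> Ind (Suc (Suc m))"
  using assms ew_permutes ew_avoids ew_pts by (simp add: Ind_def Av_def)

text \<open>
  The lowest point and \<open>w\<close> are both removable, and the result is indecomposable, iff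
  \<open>c\<close> is at or after the first cut \<open>a\<close>, \<open>d\<close> at or before the
  last cut \<open>m - b\<close>, and \<open>c < d\<close>, so that no cut serves both, unless
  \<open>e\<close> and \<open>w\<close> are inverted, in which case they prevent every
  decomposition.
\<close>

lemma ew_cond:
  assumes ab: "1 \<le> a" "1 \<le> b" "a + b \<le> m"
    and z: "\<And>z. zc m \<tau> z \<longleftrightarrow> z = 0 \<or> z = m \<or> a \<le> z \<and> z \<le> m - b"
  shows "dsum (insert e T) \<and> dsum (insert w T) \<and> \<not> dsum (insert e (insert w T))
     \<longleftrightarrow> d \<le> m - b \<and> a \<le> c \<and> (e \<lless> w \<longrightarrow> c < d)"
proof -
  have "dsum (insert e T) \<longleftrightarrow> d \<le> m - b" unfolding ew_dsum_e
  proof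
    assume "d \<le> m - b"
    then show "\<exists>z<m. zc m \<tau> z \<and> d \<le> z" using ab by (intro exI[of _ "m - b"]) (auto simp: z)
  qed (auto simp: z)
  moreover have "dsum (insert w T) \<longleftrightarrow> a \<le> c" unfolding ew_dsum_w
  proof
    assume "a \<le> c"
    then show "\<exists>z>0. zc m \<tau> z \<and> z \<le> c" using ab by (intro exI[of _ a]) (auto simp: z)
  qed (use ab in \<open>auto simp: z\<close>)
  moreover have "(\<exists>z. zc m \<tau> z \<and> d \<le> z \<and> z \<le> c) \<longleftrightarrow> d \<le> c" if "d \<le> m - b" "a \<le> c"
  proof
    assume "d \<le> c"
    then show "\<exists>z. zc m \<tau> z \<and> d \<le> z \<and> z \<le> c" using ab that by (intro exI[of _ "max a d"]) (auto simp: z)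
  qed auto
  ultimately show ?thesis unfolding ew_dsum_ew by auto
qed

end

lemma right_case:
  assumes p: "\<tau> permutes {1..m}" and x: "1 \<le> x" "x \<le> Suc m" and v: "1 \<le> v" "v \<le> Suc m"
  defines "\<pi> \<equiv> ins x 1 (ins (Suc m) v \<tau>)"
  defines "e \<equiv> low_max.e x" and "w \<equiv> low_max.w x (Suc m) v" and "T \<equiv> low_max.T m x (Suc m) v \<tau>"
  shows "pts (Suc (Suc m)) \<pi> = insert e (insert w T)" "e \<lless> w"
    "Mlow (pts (Suc (Suc m)) \<pi>) \<longleftrightarrow> dsum (insert w T)"
    "Mright (pts (Suc (Suc m)) \<pi>) \<longleftrightarrow> dsum (insert e T)"
    "ninv (pts (Suc (Suc m)) \<pi>) = ninv (pts m \<tau>) + (m - (v - 1)) + (x - 1)"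
proof -
  interpret L: low_max m x "Suc m" v "v - 1" "x - 1" \<tau> by (rule low_right[OF p x v])
  have lt: "fst q < fst L.w" if "q \<in> insert L.e L.T" for q
  proof -
    have "fst L.w = int m + 2" using x by (simp add: L.w_def bump_def)
    moreover have "fst L.e < int m + 2" using x by (simp add: L.e_def)
    moreover have "fst q < int m + 2" if "q \<in> L.T"
      using that by (auto simp: L.T_def pts_def L.ew_pt bump_def)
    ultimately show ?thesis using that by auto
  qed
  show pts: "pts (Suc (Suc m)) \<pi> = insert e (insert w T)" unfolding \<pi>_def e_def w_def T_def by (rule L.ew_pts)
  have ew: "L.e \<lless> L.w" using lt[of L.e] L.ew_low[of L.w] by (simp add: below_def)
  then show "e \<lless> w" by (simp add: e_def w_def)
  show "Mlow (pts (Suc (Suc m)) \<pi>) \<longleftrightarrow> dsum (insert w T)"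
    unfolding pts unfolding e_def w_def T_def by (rule L.ew_Mlow)
  have "Mright (insert L.w (insert L.e L.T)) \<longleftrightarrow> dsum (insert L.e L.T)"
    using lt by (intro Mright_insert) blast
  then show "Mright (pts (Suc (Suc m)) \<pi>) \<longleftrightarrow> dsum (insert e T)"
    unfolding pts unfolding e_def w_def T_def by (simp only: insert_commute)
  have "inverted L.w (L.f (pt \<tau> i)) \<longleftrightarrow> v \<le> \<tau> i" if "i \<in> {1..m}" for i
  proof -
    have "fst (L.f (pt \<tau> i)) < fst L.w" by (rule lt) (use that in \<open>auto simp: L.T_def pts_def\<close>)
    then have "inverted L.w (L.f (pt \<tau> i)) \<longleftrightarrow> snd L.w < snd (L.f (pt \<tau> i))" by (auto simp: inverted_def)
    then show ?thesis by (simp add: L.w_def L.ew_pt bump_simps)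
  qed
  then have "{i \<in> {1..m}. inverted L.w (L.f (pt \<tau> i))} = {i \<in> {1..m}. v \<le> \<tau> i}" by auto
  then have "card {i \<in> {1..m}. inverted L.w (L.f (pt \<tau> i))} = m - (v - 1)"
    using perm_count_ge[OF p v(1)] by simp
  moreover have "{i \<in> {1..m}. bump (Suc m) i < x} = {1..<x}" using x by (auto simp: bump_def)
  then have "card {i \<in> {1..m}. bump (Suc m) i < x} = x - 1" by simp
  moreover have "\<not> inverted L.e L.w" using ew by (rule below_not_inverted)
  ultimately have "ninv (insert L.e (insert L.w L.T)) = ninv (pts m \<tau>) + (m - (v - 1)) + (x - 1)"
    using L.ew_ninv by simp
  then show "ninv (pts (Suc (Suc m)) \<pi>) = ninv (pts m \<tau>) + (m - (v - 1)) + (x - 1)"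
    unfolding pts unfolding e_def w_def T_def .
qed

lemma high_case:
  assumes p: "\<tau> permutes {1..m}" and x: "1 \<le> x" "x \<le> Suc (Suc m)" and g: "1 \<le> g" "g \<le> Suc m"
  defines "\<pi> \<equiv> ins x 1 (ins g (Suc m) \<tau>)"
  defines "e \<equiv> low_max.e x" and "w \<equiv> low_max.w x g (Suc m)" and "T \<equiv> low_max.T m x g (Suc m) \<tau>"
  shows "pts (Suc (Suc m)) \<pi> = insert e (insert w T)" "e \<lless> w \<longleftrightarrow> x \<le> g"
    "Mlow (pts (Suc (Suc m)) \<pi>) \<longleftrightarrow> dsum (insert w T)"
    "Mhigh (pts (Suc (Suc m)) \<pi>) \<longleftrightarrow> dsum (insert e T)"
    "g < x \<Longrightarrow> x \<le> m + 2 \<Longrightarrow> ninv (pts (Suc (Suc m)) \<pi>) = ninv (pts m \<tau>) + (m - (g - 1)) + 1 + (x - 2)"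
proof -
  interpret L: low_max m x g "Suc m" "g - 1" "if x \<le> g then x - 1 else x - 2" \<tau> by (rule low_high[OF p x g])
  have lt: "snd q < snd L.w" if "q \<in> insert L.e L.T" for q
  proof -
    have "snd L.w = int m + 2" by (simp add: L.w_def bump_def)
    moreover have "snd L.e < int m + 2" by (simp add: L.e_def)
    moreover have "snd q < int m + 2" if qT: "q \<in> L.T"
    proof -
      obtain i where "i \<in> {1..m}" "q = L.f (pt \<tau> i)" using qT by (auto simp: L.T_def pts_def)
      then show ?thesis using perm_range[OF p, of i] by (simp add: L.ew_pt bump_def)
    qed
    ultimately show ?thesis using that by auto
  qed
  show pts: "pts (Suc (Suc m)) \<pi> = insert e (insert w T)" unfolding \<pi>_def e_def w_def T_def by (rule L.ew_pts)
  show "e \<lless> w \<longleftrightarrow> x \<le> g"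
    using lt[of L.e] by (simp add: below_def e_def w_def) (simp add: L.e_def L.w_def bump_simps)
  show "Mlow (pts (Suc (Suc m)) \<pi>) \<longleftrightarrow> dsum (insert w T)"
    unfolding pts unfolding e_def w_def T_def by (rule L.ew_Mlow)
  have "Mhigh (insert L.w (insert L.e L.T)) \<longleftrightarrow> dsum (insert L.e L.T)"
    using lt by (intro Mhigh_insert) blast
  then show "Mhigh (pts (Suc (Suc m)) \<pi>) \<longleftrightarrow> dsum (insert e T)"
    unfolding pts unfolding e_def w_def T_def by (simp only: insert_commute)
  assume gx: "g < x" "x \<le> m + 2"
  have "inverted L.w (L.f (pt \<tau> i)) \<longleftrightarrow> g \<le> i" if "i \<in> {1..m}" for i
  proof -
    have "snd (L.f (pt \<tau> i)) < snd L.w" by (rule lt) (use that in \<open>auto simp: L.T_def pts_def\<close>)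
    then have "inverted L.w (L.f (pt \<tau> i)) \<longleftrightarrow> fst L.w < fst (L.f (pt \<tau> i))" by (auto simp: inverted_def)
    then show ?thesis by (simp add: L.w_def L.ew_pt bump_simps)
  qed
  then have "{i \<in> {1..m}. inverted L.w (L.f (pt \<tau> i))} = {g..m}" using g by auto
  then have "card {i \<in> {1..m}. inverted L.w (L.f (pt \<tau> i))} = m - (g - 1)" using g by simp
  moreover have "{i \<in> {1..m}. bump g i < x} = {1..x - 2}" using gx g by (auto simp: bump_def split: if_splits)
  then have "card {i \<in> {1..m}. bump g i < x} = x - 2" by simp
  moreover have "inverted L.e L.w"
    using lt[of L.e] gx by (simp add: inverted_def) (simp add: L.e_def L.w_def bump_simps)
  ultimately have "ninv (insert L.e (insert L.w L.T)) = ninv (pts m \<tau>) + (m - (g - 1)) + 1 + (x - 2)"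
    using L.ew_ninv by simp
  then show "ninv (pts (Suc (Suc m)) \<pi>) = ninv (pts m \<tau>) + (m - (g - 1)) + 1 + (x - 2)"
    unfolding pts unfolding e_def w_def T_def .
qed

lemma Dec_permutes: "\<sigma> \<in> Dec n \<Longrightarrow> \<sigma> permutes {1..n}" "\<sigma> \<in> Dec n \<Longrightarrow> \<sigma> \<in> Av n"
  by (auto simp: Dec_def Av_def)

text \<open>
  One point may be lowest and rightmost at the same time. It is inverted with all others, so the
  result is always indecomposable.
\<close>

lemma Mlow_Mright_same_sum:
  "(\<Sum>\<pi>\<in>{\<pi> \<in> Ind (Suc n). Mlow (pts (Suc n) \<pi>) \<and> Mright (pts (Suc n) \<pi>) \<and> \<pi> (Suc n) = 1}. wt (Suc n) \<pi>)
     = (\<Sum>(a, b)\<in>Pr n. B a * B' b * fps_X ^ n)"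
proof -
  let ?M = "{\<pi> \<in> Ind (Suc n). Mlow (pts (Suc n) \<pi>) \<and> Mright (pts (Suc n) \<pi>) \<and> \<pi> (Suc n) = 1}"
  have r: "1 \<le> Suc n" "Suc n \<le> Suc n" by auto
  have Mright: "Mright (pts (Suc n) (ins (Suc n) 1 \<sigma>)) \<longleftrightarrow> dsum (pts n \<sigma>)" if "\<sigma> permutes {1..n}" for \<sigma>
  proof -
    have "\<forall>q\<in>shift (Suc n) 1 ` pts n \<sigma>. fst q < fst (int (Suc n), 1 :: int)"
    proof
      fix q assume "q \<in> shift (Suc n) 1 ` pts n \<sigma>"
      then obtain i where "i \<in> {1..n}" "q = shift (Suc n) 1 (pt \<sigma> i)" by (auto simp: pts_def)
      then show "fst q < fst (int (Suc n), 1 :: int)" by (simp add: shift_pt bump_def)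
    qed
    from Mright_insert[OF this] show ?thesis
      using emb_dsum[OF order_emb_shift] by (simp only: low_ins_pts[OF that r])
  qed
  have nd: "\<not> dsum (pts (Suc n) (ins (Suc n) 1 \<sigma>))" if "\<sigma> permutes {1..n}" for \<sigma>
    unfolding low_ins_dsum[OF that r] by auto
  have "bij_betw (ins (Suc n) 1) (Dec n) ?M"
  proof (rule bij_betw_imageI)
    show "inj_on (ins (Suc n) 1) (Dec n)" using ins_cong by (auto intro: inj_onI)
    show "ins (Suc n) 1 ` Dec n = ?M"
    proof (intro equalityI subsetI)
      fix \<pi> assume "\<pi> \<in> ins (Suc n) 1 ` Dec n"
      then obtain \<sigma> where s: "\<sigma> \<in> Dec n" "\<pi> = ins (Suc n) 1 \<sigma>" by auto
      note p = Dec_permutes(1)[OF s(1)]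
      have "dsum (pts n \<sigma>)" using s by (simp add: Dec_def)
      then show "\<pi> \<in> ?M"
        using low_ins_in_Ind[OF p r s(1) nd[OF p]] low_ins_Mlow[OF p r] Mright[OF p] s(2) by simp
    next
      fix \<pi> assume pi: "\<pi> \<in> ?M"
      then have p: "\<pi> permutes {1..Suc n}" by (simp add: Ind_def Av_def)
      obtain \<sigma> where s: "\<sigma> permutes {1..n}" "\<pi> = ins (Suc n) (\<pi> (Suc n)) \<sigma>" using ins_surj[OF p r] .
      have s2: "\<pi> = ins (Suc n) 1 \<sigma>" using s(2) pi by simp
      have "\<sigma> \<in> Av n" by (rule Av_ins_sub[OF _ s(1) r, of 1]) (use pi s2 in \<open>simp add: Ind_def\<close>)
      then have "\<sigma> \<in> Dec n" using low_ins_Mlow[OF s(1) r] pi s2 by (simp add: Dec_def)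
      then show "\<pi> \<in> ins (Suc n) 1 ` Dec n" using s2 by blast
    qed
  qed
  then have "(\<Sum>\<pi>\<in>?M. wt (Suc n) \<pi>) = (\<Sum>\<sigma>\<in>Dec n. wt (Suc n) (ins (Suc n) 1 \<sigma>))"
    by (rule sum.reindex_bij_betw[symmetric])
  also have "\<dots> = (\<Sum>\<sigma>\<in>Dec n. wt n \<sigma> * fps_X ^ n)"
  proof (rule sum.cong[OF refl])
    fix \<sigma> assume "\<sigma> \<in> Dec n"
    from low_ins_ninv[OF Dec_permutes(1)[OF this] r]
    show "wt (Suc n) (ins (Suc n) 1 \<sigma>) = wt n \<sigma> * fps_X ^ n" by (simp add: wt_def power_add)
  qed
  also have "\<dots> = (\<Sum>(a, b)\<in>Pr n. B a * B' b * fps_X ^ n)" by (rule Dec_sum) simp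
  finally show ?thesis .
qed

text \<open>
  Here \<open>c + 1\<close> is the value inserted as last entry, \<open>d + 1\<close> the position
  of the lowest point. The former is smaller than \<open>m - c\<close> others, the latter comes
  after \<open>d\<close> others, and the two are not inverted; so indecomposability requires
  \<open>c < d\<close>.
\<close>

lemma Mlow_Mright_distinct_sum:
  "(\<Sum>\<pi>\<in>{\<pi> \<in> Ind (Suc (Suc m)). Mlow (pts (Suc (Suc m)) \<pi>) \<and> Mright (pts (Suc (Suc m)) \<pi>) \<and> \<pi> (Suc (Suc m)) \<noteq> 1}.
      wt (Suc (Suc m)) \<pi>)
     = (\<Sum>(a, b)\<in>Pr m. B a * B' b * (\<Sum>(c, d)\<in>{(c, d). a \<le> c \<and> c < d \<and> d \<le> m - b}. fps_X ^ (m - c + d)))"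
proof -
  let ?N = "Suc (Suc m)"
  let ?M = "{\<pi> \<in> Ind ?N. Mlow (pts ?N \<pi>) \<and> Mright (pts ?N \<pi>) \<and> \<pi> ?N \<noteq> 1}"
  let ?R = "{1..Suc m}"
  let ?I = "\<lambda>(\<tau>, (v, x)). ins x 1 (ins (Suc m) v \<tau>)"
  let ?S = "SIGMA \<tau>:Dec m. {u \<in> ?R \<times> ?R. ?I (\<tau>, u) \<in> ?M}"
  have r: "1 \<le> Suc m" "Suc m \<le> Suc m" by auto
  have bij: "bij_betw ?I ?S ?M"
  proof (rule bij_betw_imageI)
    show "inj_on ?I ?S"
    proof (rule inj_onI)
      fix u u' assume u: "u \<in> ?S" "u' \<in> ?S" and e: "?I u = ?I u'"
      obtain \<tau> v x where U: "u = (\<tau>, (v, x))" "\<tau> \<in> Dec m" "v \<in> ?R" "x \<in> ?R" using u(1) by auto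
      obtain \<tau>' v' x' where U': "u' = (\<tau>', (v', x'))" using u(2) by auto
      have e: "ins x 1 (ins (Suc m) v \<tau>) = ins x' 1 (ins (Suc m) v' \<tau>')" using e U(1) U' by simp
      have "x = x' \<and> v = v' \<and> \<tau> = \<tau>'"
        using ew_same[OF e Dec_permutes(1)[OF U(2)]] U(3,4) by auto
      then show "u = u'" using U(1) U' by simp
    qed
    show "?I ` ?S = ?M"
    proof (intro equalityI subsetI)
      fix \<pi> assume pi: "\<pi> \<in> ?M"
      then have p: "\<pi> permutes {1..?N}" by (simp add: Ind_def Av_def)
      obtain x \<sigma> where x: "1 \<le> x" "x \<le> ?N" "\<sigma> permutes {1..Suc m}" "\<pi> = ins x 1 \<sigma>" "\<pi> x = 1"
        using ex_low_ins[OF p] .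
      have x': "x \<le> Suc m" using x(2,5) pi by (cases "x = ?N") auto
      obtain \<tau> where t: "\<tau> permutes {1..m}" "\<sigma> = ins (Suc m) (\<sigma> (Suc m)) \<tau>" using ins_surj[OF x(3) r] .
      define v where "v = \<sigma> (Suc m)"
      have v: "1 \<le> v" "v \<le> Suc m" using perm_range[OF x(3), of "Suc m"] by (auto simp: v_def)
      have t2: "\<sigma> = ins (Suc m) v \<tau>" using t(2) by (simp add: v_def)
      have "\<sigma> \<in> Av (Suc m)" by (rule Av_ins_sub[OF _ x(3,1,2), of 1]) (use pi x in \<open>simp add: Ind_def\<close>)
      then have ta: "\<tau> \<in> Av m" unfolding t2 by (rule Av_ins_sub[OF _ t(1) r])
      interpret L: low_max m x "Suc m" v "v - 1" "x - 1" \<tau> by (rule low_right[OF t(1) x(1) x' v])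
      note rc = right_case[OF t(1) x(1) x' v]
      have "dsum (pts m \<tau>)"
        using pi rc(1,3,4) x(4) t2 by (intro L.ew_core) (simp_all add: Ind_def)
      then have "\<tau> \<in> Dec m" using ta by (simp add: Dec_def)
      then show "\<pi> \<in> ?I ` ?S"
        using pi x(1,4) x' v t2 by (intro image_eqI[of _ _ "(\<tau>, (v, x))"]) auto
    qed auto
  qed
  have "(\<Sum>\<pi>\<in>?M. wt ?N \<pi>) = (\<Sum>u\<in>?S. wt ?N (?I u))"
    by (rule sum.reindex_bij_betw[OF bij, symmetric])
  also have "\<dots> = (\<Sum>\<tau>\<in>Dec m. \<Sum>u\<in>{u \<in> ?R \<times> ?R. ?I (\<tau>, u) \<in> ?M}. wt ?N (?I (\<tau>, u)))"
    by (subst sum.Sigma) (auto simp: case_prod_unfold)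
  also have "\<dots> = (\<Sum>(a, b)\<in>Pr m. B a * B' b * (\<Sum>(c, d)\<in>{(c, d). a \<le> c \<and> c < d \<and> d \<le> m - b}. fps_X ^ (m - c + d)))"
  proof (rule Dec_sum)
    fix \<tau> a b assume t: "\<tau> \<in> Dec m" and ab: "1 \<le> a" "1 \<le> b" "a + b \<le> m"
      and z: "\<And>z. zc m \<tau> z \<longleftrightarrow> z = 0 \<or> z = m \<or> a \<le> z \<and> z \<le> m - b"
    note tp = Dec_permutes(1)[OF t]
    let ?C = "{(c, d). a \<le> c \<and> c < d \<and> d \<le> m - b}"
    let ?h = "\<lambda>(c, d). (Suc c, Suc d)"
    have cond: "ins x 1 (ins (Suc m) v \<tau>) \<in> ?M \<longleftrightarrow> a \<le> v - 1 \<and> v - 1 < x - 1 \<and> x - 1 \<le> m - b"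
      if vx: "v \<in> ?R" "x \<in> ?R" for v x
    proof -
      have vx': "1 \<le> x" "x \<le> Suc m" "1 \<le> v" "v \<le> Suc m" using vx by auto
      interpret L: low_max m x "Suc m" v "v - 1" "x - 1" \<tau> by (rule low_right[OF tp vx'])
      note rc = right_case[OF tp vx']
      have ne: "ins x 1 (ins (Suc m) v \<tau>) ?N \<noteq> 1"
        using injD[OF permutes_inj[OF L.ew_permutes], of ?N x] vx' by auto
      have "ins x 1 (ins (Suc m) v \<tau>) \<in> ?M \<longleftrightarrow>
        dsum (insert L.e L.T) \<and> dsum (insert L.w L.T) \<and> \<not> dsum (insert L.e (insert L.w L.T))"
        using L.ew_good[OF Dec_permutes(2)[OF t]] rc(1,3,4) ne by (auto simp: Ind_def)
      also have "\<dots> \<longleftrightarrow> a \<le> v - 1 \<and> v - 1 < x - 1 \<and> x - 1 \<le> m - b"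
        unfolding L.ew_cond[OF ab z] using rc(2) by auto
      finally show ?thesis .
    qed
    have "{u \<in> ?R \<times> ?R. ?I (\<tau>, u) \<in> ?M} = ?h ` ?C"
    proof (intro equalityI subsetI)
      fix u assume u: "u \<in> {u \<in> ?R \<times> ?R. ?I (\<tau>, u) \<in> ?M}"
      obtain v x where vx: "u = (v, x)" "v \<in> ?R" "x \<in> ?R" using u by auto
      then have "a \<le> v - 1 \<and> v - 1 < x - 1 \<and> x - 1 \<le> m - b" using cond[OF vx(2,3)] u by simp
      then show "u \<in> ?h ` ?C" using vx by (intro image_eqI[of _ _ "(v - 1, x - 1)"]) auto
    next
      fix u assume "u \<in> ?h ` ?C"
      then obtain c d where cd: "u = (Suc c, Suc d)" "a \<le> c" "c < d" "d \<le> m - b" by auto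
      moreover from this have "c \<le> m" "d \<le> m" by linarith+
      ultimately show "u \<in> {u \<in> ?R \<times> ?R. ?I (\<tau>, u) \<in> ?M}" using cond[of "Suc c" "Suc d"] by simp
    qed
    then have "(\<Sum>u\<in>{u \<in> ?R \<times> ?R. ?I (\<tau>, u) \<in> ?M}. wt ?N (?I (\<tau>, u))) = (\<Sum>u\<in>?h ` ?C. wt ?N (?I (\<tau>, u)))"
      by simp
    also have "\<dots> = (\<Sum>u\<in>?C. wt ?N (?I (\<tau>, ?h u)))"
      by (subst sum.reindex) (auto simp: inj_on_def)
    also have "\<dots> = (\<Sum>u\<in>?C. wt m \<tau> * (case u of (c, d) \<Rightarrow> fps_X ^ (m - c + d)))"
    proof (rule sum.cong[OF refl])
      fix u assume "u \<in> ?C"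
      then obtain c d where u: "u = (c, d)" "a \<le> c" "c < d" "d \<le> m - b" by auto
      then have "ninv (pts ?N (ins (Suc d) 1 (ins (Suc m) (Suc c) \<tau>))) = ninv (pts m \<tau>) + (m - c + d)"
        using right_case(5)[OF tp, of "Suc d" "Suc c"] by simp
      then show "wt ?N (?I (\<tau>, ?h u)) = wt m \<tau> * (case u of (c, d) \<Rightarrow> fps_X ^ (m - c + d))"
        unfolding wt_def u(1) by (simp add: power_add)
    qed
    finally show "(\<Sum>u\<in>{u \<in> ?R \<times> ?R. ?I (\<tau>, u) \<in> ?M}. wt ?N (?I (\<tau>, u)))
       = wt m \<tau> * (\<Sum>(c, d)\<in>?C. fps_X ^ (m - c + d))" by (simp add: sum_distrib_left)
  qed
  finally show ?thesis .
qed

text \<open>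
  Here \<open>c + 1\<close> is the position of the highest point, \<open>d + 2\<close> the final
  position of the lowest one. If the lowest point came first, the two would not be inverted and the
  thresholds would leave no room for an indecomposable result; so it comes later, and the pair
  itself contributes the additional inversion.
\<close>

lemma Mlow_Mhigh_sum:
  "(\<Sum>\<pi>\<in>{\<pi> \<in> Ind (Suc (Suc m)). Mlow (pts (Suc (Suc m)) \<pi>) \<and> Mhigh (pts (Suc (Suc m)) \<pi>)}. wt (Suc (Suc m)) \<pi>)
     = (\<Sum>(a, b)\<in>Pr m. B a * B' b * (\<Sum>(c, d)\<in>{(c, d). a \<le> c \<and> c \<le> d \<and> d \<le> m - b}. fps_X ^ (m - c + d + 1)))"
proof -
  let ?N = "Suc (Suc m)"
  let ?M = "{\<pi> \<in> Ind ?N. Mlow (pts ?N \<pi>) \<and> Mhigh (pts ?N \<pi>)}"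
  let ?R = "{1..Suc m} \<times> {1..?N}"
  let ?I = "\<lambda>(\<tau>, (g, x)). ins x 1 (ins g (Suc m) \<tau>)"
  let ?S = "SIGMA \<tau>:Dec m. {u \<in> ?R. ?I (\<tau>, u) \<in> ?M}"
  have r: "1 \<le> Suc m" "Suc m \<le> Suc m" by auto
  have bij: "bij_betw ?I ?S ?M"
  proof (rule bij_betw_imageI)
    show "inj_on ?I ?S"
    proof (rule inj_onI)
      fix u u' assume u: "u \<in> ?S" "u' \<in> ?S" and e: "?I u = ?I u'"
      obtain \<tau> g x where U: "u = (\<tau>, (g, x))" "\<tau> \<in> Dec m" "g \<in> {1..Suc m}" "x \<in> {1..?N}" using u(1) by auto
      obtain \<tau>' g' x' where U': "u' = (\<tau>', (g', x'))" "\<tau>' \<in> Dec m" "g' \<in> {1..Suc m}" using u(2) by auto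
      have e: "ins x 1 (ins g (Suc m) \<tau>) = ins x' 1 (ins g' (Suc m) \<tau>')" using e U(1) U'(1) by simp
      have p: "ins g (Suc m) \<tau> permutes {1..Suc m}"
        using ins_permutes[OF Dec_permutes(1)[OF U(2)], of g "Suc m"] U(3) by simp
      have xx: "x = x'" "ins g (Suc m) \<tau> = ins g' (Suc m) \<tau>'"
        using low_ins_same[OF e p] U(4) by auto
      have "ins g (Suc m) \<tau> g = Suc m" by simp
      moreover have "ins g (Suc m) \<tau> g' = Suc m" unfolding xx(2) by simp
      ultimately have "g = g'" using injD[OF permutes_inj[OF p]] by metis
      then have "\<tau> = \<tau>'" using xx(2) ins_cong by blast
      then show "u = u'" using U(1) U'(1) xx \<open>g = g'\<close> by simp
    qed
    show "?I ` ?S = ?M"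
    proof (intro equalityI subsetI)
      fix \<pi> assume pi: "\<pi> \<in> ?M"
      then have p: "\<pi> permutes {1..?N}" by (simp add: Ind_def Av_def)
      obtain x \<sigma> where x: "1 \<le> x" "x \<le> ?N" "\<sigma> permutes {1..Suc m}" "\<pi> = ins x 1 \<sigma>" "\<pi> x = 1"
        using ex_low_ins[OF p] .
      obtain g where sg: "\<sigma> g = Suc m" using permutes_surj[OF x(3)] by (metis surj_def)
      then have "g \<in> {1..Suc m}" using permutes_in_image[OF x(3), of g] by simp
      then have g: "1 \<le> g" "g \<le> Suc m" by auto
      obtain \<tau> where t: "\<tau> permutes {1..m}" "\<sigma> = ins g (\<sigma> g) \<tau>" using ins_surj[OF x(3) g] .
      have t2: "\<sigma> = ins g (Suc m) \<tau>" using t(2) sg by simp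
      have "\<sigma> \<in> Av (Suc m)" by (rule Av_ins_sub[OF _ x(3,1,2), of 1]) (use pi x in \<open>simp add: Ind_def\<close>)
      then have ta: "\<tau> \<in> Av m" unfolding t2 by (rule Av_ins_sub[OF _ t(1) g])
      interpret L: low_max m x g "Suc m" "g - 1" "if x \<le> g then x - 1 else x - 2" \<tau>
        by (rule low_high[OF t(1) x(1,2) g])
      note rc = high_case[OF t(1) x(1,2) g]
      have "dsum (pts m \<tau>)"
        using pi rc(1,3,4) x(4) t2 by (intro L.ew_core) (simp_all add: Ind_def)
      then have "\<tau> \<in> Dec m" using ta by (simp add: Dec_def)
      then show "\<pi> \<in> ?I ` ?S"
        using pi x(1,2,4) g t2 by (intro image_eqI[of _ _ "(\<tau>, (g, x))"]) auto
    qed auto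
  qed
  have "(\<Sum>\<pi>\<in>?M. wt ?N \<pi>) = (\<Sum>u\<in>?S. wt ?N (?I u))"
    by (rule sum.reindex_bij_betw[OF bij, symmetric])
  also have "\<dots> = (\<Sum>\<tau>\<in>Dec m. \<Sum>u\<in>{u \<in> ?R. ?I (\<tau>, u) \<in> ?M}. wt ?N (?I (\<tau>, u)))"
    by (subst sum.Sigma) (auto simp: case_prod_unfold)
  also have "\<dots> = (\<Sum>(a, b)\<in>Pr m. B a * B' b * (\<Sum>(c, d)\<in>{(c, d). a \<le> c \<and> c \<le> d \<and> d \<le> m - b}. fps_X ^ (m - c + d + 1)))"
  proof (rule Dec_sum)
    fix \<tau> a b assume t: "\<tau> \<in> Dec m" and ab: "1 \<le> a" "1 \<le> b" "a + b \<le> m"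
      and z: "\<And>z. zc m \<tau> z \<longleftrightarrow> z = 0 \<or> z = m \<or> a \<le> z \<and> z \<le> m - b"
    note tp = Dec_permutes(1)[OF t]
    let ?C = "{(c, d). a \<le> c \<and> c \<le> d \<and> d \<le> m - b}"
    let ?h = "\<lambda>(c, d). (Suc c, Suc (Suc d))"
    have cond: "ins x 1 (ins g (Suc m) \<tau>) \<in> ?M \<longleftrightarrow> a \<le> g - 1 \<and> g < x \<and> x - 2 \<le> m - b"
      if gx: "g \<in> {1..Suc m}" "x \<in> {1..?N}" for g x
    proof -
      have gx': "1 \<le> x" "x \<le> ?N" "1 \<le> g" "g \<le> Suc m" using gx by auto
      interpret L: low_max m x g "Suc m" "g - 1" "if x \<le> g then x - 1 else x - 2" \<tau>
        by (rule low_high[OF tp gx'])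
      note rc = high_case[OF tp gx']
      have "ins x 1 (ins g (Suc m) \<tau>) \<in> ?M \<longleftrightarrow>
        dsum (insert L.e L.T) \<and> dsum (insert L.w L.T) \<and> \<not> dsum (insert L.e (insert L.w L.T))"
        using L.ew_good[OF Dec_permutes(2)[OF t]] rc(1,3,4) by (auto simp: Ind_def)
      also have "\<dots> \<longleftrightarrow> a \<le> g - 1 \<and> g < x \<and> x - 2 \<le> m - b"
        unfolding L.ew_cond[OF ab z] rc(2) using gx' by (cases "x \<le> g") auto
      finally show ?thesis .
    qed
    have "{u \<in> ?R. ?I (\<tau>, u) \<in> ?M} = ?h ` ?C"
    proof (intro equalityI subsetI)
      fix u assume u: "u \<in> {u \<in> ?R. ?I (\<tau>, u) \<in> ?M}"
      obtain g x where gx: "u = (g, x)" "g \<in> {1..Suc m}" "x \<in> {1..?N}" using u by auto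
      then have "a \<le> g - 1 \<and> g < x \<and> x - 2 \<le> m - b" using cond[OF gx(2,3)] u by simp
      then show "u \<in> ?h ` ?C" using gx by (intro image_eqI[of _ _ "(g - 1, x - 2)"]) auto
    next
      fix u assume "u \<in> ?h ` ?C"
      then obtain c d where cd: "u = (Suc c, Suc (Suc d))" "a \<le> c" "c \<le> d" "d \<le> m - b" by auto
      moreover from this have "c \<le> m" "d \<le> m" by linarith+
      ultimately show "u \<in> {u \<in> ?R. ?I (\<tau>, u) \<in> ?M}" using cond[of "Suc c" "Suc (Suc d)"] by simp
    qed
    then have "(\<Sum>u\<in>{u \<in> ?R. ?I (\<tau>, u) \<in> ?M}. wt ?N (?I (\<tau>, u))) = (\<Sum>u\<in>?h ` ?C. wt ?N (?I (\<tau>, u)))"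
      by simp
    also have "\<dots> = (\<Sum>u\<in>?C. wt ?N (?I (\<tau>, ?h u)))"
      by (subst sum.reindex) (auto simp: inj_on_def)
    also have "\<dots> = (\<Sum>u\<in>?C. wt m \<tau> * (case u of (c, d) \<Rightarrow> fps_X ^ (m - c + d + 1)))"
    proof (rule sum.cong[OF refl])
      fix u assume "u \<in> ?C"
      then obtain c d where u: "u = (c, d)" "a \<le> c" "c \<le> d" "d \<le> m - b" by auto
      then have "ninv (pts ?N (ins (Suc (Suc d)) 1 (ins (Suc c) (Suc m) \<tau>))) = ninv (pts m \<tau>) + (m - c + d + 1)"
        using high_case(5)[OF tp, of "Suc (Suc d)" "Suc c"] by simp
      then show "wt ?N (?I (\<tau>, ?h u)) = wt m \<tau> * (case u of (c, d) \<Rightarrow> fps_X ^ (m - c + d + 1))"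
        unfolding wt_def u(1) by (simp add: power_add)
    qed
    finally show "(\<Sum>u\<in>{u \<in> ?R. ?I (\<tau>, u) \<in> ?M}. wt ?N (?I (\<tau>, u)))
       = wt m \<tau> * (\<Sum>(c, d)\<in>?C. fps_X ^ (m - c + d + 1))" by (simp add: sum_distrib_left)
  qed
  finally show ?thesis .
qed

section \<open>Symmetry and inclusion-exclusion\<close>

lemma gf_coeff:
  assumes "finite S"
  shows "fps_nth (\<Sum>\<pi>\<in>S. wt n \<pi>) k = of_nat (card {\<pi> \<in> S. ninv (pts n \<pi>) = k})"
proof -
  have "fps_nth (\<Sum>\<pi>\<in>S. wt n \<pi>) k = (\<Sum>\<pi>\<in>S. if ninv (pts n \<pi>) = k then 1 else 0)"
    unfolding fps_sum_nth by (rule sum.cong) (auto simp: wt_def)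
  also have "\<dots> = of_nat (card {\<pi> \<in> S. ninv (pts n \<pi>) = k})"
    using assms by (simp add: sum.If_cases Int_def)
  finally show ?thesis .
qed

lemma emb_low: "order_emb f \<Longrightarrow> low (f ` T) (f e) \<longleftrightarrow> low T e"
  unfolding low_def using emb_fst_snd(2)[of f _ e] emb_inj[of f] by (auto simp: not_less[symmetric] inj_image_mem_iff)
lemma emb_high: "order_emb f \<Longrightarrow> high (f ` T) (f e) \<longleftrightarrow> high T e"
  unfolding high_def using emb_fst_snd(2)[of f e] emb_inj[of f] by (auto simp: not_less[symmetric] inj_image_mem_iff)
lemma emb_left: "order_emb f \<Longrightarrow> left (f ` T) (f e) \<longleftrightarrow> left T e"
  unfolding left_def using emb_fst_snd(1)[of f _ e] emb_inj[of f] by (auto simp: not_less[symmetric] inj_image_mem_iff)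
lemma emb_right: "order_emb f \<Longrightarrow> right (f ` T) (f e) \<longleftrightarrow> right T e"
  unfolding right_def using emb_fst_snd(1)[of f e] emb_inj[of f] by (auto simp: not_less[symmetric] inj_image_mem_iff)

lemma M_image:
  assumes inj: "inj f" and lo: "\<And>e. lo' (f ` T) (f e) \<longleftrightarrow> lo T e"
    and mem: "\<And>S e. lo' S e \<Longrightarrow> e \<in> S" and d: "\<And>S. dsum (f ` S) \<longleftrightarrow> dsum S"
  shows "(\<exists>e. lo' (f ` T) e \<and> dsum (f ` T - {e})) \<longleftrightarrow> (\<exists>e. lo T e \<and> dsum (T - {e}))"
proof -
  have rm: "f ` T - {f e} = f ` (T - {e})" for e
    using inj by (simp add: image_set_diff)
  show ?thesis
  proof
    assume "\<exists>e. lo' (f ` T) e \<and> dsum (f ` T - {e})"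
    then obtain e where e: "lo' (f ` T) e" "dsum (f ` T - {e})" by blast
    then obtain u where "e = f u" using mem by blast
    then show "\<exists>e. lo T e \<and> dsum (T - {e})" using e lo rm d by metis
  next
    assume "\<exists>e. lo T e \<and> dsum (T - {e})"
    then obtain e where e: "lo T e" "dsum (T - {e})" by blast
    then have "lo' (f ` T) (f e)" "dsum (f ` T - {f e})" using lo rm d by simp_all
    then show "\<exists>e. lo' (f ` T) e \<and> dsum (f ` T - {e})" by blast
  qed
qed

lemma extreme_mem: "low S e \<Longrightarrow> e \<in> S" "high S e \<Longrightarrow> e \<in> S" "left S e \<Longrightarrow> e \<in> S" "right S e \<Longrightarrow> e \<in> S"
  by (simp_all add: low_def high_def left_def right_def)

lemma emb_M:
  assumes "order_emb f"
  shows "Mlow (f ` T) \<longleftrightarrow> Mlow T" "Mhigh (f ` T) \<longleftrightarrow> Mhigh T" "Mleft (f ` T) \<longleftrightarrow> Mleft T" "Mright (f ` T) \<longleftrightarrow> Mright T"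
  unfolding Mlow_def Mhigh_def Mleft_def Mright_def
  by (rule M_image[OF emb_inj[OF assms]]; (simp add: emb_low[OF assms] emb_high[OF assms] emb_left[OF assms]
      emb_right[OF assms] emb_dsum[OF assms] extreme_mem)?)+

lemma ng_M: "Mlow (ng ` T) \<longleftrightarrow> Mhigh T" "Mhigh (ng ` T) \<longleftrightarrow> Mlow T" "Mleft (ng ` T) \<longleftrightarrow> Mright T" "Mright (ng ` T) \<longleftrightarrow> Mleft T"
  unfolding Mlow_def Mhigh_def Mleft_def Mright_def
  by (rule M_image; (simp add: extreme_mem)?)+

lemma sw_M: "Mlow (sw ` T) \<longleftrightarrow> Mleft T" "Mhigh (sw ` T) \<longleftrightarrow> Mright T" "Mleft (sw ` T) \<longleftrightarrow> Mlow T" "Mright (sw ` T) \<longleftrightarrow> Mhigh T"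
  unfolding Mlow_def Mhigh_def Mleft_def Mright_def
  by (rule M_image; (simp add: extreme_mem)?)+

text \<open>
  The reverse-complement.
\<close>

definition rc :: "nat \<Rightarrow> (nat \<Rightarrow> nat) \<Rightarrow> nat \<Rightarrow> nat" where
  "rc n \<pi> i = (if i \<in> {1..n} then n + 1 - \<pi> (n + 1 - i) else i)"

text \<open>
  The half-turn about the origin followed by this translation is the half-turn about the centre of
  the diagram.
\<close>

definition move :: "nat \<Rightarrow> point \<Rightarrow> point" where
  "move n p = (fst p + int n + 1, snd p + int n + 1)"

lemma order_emb_move: "order_emb (move n)" unfolding order_emb_def move_def by auto

lemma refl_range: "i \<in> {1..n} \<Longrightarrow> n + 1 - i \<in> {1..n}" for i n :: nat by auto

lemma refl_image: "(\<lambda>i. n + 1 - i) ` {1..n} = {1..n}" for n :: nat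
proof (intro equalityI subsetI)
  fix i assume "i \<in> {1..n}"
  then show "i \<in> (\<lambda>i. n + 1 - i) ` {1..n}" by (intro image_eqI[of _ _ "n + 1 - i"]) auto
qed auto

lemma rc_permutes: "\<pi> permutes {1..n} \<Longrightarrow> rc n \<pi> permutes {1..n}"
proof (rule bij_imp_permutes)
  assume p: "\<pi> permutes {1..n}"
  have "rc n \<pi> ` {1..n} = (\<lambda>i. n + 1 - i) ` \<pi> ` (\<lambda>i. n + 1 - i) ` {1..n}"
    unfolding image_image by (rule image_cong) (auto simp: rc_def)
  also have "\<dots> = {1..n}" by (simp only: refl_image permutes_image[OF p])
  finally show "bij_betw (rc n \<pi>) {1..n} {1..n}" by (simp add: bij_betw_def eq_card_imp_inj_on)
qed (auto simp: rc_def)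

lemma rc_rc: "\<pi> permutes {1..n} \<Longrightarrow> rc n (rc n \<pi>) = \<pi>"
proof
  fix i assume p: "\<pi> permutes {1..n}"
  show "rc n (rc n \<pi>) i = \<pi> i"
    using perm_range[OF p, of i] refl_range[of i n] permutes_not_in[OF p, of i]
    by (cases "i \<in> {1..n}") (auto simp: rc_def)
qed

lemma pts_rc:
  assumes "\<pi> permutes {1..n}"
  shows "pts n (rc n \<pi>) = move n ` ng ` pts n \<pi>"
proof -
  have "pts n (rc n \<pi>) = pt (rc n \<pi>) ` (\<lambda>i. n + 1 - i) ` {1..n}" by (simp only: pts_def refl_image)
  also have "\<dots> = move n ` ng ` pts n \<pi>"
    unfolding pts_def image_image
  proof (rule image_cong[OF refl])
    fix i assume i: "i \<in> {1..n}"
    have "n + 1 - (n + 1 - i) = i" using i by auto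
    then have "rc n \<pi> (n + 1 - i) = n + 1 - \<pi> i" using refl_range[OF i] by (simp add: rc_def)
    then show "pt (rc n \<pi>) (n + 1 - i) = move n (ng (pt \<pi> i))"
      using i perm_range[OF assms i] by (simp add: pt_def move_def of_nat_diff)
  qed
  finally show ?thesis .
qed

lemma pts_inv:
  assumes "\<pi> permutes {1..n}"
  shows "pts n (inv \<pi>) = sw ` pts n \<pi>"
proof -
  have "pts n (inv \<pi>) = pt (inv \<pi>) ` \<pi> ` {1..n}" by (simp only: pts_def permutes_image[OF assms])
  also have "\<dots> = sw ` pts n \<pi>"
    unfolding pts_def image_image
    by (rule image_cong[OF refl]) (simp add: pt_def sw_def permutes_inverses[OF assms])
  finally show ?thesis .
qed

lemma rc_card:
  assumes "\<And>T. finite T \<Longrightarrow> Q' (move n ` ng ` T) \<longleftrightarrow> Q T"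
  shows "card {\<pi>. \<pi> permutes {1..n} \<and> Q (pts n \<pi>)} = card {\<pi>. \<pi> permutes {1..n} \<and> Q' (pts n \<pi>)}"
proof (rule bij_betw_same_card[of "rc n"], rule bij_betw_byWitness[of _ "rc n"])
  show "rc n ` {\<pi>. \<pi> permutes {1..n} \<and> Q (pts n \<pi>)} \<subseteq> {\<pi>. \<pi> permutes {1..n} \<and> Q' (pts n \<pi>)}"
  proof (intro subsetI)
    fix u assume "u \<in> rc n ` {\<pi>. \<pi> permutes {1..n} \<and> Q (pts n \<pi>)}"
    then obtain \<pi> where p: "\<pi> permutes {1..n}" "Q (pts n \<pi>)" "u = rc n \<pi>" by auto
    then show "u \<in> {\<pi>. \<pi> permutes {1..n} \<and> Q' (pts n \<pi>)}"
      using assms[of "pts n \<pi>"] pts_rc[OF p(1)] rc_permutes[OF p(1)] by simp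
  qed
  show "rc n ` {\<pi>. \<pi> permutes {1..n} \<and> Q' (pts n \<pi>)} \<subseteq> {\<pi>. \<pi> permutes {1..n} \<and> Q (pts n \<pi>)}"
  proof (intro subsetI)
    fix u assume "u \<in> rc n ` {\<pi>. \<pi> permutes {1..n} \<and> Q' (pts n \<pi>)}"
    then obtain \<pi> where p: "\<pi> permutes {1..n}" "Q' (pts n \<pi>)" "u = rc n \<pi>" by auto
    have "pts n \<pi> = move n ` ng ` pts n (rc n \<pi>)" using pts_rc[OF rc_permutes[OF p(1)]] rc_rc[OF p(1)] by simp
    then show "u \<in> {\<pi>. \<pi> permutes {1..n} \<and> Q (pts n \<pi>)}"
      using assms[of "pts n (rc n \<pi>)"] p rc_permutes[OF p(1)] by simp
  qed
qed (auto simp: rc_rc)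

lemma inv_card:
  assumes "\<And>T. finite T \<Longrightarrow> Q' (sw ` T) \<longleftrightarrow> Q T"
  shows "card {\<pi>. \<pi> permutes {1..n} \<and> Q (pts n \<pi>)} = card {\<pi>. \<pi> permutes {1..n} \<and> Q' (pts n \<pi>)}"
proof (rule bij_betw_same_card[of inv], rule bij_betw_byWitness[of _ inv])
  show "inv ` {\<pi>. \<pi> permutes {1..n} \<and> Q (pts n \<pi>)} \<subseteq> {\<pi>. \<pi> permutes {1..n} \<and> Q' (pts n \<pi>)}"
  proof (intro subsetI)
    fix u assume "u \<in> inv ` {\<pi>. \<pi> permutes {1..n} \<and> Q (pts n \<pi>)}"
    then obtain \<pi> where p: "\<pi> permutes {1..n}" "Q (pts n \<pi>)" "u = inv \<pi>" by auto
    then show "u \<in> {\<pi>. \<pi> permutes {1..n} \<and> Q' (pts n \<pi>)}"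
      using assms[of "pts n \<pi>"] pts_inv[OF p(1)] permutes_inv[OF p(1)] by simp
  qed
  show "inv ` {\<pi>. \<pi> permutes {1..n} \<and> Q' (pts n \<pi>)} \<subseteq> {\<pi>. \<pi> permutes {1..n} \<and> Q (pts n \<pi>)}"
  proof (intro subsetI)
    fix u assume "u \<in> inv ` {\<pi>. \<pi> permutes {1..n} \<and> Q' (pts n \<pi>)}"
    then obtain \<pi> where p: "\<pi> permutes {1..n}" "Q' (pts n \<pi>)" "u = inv \<pi>" by auto
    have "pts n \<pi> = sw ` pts n (inv \<pi>)" using pts_inv[OF p(1)] by simp
    then show "u \<in> {\<pi>. \<pi> permutes {1..n} \<and> Q (pts n \<pi>)}"
      using assms[of "pts n (inv \<pi>)"] p permutes_inv[OF p(1)] by simp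
  qed
qed (auto simp: permutes_inv_inv)

definition cnt :: "nat \<Rightarrow> nat \<Rightarrow> (point set \<Rightarrow> bool) \<Rightarrow> nat" where
  "cnt n k Q = card {\<pi> \<in> Ind n. ninv (pts n \<pi>) = k \<and> Q (pts n \<pi>)}"

text \<open>
  All conditions are properties of the diagram, which is the form in which symmetries can be
  applied.
\<close>

lemma cnt_alt: "cnt n k Q = card {\<pi>. \<pi> permutes {1..n} \<and> (avoids (pts n \<pi>) \<and> \<not> dsum (pts n \<pi>) \<and> ninv (pts n \<pi>) = k \<and> Q (pts n \<pi>))}"
  unfolding cnt_def Ind_def Av_def by (rule arg_cong[of _ _ card]) auto

lemma cnt_rc:
  assumes "\<And>T. finite T \<Longrightarrow> Q' (move n ` ng ` T) \<longleftrightarrow> Q T"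
  shows "cnt n k Q = cnt n k Q'"
  unfolding cnt_alt
  by (rule rc_card) (simp add: assms emb_avoids[OF order_emb_move] emb_dsum[OF order_emb_move] emb_ninv[OF order_emb_move])

lemma cnt_inv:
  assumes "\<And>T. finite T \<Longrightarrow> Q' (sw ` T) \<longleftrightarrow> Q T"
  shows "cnt n k Q = cnt n k Q'"
  unfolding cnt_alt by (rule inv_card) (simp add: assms)

text \<open>
  The four directions are permuted transitively by the symmetries, the adjacent pairs low-right and
  left-high are exchanged, and so are the opposite pairs low-high and left-right.
\<close>

lemma cnt_symmetry:
  "cnt n k Mhigh = cnt n k Mlow" "cnt n k Mleft = cnt n k Mlow" "cnt n k Mright = cnt n k Mlow"
  "cnt n k (\<lambda>T. Mleft T \<and> Mright T) = cnt n k (\<lambda>T. Mlow T \<and> Mhigh T)"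
  "cnt n k (\<lambda>T. Mleft T \<and> Mhigh T) = cnt n k (\<lambda>T. Mlow T \<and> Mright T)"
proof -
  show 1: "cnt n k Mhigh = cnt n k Mlow" by (rule cnt_rc) (simp add: emb_M[OF order_emb_move] ng_M)
  show 2: "cnt n k Mleft = cnt n k Mlow" by (rule cnt_inv) (simp add: sw_M)
  have "cnt n k Mright = cnt n k Mhigh" by (rule cnt_inv) (simp add: sw_M)
  then show "cnt n k Mright = cnt n k Mlow" using 1 by simp
  show "cnt n k (\<lambda>T. Mleft T \<and> Mright T) = cnt n k (\<lambda>T. Mlow T \<and> Mhigh T)"
    by (rule cnt_inv) (simp add: sw_M)
  show "cnt n k (\<lambda>T. Mleft T \<and> Mhigh T) = cnt n k (\<lambda>T. Mlow T \<and> Mright T)"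
    by (rule cnt_inv) (simp add: sw_M)
qed

text \<open>
  Each triple intersection would contain one of the two empty intersections, so inclusion-exclusion
  stops after the pairs.
\<close>

lemma card_four:
  assumes fin: "finite L" "finite H" "finite F" "finite K" and e: "L \<inter> F = {}" "H \<inter> K = {}"
  shows "card (L \<union> H \<union> F \<union> K) + card (L \<inter> H) + card (L \<inter> K) + card (F \<inter> H) + card (F \<inter> K)
     = card L + card H + card F + card K"
proof -
  have "card (L \<union> F) = card L + card F" "card (H \<union> K) = card H + card K"
    using assms by (simp_all add: card_Un_disjoint)
  moreover have "card (L \<union> F) + card (H \<union> K) = card ((L \<union> F) \<union> (H \<union> K)) + card ((L \<union> F) \<inter> (H \<union> K))"
    by (rule card_Un_Int) (use fin in auto)
  moreover have "(L \<union> F) \<inter> (H \<union> K) = ((L \<inter> H) \<union> (L \<inter> K)) \<union> ((F \<inter> H) \<union> (F \<inter> K))" by auto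
  moreover have "card (((L \<inter> H) \<union> (L \<inter> K)) \<union> ((F \<inter> H) \<union> (F \<inter> K))) = card ((L \<inter> H) \<union> (L \<inter> K)) + card ((F \<inter> H) \<union> (F \<inter> K))"
    by (rule card_Un_disjoint) (use assms in auto)
  moreover have "card ((L \<inter> H) \<union> (L \<inter> K)) = card (L \<inter> H) + card (L \<inter> K)"
    by (rule card_Un_disjoint) (use assms in auto)
  moreover have "card ((F \<inter> H) \<union> (F \<inter> K)) = card (F \<inter> H) + card (F \<inter> K)"
    by (rule card_Un_disjoint) (use assms in auto)
  moreover have "L \<union> H \<union> F \<union> K = (L \<union> F) \<union> (H \<union> K)" by auto
  ultimately show ?thesis by simp
qed

lemma Ind_count:
  assumes "k + 7 \<le> 2 * n"
  shows "card {\<pi> \<in> Ind n. ninv (pts n \<pi>) = k} + 2 * cnt n k (\<lambda>T. Mlow T \<and> Mhigh T) + 2 * cnt n k (\<lambda>T. Mlow T \<and> Mright T)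
     = 4 * cnt n k Mlow"
proof -
  let ?S = "\<lambda>Q. {\<pi> \<in> Ind n. ninv (pts n \<pi>) = k \<and> Q (pts n \<pi>)}"
  have "\<pi> \<in> ?S Mlow \<union> ?S Mhigh \<union> ?S Mleft \<union> ?S Mright" if "\<pi> \<in> Ind n" "ninv (pts n \<pi>) = k" for \<pi>
  proof -
    have "reducible (pts n \<pi>)"
      by (rule few_inversions_reducible)
        (use that assms generic_pts[of \<pi> n] in \<open>auto simp: Ind_def Av_def card_pts\<close>)
    then show ?thesis using that
      unfolding reducible_def extreme_def Mlow_def Mhigh_def Mleft_def Mright_def by blast
  qed
  then have un: "{\<pi> \<in> Ind n. ninv (pts n \<pi>) = k} = ?S Mlow \<union> ?S Mhigh \<union> ?S Mleft \<union> ?S Mright" by blast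
  have e1: "?S Mlow \<inter> ?S Mleft = {}"
    using low_left_exclusive unfolding Ind_def Mlow_def Mleft_def by blast
  have e2: "?S Mhigh \<inter> ?S Mright = {}"
    using high_right_exclusive unfolding Ind_def Mhigh_def Mright_def by blast
  have int: "?S Q \<inter> ?S Q' = ?S (\<lambda>T. Q T \<and> Q' T)" for Q Q' by auto
  have "card {\<pi> \<in> Ind n. ninv (pts n \<pi>) = k} + cnt n k (\<lambda>T. Mlow T \<and> Mhigh T) + cnt n k (\<lambda>T. Mlow T \<and> Mright T)
     + cnt n k (\<lambda>T. Mleft T \<and> Mhigh T) + cnt n k (\<lambda>T. Mleft T \<and> Mright T)
     = cnt n k Mlow + cnt n k Mhigh + cnt n k Mleft + cnt n k Mright"
    unfolding un cnt_def int[symmetric] by (rule card_four[OF _ _ _ _ e1 e2]) simp_all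
  then show ?thesis unfolding cnt_symmetry by simp
qed

lemma I213_rc: "bij_betw (rc n) (I132 n) (I213 n)"
proof (rule bij_betw_byWitness[of _ "rc n"])
  have lt: "rc n \<pi> i < rc n \<pi> j \<longleftrightarrow> \<pi> (n + 1 - j) < \<pi> (n + 1 - i)"
    if "\<pi> permutes {1..n}" "i \<in> {1..n}" "j \<in> {1..n}" for \<pi> i j
  proof -
    have "\<pi> (n + 1 - i) \<le> n" "\<pi> (n + 1 - j) \<le> n"
      using perm_range[OF that(1) refl_range[OF that(2)]] perm_range[OF that(1) refl_range[OF that(3)]] by auto
    moreover have "rc n \<pi> i = n + 1 - \<pi> (n + 1 - i)" "rc n \<pi> j = n + 1 - \<pi> (n + 1 - j)"
      using that by (simp_all add: rc_def)
    ultimately show ?thesis by linarith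
  qed
  have ds: "dsum (pts n (rc n \<pi>)) \<longleftrightarrow> dsum (pts n \<pi>)" if "\<pi> permutes {1..n}" for \<pi>
    by (simp add: pts_rc[OF that] emb_dsum[OF order_emb_move])
  show "rc n ` I132 n \<subseteq> I213 n"
  proof
    fix u assume "u \<in> rc n ` I132 n"
    then obtain \<alpha> where a: "\<alpha> \<in> I132 n" "u = rc n \<alpha>" by auto
    note p = I132_permutes[OF a(1)]
    have False if "i \<in> {1..n}" "j \<in> {1..n}" "k \<in> {1..n}" "i < j" "j < k" "u j < u i" "u i < u k" for i j k
    proof -
      have "\<alpha> (n + 1 - k) < \<alpha> (n + 1 - i)" "\<alpha> (n + 1 - i) < \<alpha> (n + 1 - j)"
        using that lt[OF p] a(2) by auto
      moreover have "n + 1 - k < n + 1 - j" "n + 1 - j < n + 1 - i" using that by auto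
      ultimately show False using a(1) refl_range[OF that(1)] refl_range[OF that(2)] refl_range[OF that(3)]
        unfolding I132_def by blast
    qed
    then show "u \<in> I213 n" using a ds[OF p] rc_permutes[OF p] by (auto simp: I213_def I132_def)
  qed
  show "rc n ` I213 n \<subseteq> I132 n"
  proof
    fix u assume "u \<in> rc n ` I213 n"
    then obtain \<alpha> where a: "\<alpha> \<in> I213 n" "u = rc n \<alpha>" by auto
    note p = I213_permutes[OF a(1)]
    have False if "i \<in> {1..n}" "j \<in> {1..n}" "k \<in> {1..n}" "i < j" "j < k" "u i < u k" "u k < u j" for i j k
    proof -
      have "\<alpha> (n + 1 - k) < \<alpha> (n + 1 - i)" "\<alpha> (n + 1 - j) < \<alpha> (n + 1 - k)"
        using that lt[OF p] a(2) by auto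
      moreover have "n + 1 - k < n + 1 - j" "n + 1 - j < n + 1 - i" using that by auto
      ultimately show False using a(1) refl_range[OF that(1)] refl_range[OF that(2)] refl_range[OF that(3)]
        unfolding I213_def by blast
    qed
    then show "u \<in> I132 n" using a ds[OF p] rc_permutes[OF p] by (auto simp: I213_def I132_def)
  qed
qed (use rc_rc[OF I132_permutes] rc_rc[OF I213_permutes] in blast)+

lemma B'_eq_B: "B' n = B n"
proof -
  have "B' n = (\<Sum>\<alpha>\<in>I132 n. wt n (rc n \<alpha>))"
    unfolding B'_def by (rule sum.reindex_bij_betw[OF I213_rc, symmetric])
  also have "\<dots> = B n"
    unfolding B_def by (rule sum.cong[OF refl])
      (simp add: wt_def pts_rc[OF I132_permutes] emb_ninv[OF order_emb_move])
  finally show ?thesis .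
qed

lemma av_split: "av n k 4 pattern_1324 = card {\<pi> \<in> Dec n. ninv (pts n \<pi>) = k} + card {\<pi> \<in> Ind n. ninv (pts n \<pi>) = k}"
proof -
  have "av n k 4 pattern_1324 = card ({\<pi> \<in> Dec n. ninv (pts n \<pi>) = k} \<union> {\<pi> \<in> Ind n. ninv (pts n \<pi>) = k})"
    unfolding av_def Dec_def Ind_def Av_def ninv_pts avoids_pts by (rule arg_cong[of _ _ card]) auto
  also have "\<dots> = card {\<pi> \<in> Dec n. ninv (pts n \<pi>) = k} + card {\<pi> \<in> Ind n. ninv (pts n \<pi>) = k}"
    by (rule card_Un_disjoint) (auto simp: Dec_def Ind_def)
  finally show ?thesis .
qed

section \<open>132-avoiders as Young diagrams in a staircase\<close>

definition S132 :: "nat \<Rightarrow> (nat \<Rightarrow> nat) set" where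
  "S132 a = {\<alpha>. \<alpha> permutes {1..a} \<and>
     \<not> (\<exists>i\<in>{1..a}. \<exists>j\<in>{1..a}. \<exists>k\<in>{1..a}. i < j \<and> j < k \<and> \<alpha> i < \<alpha> k \<and> \<alpha> k < \<alpha> j)}"

text \<open>
  Young diagrams by their row lengths, with trailing empty rows, inside the staircase with rows of
  lengths \<open>m - 1\<close>, \<open>m - 2\<close> and so on down to \<open>0\<close>.
\<close>

definition codes :: "nat \<Rightarrow> nat list set" where
  "codes m = {c. length c = m \<and> sorted_wrt (\<ge>) c \<and> (\<forall>i<m. c ! i + i < m)}"

text \<open>
  The permutation with the given Lehmer code: the entry of the code at a position counts the smaller
  values to the right of it.
\<close>

primrec perm_of :: "nat list \<Rightarrow> nat \<Rightarrow> nat" where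
  "perm_of [] = id"
| "perm_of (c # cs) = ins 1 (Suc c) (perm_of cs)"

lemma finite_S132 [simp]: "finite (S132 n)"
  unfolding S132_def by (rule finite_subset[OF _ finite_permutations[of "{1..n}"]]) auto

lemma codes_Cons: "c # cs \<in> codes (Suc m) \<longleftrightarrow> c \<le> m \<and> (\<forall>x\<in>set cs. x \<le> c) \<and> cs \<in> codes m"
  unfolding codes_def by (auto simp: All_less_Suc2)

lemma codes_0: "codes 0 = {[]}" by (auto simp: codes_def)

lemma finite_codes [simp]: "finite (codes m)"
proof (rule finite_subset)
  show "codes m \<subseteq> {c. set c \<subseteq> {..m} \<and> length c = m}"
  proof
    fix c assume "c \<in> codes m"
    then have c: "length c = m" "\<forall>i<m. c ! i + i < m" by (auto simp: codes_def)
    have "x \<le> m" if "x \<in> set c" for x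
      using that c by (fastforce simp: in_set_conv_nth)
    then show "c \<in> {c. set c \<subseteq> {..m} \<and> length c = m}" using c by auto
  qed
qed (rule finite_lists_length_eq, simp)

lemma ins1_bump: "ins 1 v \<sigma> (Suc i) = bump v (\<sigma> i)" if "1 \<le> i" for i
  using ins_bump[of 1 v \<sigma> i] that by (simp add: bump_def)

text \<open>
  The new first entry can only play the 1 in a pattern 132.
\<close>

lemma S132_ins:
  assumes p: "\<sigma> permutes {1..m}" and c: "c \<le> m"
  shows "ins 1 (Suc c) \<sigma> \<in> S132 (Suc m) \<longleftrightarrow>
    \<sigma> \<in> S132 m \<and> \<not> (\<exists>i\<in>{1..m}. \<exists>j\<in>{1..m}. i < j \<and> c < \<sigma> j \<and> \<sigma> j < \<sigma> i)" (is "?L \<longleftrightarrow> ?R")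
proof
  let ?s = "ins 1 (Suc c) \<sigma>"
  have b: "?s (Suc i) = bump (Suc c) (\<sigma> i)" if "1 \<le> i" for i using ins1_bump that by simp
  assume L: ?L
  then have no: False if "i \<in> {1..Suc m}" "j \<in> {1..Suc m}" "k \<in> {1..Suc m}" "i < j" "j < k" "?s i < ?s k" "?s k < ?s j" for i j k
    using that unfolding S132_def by blast
  have False if "i \<in> {1..m}" "j \<in> {1..m}" "k \<in> {1..m}" "i < j" "j < k" "\<sigma> i < \<sigma> k" "\<sigma> k < \<sigma> j" for i j k
    using no[of "Suc i" "Suc j" "Suc k"] that b by simp
  moreover have False if "i \<in> {1..m}" "j \<in> {1..m}" "i < j" "c < \<sigma> j" "\<sigma> j < \<sigma> i" for i j
    using no[of 1 "Suc i" "Suc j"] that b by (simp add: bump_simps)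
  ultimately show ?R using p unfolding S132_def by blast
next
  let ?s = "ins 1 (Suc c) \<sigma>"
  have b: "?s (Suc i) = bump (Suc c) (\<sigma> i)" if "1 \<le> i" for i using ins1_bump that by simp
  assume R: ?R
  have False if h: "i \<in> {1..Suc m}" "j \<in> {1..Suc m}" "k \<in> {1..Suc m}" "i < j" "j < k" "?s i < ?s k" "?s k < ?s j" for i j k
  proof -
    obtain j' k' where jk: "j = Suc j'" "k = Suc k'" using h by (metis Suc_le_D atLeastAtMost_iff One_nat_def)
    then have jk': "j' \<in> {1..m}" "k' \<in> {1..m}" "j' < k'" using h by auto
    have kj: "\<sigma> k' < \<sigma> j'" using h(7) b[of k'] b[of j'] jk jk' by simp
    show False
    proof (cases "i = 1")
      case True
      then have "c < \<sigma> k'" using h(6) b[of k'] jk jk' by (simp add: bump_def split: if_splits)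
      then show False using R jk' kj by blast
    next
      case False
      then obtain i' where i: "i = Suc i'" "i' \<in> {1..m}" "i' < j'" using h jk by (cases i) auto
      then have "\<sigma> i' < \<sigma> k'" using h(6) b[of k'] b[of i'] jk jk' by simp
      then show False using R jk' kj i unfolding S132_def by blast
    qed
  qed
  moreover have "?s permutes {1..Suc m}" using ins_permutes[OF p, of 1 "Suc c"] c by simp
  ultimately show ?L unfolding S132_def by blast
qed

lemma first_ins_ninv:
  assumes p: "\<sigma> permutes {1..m}" and c: "c \<le> m"
  shows "ninv (pts (Suc m) (ins 1 (Suc c) \<sigma>)) = c + ninv (pts m \<sigma>)"
proof -
  have eq: "pts (Suc m) (ins 1 (Suc c) \<sigma>) = insert (int 1, int (Suc c)) (shift 1 (Suc c) ` pts m \<sigma>)"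
    by (rule pts_ins) auto
  have "inverted (int 1, int (Suc c)) (shift 1 (Suc c) (pt \<sigma> i)) \<longleftrightarrow> \<not> Suc c \<le> \<sigma> i" if "i \<in> {1..m}" for i
    using that unfolding shift_pt inverted_def by (auto simp: bump_def)
  then have "{i \<in> {1..m}. inverted (int 1, int (Suc c)) (shift 1 (Suc c) (pt \<sigma> i))}
     = {1..m} - {i \<in> {1..m}. Suc c \<le> \<sigma> i}" by auto
  moreover have "card ({1..m} - {i \<in> {1..m}. Suc c \<le> \<sigma> i}) = card {1..m} - card {i \<in> {1..m}. Suc c \<le> \<sigma> i}"
    by (rule card_Diff_subset) auto
  ultimately have "cross {(int 1, int (Suc c))} (shift 1 (Suc c) ` pts m \<sigma>) = m - (m - c)"
    using perm_count_ge[OF p, of "Suc c"] unfolding cross_emb_pts[OF order_emb_shift] by simp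
  then show ?thesis unfolding eq using c ins_notin[of 1 "Suc c"]
    by (subst ninv_insert) (simp_all add: emb_ninv[OF order_emb_shift])
qed

text \<open>
  By \<open>S132_ins\<close> a first entry \<open>c + 1\<close> may be added to a 132-avoider iff
  there is no inversion among its values above \<open>c\<close>. The last conjunct translates that
  into the condition that \<open>c\<close> is at least as large as all previous code entries, which
  makes the induction work: the codes of 132-avoiders are exactly the weakly decreasing ones.
\<close>

lemma perm_of_codes:
  assumes "cs \<in> codes m"
  shows "perm_of cs \<in> S132 m \<and> ninv (pts m (perm_of cs)) = sum_list cs \<and>
    (\<forall>c\<le>m. (\<exists>i\<in>{1..m}. \<exists>j\<in>{1..m}. i < j \<and> c < perm_of cs j \<and> perm_of cs j < perm_of cs i) \<longleftrightarrow> \<not> (\<forall>x\<in>set cs. x \<le> c))"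
  using assms
proof (induction cs arbitrary: m)
  case Nil
  then have "m = 0" by (simp add: codes_def)
  then show ?case by (auto simp: S132_def permutes_id pts_def)
next
  case (Cons c' cs)
  then obtain m' where m: "m = Suc m'" by (cases m) (auto simp: codes_def)
  then have c': "c' \<le> m'" "\<forall>x\<in>set cs. x \<le> c'" "cs \<in> codes m'" using Cons.prems codes_Cons by auto
  let ?s = "perm_of cs"
  have IH: "?s \<in> S132 m'" "ninv (pts m' ?s) = sum_list cs"
    "\<And>c. c \<le> m' \<Longrightarrow> (\<exists>i\<in>{1..m'}. \<exists>j\<in>{1..m'}. i < j \<and> c < ?s j \<and> ?s j < ?s i) \<longleftrightarrow> \<not> (\<forall>x\<in>set cs. x \<le> c)"
    using Cons.IH[OF c'(3)] by auto
  have p: "?s permutes {1..m'}" using IH(1) by (simp add: S132_def)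
  have b: "ins 1 (Suc c') ?s (Suc i) = bump (Suc c') (?s i)" if "1 \<le> i" for i using ins1_bump that by simp
  have "(\<exists>i\<in>{1..m}. \<exists>j\<in>{1..m}. i < j \<and> c < perm_of (c' # cs) j \<and> perm_of (c' # cs) j < perm_of (c' # cs) i)
      \<longleftrightarrow> \<not> (\<forall>x\<in>set (c' # cs). x \<le> c)" if "c \<le> m" for c
  proof (cases "c' \<le> c")
    case True
    then have "\<forall>x\<in>set (c' # cs). x \<le> c" using c'(2) by auto
    moreover have False if h: "i \<in> {1..m}" "j \<in> {1..m}" "i < j" "c < ins 1 (Suc c') ?s j" "ins 1 (Suc c') ?s j < ins 1 (Suc c') ?s i" for i j
    proof -
      obtain j' where j: "j = Suc j'" "j' \<in> {1..m'}" using h m by (cases j) auto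
      show False
      proof (cases "i = 1")
        case True
        then show False using h(4,5) b[of j'] j \<open>c' \<le> c\<close> by (simp add: bump_def split: if_splits)
      next
        case False
        then obtain i' where i: "i = Suc i'" "i' \<in> {1..m'}" "i' < j'" using h j m by (cases i) auto
        have "?s j' < ?s i'" using h(5) i j b[of i'] b[of j'] by simp
        moreover have "c' < ?s j'" using h(4) j b[of j'] True by (auto simp: bump_def split: if_splits)
        ultimately show False using IH(3)[OF c'(1)] c'(2) i j by blast
      qed
    qed
    ultimately show ?thesis unfolding perm_of.simps by blast
  next
    case False
    then obtain j where j: "j \<in> {1..m'}" "?s j = c'"
    proof -
      have "c' \<in> ?s ` {1..m'}" using permutes_image[OF p] False c'(1) by auto
      then show ?thesis using that by auto
    qed
    have "ins 1 (Suc c') ?s (Suc j) = c'" using b[of j] j by (simp add: bump_def)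
    moreover have "ins 1 (Suc c') ?s 1 = Suc c'" by simp
    ultimately have "\<exists>i\<in>{1..m}. \<exists>j\<in>{1..m}. i < j \<and> c < ins 1 (Suc c') ?s j \<and> ins 1 (Suc c') ?s j < ins 1 (Suc c') ?s i"
      using j m False by (intro bexI[of _ 1] bexI[of _ "Suc j"]) auto
    then show ?thesis using False unfolding perm_of.simps by auto
  qed
  moreover have "perm_of (c' # cs) \<in> S132 m"
    unfolding m perm_of.simps S132_ins[OF p c'(1)] using IH(1) IH(3)[OF c'(1)] c'(2) by blast
  moreover have "ninv (pts m (perm_of (c' # cs))) = sum_list (c' # cs)"
    unfolding m perm_of.simps first_ins_ninv[OF p c'(1)] using IH(2) by simp
  ultimately show ?case by blast
qed

lemma perm_of_bij: "bij_betw perm_of (codes m) (S132 m)"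
proof (rule bij_betw_imageI)
  show "inj_on perm_of (codes m)"
  proof (rule inj_onI)
    fix u v assume "u \<in> codes m" "v \<in> codes m" "perm_of u = perm_of v"
    then show "u = v"
    proof (induction u arbitrary: v m)
      case Nil
      then show ?case by (auto simp: codes_def)
    next
      case (Cons c u)
      then obtain m' c' v' where m: "m = Suc m'" "v = c' # v'" by (cases m; cases v) (auto simp: codes_def)
      have e: "ins 1 (Suc c) (perm_of u) = ins 1 (Suc c') (perm_of v')" using Cons.prems m by simp
      have "c = c'" using fun_cong[OF e, of 1] by simp
      then have "perm_of u = perm_of v'" using e ins_cong by blast
      then show ?case using Cons.IH[of m' v'] Cons.prems m \<open>c = c'\<close> codes_Cons by blast
    qed
  qed
  show "perm_of ` codes m = S132 m"
  proof (intro equalityI subsetI)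
    fix \<alpha> assume "\<alpha> \<in> S132 m"
    then show "\<alpha> \<in> perm_of ` codes m"
    proof (induction m arbitrary: \<alpha>)
      case 0
      then show ?case by (auto simp: S132_def codes_0 fun_eq_iff)
    next
      case (Suc m)
      have p: "\<alpha> permutes {1..Suc m}" using Suc.prems by (simp add: S132_def)
      obtain \<sigma> where s: "\<sigma> permutes {1..m}" "\<alpha> = ins 1 (\<alpha> 1) \<sigma>" by (rule ins_surj[OF p, of 1]) auto
      obtain c where c: "\<alpha> 1 = Suc c" "c \<le> m" using perm_range[OF p, of 1] by (cases "\<alpha> 1") auto
      have R: "\<sigma> \<in> S132 m" "\<not> (\<exists>i\<in>{1..m}. \<exists>j\<in>{1..m}. i < j \<and> c < \<sigma> j \<and> \<sigma> j < \<sigma> i)"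
        using S132_ins[OF s(1) c(2)] Suc.prems s(2) c(1) by auto
      obtain cs where cs: "cs \<in> codes m" "\<sigma> = perm_of cs" using Suc.IH[OF R(1)] by auto
      have "\<forall>x\<in>set cs. x \<le> c" using perm_of_codes[OF cs(1)] R(2) c(2) cs(2) by blast
      then have "c # cs \<in> codes (Suc m)" using codes_Cons c cs by blast
      moreover have "\<alpha> = perm_of (c # cs)" using s(2) c(1) cs(2) by simp
      ultimately show ?case by blast
    qed
  qed (use perm_of_codes in auto)
qed

lemma S132_gf: "(\<Sum>\<alpha>\<in>S132 m. wt m \<alpha>) = (\<Sum>c\<in>codes m. fps_X ^ sum_list c)"
proof -
  have "(\<Sum>\<alpha>\<in>S132 m. wt m \<alpha>) = (\<Sum>c\<in>codes m. wt m (perm_of c))"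
    by (rule sum.reindex_bij_betw[OF perm_of_bij, symmetric])
  also have "\<dots> = (\<Sum>c\<in>codes m. fps_X ^ sum_list c)"
    by (rule sum.cong[OF refl]) (use perm_of_codes in \<open>simp add: wt_def\<close>)
  finally show ?thesis .
qed

text \<open>
  Adding fixed points at the end does not change the inversions.
\<close>

lemma wt_extend:
  assumes p: "\<alpha> permutes {1..a}" and "a \<le> m"
  shows "wt m \<alpha> = wt a \<alpha>"
proof -
  have id: "\<alpha> i = i" if "a < i" for i using permutes_not_in[OF p, of i] that by simp
  have le: "\<alpha> i \<le> a" if "i \<le> a" for i
    using permutes_in_image[OF p, of i] permutes_not_in[OF p, of i] that by (cases "i = 0") auto
  have "j \<le> a" if "i < j" "\<alpha> j < \<alpha> i" for i j
    using that id[of j] id[of i] le[of i] by (cases "i \<le> a"; cases "j \<le> a") auto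
  then have "inversions m \<alpha> = inversions a \<alpha>" using assms(2) unfolding inversions_def by fastforce
  then show ?thesis by (simp add: wt_def ninv_pts)
qed

text \<open>
  A 132-avoider cannot have an inversion after its first block, so it is that block followed by
  fixed points. As functions the permutation and its first block are the same.
\<close>

lemma S132_I132: "1 \<le> m \<Longrightarrow> S132 m = (\<Union>a\<in>{1..m}. I132 a)"
proof (intro equalityI subsetI)
  assume m: "1 \<le> m"
  fix \<alpha> assume al: "\<alpha> \<in> S132 m"
  then have p: "\<alpha> permutes {1..m}" by (simp add: S132_def)
  have no: False if "i \<in> {1..m}" "j \<in> {1..m}" "k \<in> {1..m}" "i < j" "j < k" "\<alpha> i < \<alpha> k" "\<alpha> k < \<alpha> j" for i j k
    using al that unfolding S132_def by blast
  define a where "a = (LEAST z. 1 \<le> z \<and> zc m \<alpha> z)"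
  have a: "1 \<le> a" "zc m \<alpha> a" using LeastI[of "\<lambda>z. 1 \<le> z \<and> zc m \<alpha> z" m] m by (auto simp: a_def)
  have am: "a \<le> m" using a by (simp add: zc_def)
  have least: "\<not> zc m \<alpha> z" if "1 \<le> z" "z < a" for z
    using not_less_Least[of z "\<lambda>z. 1 \<le> z \<and> zc m \<alpha> z"] that by (auto simp: a_def)
  have inj: "\<alpha> i \<noteq> \<alpha> j" if "i \<noteq> j" for i j using injD[OF permutes_inj[OF p]] that by blast
  have zcs: "zc m \<alpha> z" if z: "a \<le> z" "z \<le> m" for z
    unfolding zc_def
  proof (intro conjI ballI)
    fix j k assume j: "j \<in> {1..z}" and k: "k \<in> {z<..m}"
    show "\<alpha> j < \<alpha> k"
    proof (rule ccontr)
      assume n: "\<not> ?thesis"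
      then have "\<alpha> k < \<alpha> j" using inj[of j k] j k by force
      moreover have ja: "a < j"
      proof (rule ccontr)
        assume "\<not> a < j"
        then have "j \<in> {1..a}" "k \<in> {a<..m}" using j k z by auto
        then have "\<alpha> j < \<alpha> k" using a(2) by (simp add: zc_def)
        then show False using n by simp
      qed
      moreover have "\<alpha> 1 < \<alpha> k" using a k z by (simp add: zc_def)
      ultimately show False using no[of 1 j k] j k a z by auto
    qed
  qed (use z in simp)
  have id: "\<alpha> i = i" if "a < i" "i \<le> m" for i
  proof -
    have 1: "zc m \<alpha> i" and 2: "zc m \<alpha> (i - 1)" using zcs that by auto
    show ?thesis using zc_le[OF p 1, of i] zc_gt[OF p 2, of i] that by auto
  qed
  have pa: "\<alpha> permutes {1..a}"
  proof (rule bij_imp_permutes)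
    show "bij_betw \<alpha> {1..a} {1..a}" using zc_image[OF p a(2)] by (simp add: bij_betw_def eq_card_imp_inj_on)
    fix i assume "i \<notin> {1..a}"
    then show "\<alpha> i = i" using id[of i] permutes_not_in[OF p, of i] by (cases "i \<in> {1..m}") auto
  qed
  have "\<not> dsum (pts a \<alpha>)"
  proof
    assume "dsum (pts a \<alpha>)"
    then obtain z where z: "0 < z" "z < a" "zc a \<alpha> z" unfolding dsum_pts by auto
    have "zc m \<alpha> z"
      unfolding zc_def
    proof (intro conjI ballI)
      fix j k assume j: "j \<in> {1..z}" and k: "k \<in> {z<..m}"
      show "\<alpha> j < \<alpha> k"
      proof (cases "k \<le> a")
        case True
        then show ?thesis using z(3) j k by (simp add: zc_def)
      next
        case False
        then show ?thesis using a(2) j k z(2) by (simp add: zc_def)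
      qed
    qed (use z am in simp)
    then show False using least z by simp
  qed
  then have "\<alpha> \<in> I132 a" unfolding I132_def using pa no am by fastforce
  then show "\<alpha> \<in> (\<Union>a\<in>{1..m}. I132 a)" using a am by auto
next
  fix \<alpha> assume "\<alpha> \<in> (\<Union>a\<in>{1..m}. I132 a)"
  then obtain a where a: "1 \<le> a" "a \<le> m" "\<alpha> \<in> I132 a" by auto
  note p = I132_permutes[OF a(3)]
  have id: "\<alpha> i = i" if "a < i" for i using permutes_not_in[OF p, of i] that by simp
  have le: "\<alpha> i \<le> a" if "i \<le> a" for i
    using permutes_in_image[OF p, of i] permutes_not_in[OF p, of i] that by (cases "i = 0") auto
  have ka: "k \<le> a" if "j < k" "\<alpha> k < \<alpha> j" for j k
    using that id[of k] id[of j] le[of j] by (cases "j \<le> a"; cases "k \<le> a") auto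
  have False if h: "i \<in> {1..m}" "j \<in> {1..m}" "k \<in> {1..m}" "i < j" "j < k" "\<alpha> i < \<alpha> k" "\<alpha> k < \<alpha> j" for i j k
  proof -
    have "k \<le> a" using ka[OF h(5,7)] .
    then have "i \<in> {1..a}" "j \<in> {1..a}" "k \<in> {1..a}" using h by auto
    then show False using a(3) h unfolding I132_def by blast
  qed
  moreover have "\<alpha> permutes {1..m}" using permutes_subset[OF p] a by auto
  ultimately show "\<alpha> \<in> S132 m" unfolding S132_def by blast
qed

lemma I132_disjoint:
  assumes "1 \<le> a" "a < a'" "\<alpha> \<in> I132 a" "\<alpha> \<in> I132 a'"
  shows False
proof -
  note p = I132_permutes[OF assms(3)]
  have id: "\<alpha> i = i" if "a < i" for i using permutes_not_in[OF p, of i] that by simp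
  have le: "\<alpha> i \<le> a" if "i \<in> {1..a}" for i using perm_range[OF p that] by simp
  have "zc a' \<alpha> a" unfolding zc_def using id le assms(2) by fastforce
  then have "dsum (pts a' \<alpha>)" unfolding dsum_pts using assms(1,2) by (intro exI[of _ a]) simp
  then show False using assms(4) by (simp add: I132_def)
qed

lemma sum_B: "1 \<le> m \<Longrightarrow> (\<Sum>a\<in>{1..m}. B a) = (\<Sum>c\<in>codes m. fps_X ^ sum_list c)"
proof -
  assume m: "1 \<le> m"
  have "(\<Sum>\<alpha>\<in>S132 m. wt m \<alpha>) = (\<Sum>a\<in>{1..m}. \<Sum>\<alpha>\<in>I132 a. wt m \<alpha>)"
    unfolding S132_I132[OF m]
    by (rule sum.UNION_disjoint) (use I132_disjoint in \<open>auto, metis linorder_neqE_nat One_nat_def\<close>)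
  also have "\<dots> = (\<Sum>a\<in>{1..m}. B a)"
    unfolding B_def by (intro sum.cong refl wt_extend[OF I132_permutes]) auto
  finally show ?thesis using S132_gf by simp
qed

section \<open>Truncations of the partition series\<close>

lemma X_power_dvd_iff: "fps_X ^ N dvd (f :: rat fps) \<longleftrightarrow> (\<forall>k<N. fps_nth f k = 0)"
proof
  assume "fps_X ^ N dvd f"
  then obtain g where "f = fps_X ^ N * g" by (auto elim: dvdE)
  then show "\<forall>k<N. fps_nth f k = 0" by (simp add: fps_X_power_mult_nth)
next
  assume z: "\<forall>k<N. fps_nth f k = 0"
  have "f = fps_X ^ N * fps_shift N f"
    using z by (auto simp: fps_eq_iff fps_X_power_mult_nth)
  then show "fps_X ^ N dvd f" by (rule dvdI)
qed

text \<open>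
  An indecomposable permutation of length \<open>a\<close> has at least \<open>a - 1\<close>
  inversions.
\<close>

lemma B_dvd: "1 \<le> a \<Longrightarrow> fps_X ^ (a - 1) dvd B a"
  unfolding B_def wt_def
proof (intro dvd_sum le_imp_power_dvd)
  fix \<alpha> assume a: "1 \<le> a" and al: "\<alpha> \<in> I132 a"
  have "pts a \<alpha> \<noteq> {}" using a by (auto simp: pts_def)
  then have "card (pts a \<alpha>) \<le> ninv (pts a \<alpha>) + 1"
    using al generic_pts[OF I132_permutes[OF al]] by (intro indecomposable_ninv) (auto simp: I132_def)
  then show "a - 1 \<le> ninv (pts a \<alpha>)" by (simp add: card_pts)
qed

lemma sorted_sum_bound:
  assumes "sorted_wrt (\<ge>) c" "i < length c"
  shows "Suc i * c ! i \<le> sum_list (c :: nat list)"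
proof -
  have "Suc i * c ! i = (\<Sum>j\<in>{..i}. c ! i)" by simp
  also have "\<dots> \<le> (\<Sum>j\<in>{..i}. c ! j)"
  proof (rule sum_mono)
    fix j assume "j \<in> {..i}"
    then show "c ! i \<le> c ! j" using sorted_wrt_nth_less[OF assms(1), of j i] assms(2) by (cases "j = i") auto
  qed
  also have "\<dots> \<le> (\<Sum>j\<in>{0..<length c}. c ! j)" by (rule sum_mono2) (use assms(2) in auto)
  finally show ?thesis by (simp add: sum_list_sum_nth)
qed

lemma codes_bound: "c \<in> codes m \<Longrightarrow> x \<in> set c \<Longrightarrow> x < m"
  by (fastforce simp: codes_def in_set_conv_nth)

lemma codes_append_0: "c \<in> codes m \<Longrightarrow> c @ [0] \<in> codes (Suc m)"
  unfolding codes_def by (auto simp: sorted_wrt_append nth_append less_Suc_eq)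

lemma codes_map_Suc: "c \<in> codes m \<Longrightarrow> map Suc c @ [0] \<in> codes (Suc m)"
  unfolding codes_def by (auto simp: sorted_wrt_append sorted_wrt_map nth_append less_Suc_eq)

text \<open>
  The last row of a diagram in the staircase is always empty.
\<close>

lemma codes_snoc:
  assumes "c \<in> codes (Suc m)"
  obtains c' where "c = c' @ [0]" "length c' = m" "sorted_wrt (\<ge>) c'" "\<forall>i<m. c' ! i + i \<le> m"
proof -
  have c: "length c = Suc m" "sorted_wrt (\<ge>) c" "\<forall>i<Suc m. c ! i + i < Suc m" using assms by (auto simp: codes_def)
  obtain c' z where cz: "c = c' @ [z]" using c(1) by (metis length_Suc_conv_rev)
  have l: "length c' = m" using c(1) cz by simp
  have "c ! m + m < Suc m" using c(3) by blast
  then have "z = 0" using cz l by (simp add: nth_append)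
  moreover have "sorted_wrt (\<ge>) c'" using c(2) cz by (simp add: sorted_wrt_append)
  moreover have "c' ! i + i \<le> m" if "i < m" for i
    using c(3)[THEN spec, of i] that cz l by (simp add: nth_append)
  ultimately show ?thesis using that cz l by blast
qed

text \<open>
  The series \<open>B (m + 1)\<close> enumerates the diagrams that fit into the staircase of size
  \<open>m + 1\<close> but not into that of size \<open>m\<close>, so they reach its rim, a cell
  \<open>i\<close> rows down with \<open>c ! i + i = m\<close>. If this is a full first row
  (\<open>Row\<close>) or a full first column (\<open>Col\<close>), deleting it leaves any diagram
  in the smaller staircase, which gives the two equal main terms. A diagram that has both, or that
  reaches the rim only in between (\<open>O'\<close>), contains a hook of at least \<open>2 m -
  2\<close> cells or a rectangle of sides \<open>i + 1\<close> and \<open>m - i\<close>, both at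
  least two, which has at least \<open>2 m - 2\<close> cells as well.
\<close>

lemma B_row_col:
  assumes m: "1 \<le> m"
  shows "fps_X ^ (2 * m - 2) dvd B (Suc m) - 2 * fps_X ^ m * (\<Sum>a\<in>{1..m}. B a)"
proof -
  let ?C = "codes (Suc m)"
  let ?w = "\<lambda>c. fps_X ^ sum_list c :: rat fps"
  define NT where "NT = {c \<in> ?C. \<forall>i<m. c ! i + i < m}"
  define Row where "Row = {c \<in> ?C. c ! 0 = m}"
  define Col where "Col = {c \<in> ?C. 1 \<le> c ! (m - 1)}"
  define O' where "O' = ?C - NT - Row - Col"
  have fin: "finite NT" "finite Row" "finite Col" "finite O'" by (auto simp: NT_def Row_def Col_def O'_def)
  have A: "(\<Sum>a\<in>{1..m}. B a) = (\<Sum>c\<in>codes m. ?w c)" by (rule sum_B[OF m])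
  have A': "(\<Sum>a\<in>{1..Suc m}. B a) = (\<Sum>c\<in>?C. ?w c)" by (rule sum_B) simp
  have "NT = (\<lambda>c. c @ [0]) ` codes m"
  proof (intro equalityI subsetI)
    fix c assume c: "c \<in> NT"
    then have "c \<in> ?C" by (simp add: NT_def)
    then obtain c' where c': "c = c' @ [0]" "length c' = m" "sorted_wrt (\<ge>) c'" by (rule codes_snoc)
    have "c' ! i + i < m" if "i < m" for i
      using c that c' by (auto simp: NT_def nth_append)
    then have "c' \<in> codes m" using c' by (simp add: codes_def)
    then show "c \<in> (\<lambda>c. c @ [0]) ` codes m" using c' by blast
  next
    fix c assume "c \<in> (\<lambda>c. c @ [0]) ` codes m"
    then obtain c' where c': "c' \<in> codes m" "c = c' @ [0]" by auto
    then have "c ! i + i < m" if "i < m" for i using that by (auto simp: codes_def nth_append)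
    then show "c \<in> NT" using codes_append_0 c' by (simp add: NT_def)
  qed
  then have sNT: "(\<Sum>c\<in>NT. ?w c) = (\<Sum>c\<in>codes m. ?w c)"
    by (simp add: sum.reindex inj_on_def)
  have "Row = (#) m ` codes m"
  proof (intro equalityI subsetI)
    fix c assume c: "c \<in> Row"
    then obtain d ds where "c = d # ds" by (cases c) (auto simp: Row_def codes_def)
    then show "c \<in> (#) m ` codes m" using c codes_Cons by (auto simp: Row_def)
  next
    fix c assume "c \<in> (#) m ` codes m"
    then obtain c' where c': "c' \<in> codes m" "c = m # c'" by auto
    have "\<forall>x\<in>set c'. x \<le> m" using codes_bound[OF c'(1)] by (auto intro: less_imp_le)
    then show "c \<in> Row" using c' codes_Cons by (simp add: Row_def)
  qed
  then have sRow: "(\<Sum>c\<in>Row. ?w c) = fps_X ^ m * (\<Sum>c\<in>codes m. ?w c)"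
    by (simp add: sum.reindex inj_on_def power_add sum_distrib_left)
  have "Col = (\<lambda>c. map Suc c @ [0]) ` codes m"
  proof (intro equalityI subsetI)
    fix c assume c: "c \<in> Col"
    then have "c \<in> ?C" by (simp add: Col_def)
    then obtain c' where c': "c = c' @ [0]" "length c' = m" "sorted_wrt (\<ge>) c'" "\<forall>i<m. c' ! i + i \<le> m" by (rule codes_snoc)
    have last: "1 \<le> c' ! (m - 1)" using c c'(1,2) m by (simp add: Col_def nth_append)
    have pos: "1 \<le> c' ! i" if "i < m" for i
    proof (cases "i = m - 1")
      case False
      then have "i < m - 1" using that by simp
      then have "c' ! (m - 1) \<le> c' ! i" using sorted_wrt_nth_less[OF c'(3), of i "m - 1"] c'(2) m by simp
      then show ?thesis using last by simp
    qed (use last in simp)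
    define d where "d = map (\<lambda>x. x - 1) c'"
    have "(Suc \<circ> (\<lambda>x. x - 1)) x = x" if x: "x \<in> set c'" for x
    proof -
      have "1 \<le> x" using x pos c'(2) by (metis in_set_conv_nth)
      then show ?thesis by simp
    qed
    then have "map Suc d = c'" unfolding d_def map_map by (rule map_idI)
    moreover have "d \<in> codes m"
      unfolding codes_def
    proof (intro CollectI conjI allI impI)
      show "length d = m" using c' by (simp add: d_def)
      show "sorted_wrt (\<ge>) d" unfolding d_def sorted_wrt_map
        by (rule sorted_wrt_mono_rel[OF _ c'(3)]) auto
      fix i assume i: "i < m"
      then show "d ! i + i < m" using c'(2) c'(4)[THEN spec, of i] pos[OF i] by (simp add: d_def)
    qed
    ultimately show "c \<in> (\<lambda>c. map Suc c @ [0]) ` codes m" using c'(1) by (intro image_eqI[of _ _ d]) simp_all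
  next
    fix c assume "c \<in> (\<lambda>c. map Suc c @ [0]) ` codes m"
    then obtain c' where c': "c' \<in> codes m" "c = map Suc c' @ [0]" by auto
    moreover have "length c' = m" using c' by (simp add: codes_def)
    ultimately show "c \<in> Col" using codes_map_Suc m by (simp add: Col_def nth_append)
  qed
  moreover have "inj_on (\<lambda>c. map Suc c @ [0]) (codes m)" by (auto simp: inj_on_def)
  moreover have "sum_list (map Suc c) = sum_list c + length c" for c by (induction c) auto
  ultimately have sCol: "(\<Sum>c\<in>Col. ?w c) = fps_X ^ m * (\<Sum>c\<in>codes m. ?w c)"
    by (simp add: sum.reindex power_add sum_distrib_left codes_def mult.commute)
  have len: "length c = Suc m" "sorted_wrt (\<ge>) c" "\<And>i. i < Suc m \<Longrightarrow> c ! i + i < Suc m" if "c \<in> ?C" for c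
    using that by (auto simp: codes_def)
  \<comment> \<open>A full first row and a full first column together contain \<open>2 m - 1\<close> cells.\<close>
  have both: "2 * m - 2 \<le> sum_list c" if "c \<in> Row \<inter> Col" for c
  proof (cases "m = 1")
    case False
    have c: "c \<in> ?C" "c ! 0 = m" "1 \<le> c ! (m - 1)" using that by (auto simp: Row_def Col_def)
    then obtain d ds where dd: "c = d # ds" by (cases c) (auto simp: codes_def)
    have s: "Suc (m - 2) * ds ! (m - 2) \<le> sum_list ds"
      by (rule sorted_sum_bound) (use len[OF c(1)] dd False m in auto)
    have m2: "m - 1 = Suc (m - 2)" using False m by simp
    then have "ds ! (m - 2) = c ! (m - 1)" unfolding dd by (simp only: nth_Cons_Suc)
    then have "Suc (m - 2) * 1 \<le> Suc (m - 2) * ds ! (m - 2)" using c(3) by (intro mult_le_mono2) simp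
    then have "m - 1 \<le> sum_list ds" using s unfolding m2 by (metis le_trans mult.right_neutral)
    moreover have "d = m" using c dd by simp
    ultimately show ?thesis using dd by simp
  qed simp
  \<comment> \<open>The rectangle spanned by the rim cell has \<open>u + 2\<close> rows and \<open>v + 2\<close> columns, where \<open>u + v = m - 3\<close>.\<close>
  have other: "2 * m - 2 \<le> sum_list c" if "c \<in> O'" for c
  proof -
    have c: "c \<in> ?C" "c \<notin> NT" "c ! 0 \<noteq> m" "c ! (m - 1) = 0" using that by (auto simp: O'_def Row_def Col_def)
    then obtain i where i: "i < m" "m \<le> c ! i + i" by (auto simp: NT_def not_less)
    then have ci: "c ! i + i = m" using len(3)[OF c(1), of i] by simp
    have "i \<noteq> 0" using ci c(3) by (cases i) auto
    moreover have "i \<noteq> m - 1" using ci c(4) i(1) by (metis add_cancel_right_left less_irrefl)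
    ultimately have "i = Suc (i - 1)" "m = i + 2 + (m - i - 2)" using i(1) by auto
    then obtain u v where uv: "i = Suc u" "m = i + 2 + v" by blast
    have "Suc i * c ! i \<le> sum_list c" by (rule sorted_sum_bound) (use len[OF c(1)] i in auto)
    moreover have "c ! i = v + 2" using ci uv by simp
    ultimately have "(u + 2) * (v + 2) \<le> sum_list c" using uv by simp
    moreover have "(u + 2) * (v + 2) = u * v + 2 * u + 2 * v + 4" by (simp add: algebra_simps)
    ultimately show ?thesis using uv by simp
  qed
  have "?C = NT \<union> (Row \<union> Col) \<union> O'" by (auto simp: NT_def Row_def Col_def O'_def)
  moreover have "NT \<inter> (Row \<union> Col) = {}"
  proof -
    have "c \<notin> Row \<union> Col" if "c \<in> NT" for c
    proof -
      have c: "c ! i + i < m" if "i < m" for i using \<open>c \<in> NT\<close> that by (simp add: NT_def)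
      have "c ! 0 < m" "c ! (m - 1) < 1" using c[of 0] c[of "m - 1"] m by linarith+
      then show ?thesis by (auto simp: Row_def Col_def)
    qed
    then show ?thesis by blast
  qed
  moreover have "(NT \<union> (Row \<union> Col)) \<inter> O' = {}" by (auto simp: O'_def)
  ultimately have s1: "(\<Sum>c\<in>?C. ?w c) = (\<Sum>c\<in>NT. ?w c) + (\<Sum>c\<in>Row \<union> Col. ?w c) + (\<Sum>c\<in>O'. ?w c)"
    using fin by (simp add: sum.union_disjoint)
  have s2: "(\<Sum>c\<in>Row \<union> Col. ?w c) = (\<Sum>c\<in>Row. ?w c) + (\<Sum>c\<in>Col. ?w c) - (\<Sum>c\<in>Row \<inter> Col. ?w c)"
    using fin by (simp add: sum_Un)
  have "(\<Sum>a\<in>{1..Suc m}. B a) = (\<Sum>a\<in>{1..m}. B a) + B (Suc m)" by simp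
  then have "B (Suc m) = (\<Sum>c\<in>?C. ?w c) - (\<Sum>c\<in>codes m. ?w c)" using A A' by (metis add_diff_cancel_left')
  then have "B (Suc m) - 2 * fps_X ^ m * (\<Sum>a\<in>{1..m}. B a) = (\<Sum>c\<in>O'. ?w c) - (\<Sum>c\<in>Row \<inter> Col. ?w c)"
    unfolding A s1 s2 sNT sRow sCol by (simp add: algebra_simps)
  moreover have "fps_X ^ (2 * m - 2) dvd (\<Sum>c\<in>O'. ?w c)"
    by (intro dvd_sum le_imp_power_dvd) (use other in auto)
  moreover have "fps_X ^ (2 * m - 2) dvd (\<Sum>c\<in>Row \<inter> Col. ?w c)"
    by (intro dvd_sum le_imp_power_dvd both)
  ultimately show ?thesis by (simp add: dvd_diff)
qed

text \<open>
  A diagram with fewer than \<open>m\<close> cells fits into the staircase: if the row with index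
  \<open>i\<close> has \<open>c\<close> cells, there are at least \<open>(i + 1) c\<close> cells in
  total.
\<close>

lemma partition_codes:
  assumes k: "k < m"
  shows "partition_number k = card {c \<in> codes m. sum_list c = k}"
proof -
  let ?f = "\<lambda>c. filter_mset (\<lambda>x. x \<noteq> 0) (mset c)"
  have "bij_betw ?f {c \<in> codes m. sum_list c = k} {M. 0 \<notin># M \<and> sum_mset M = k}"
  proof (rule bij_betw_imageI)
    show "inj_on ?f {c \<in> codes m. sum_list c = k}"
    proof (rule inj_onI)
      fix c c' assume h: "c \<in> {c \<in> codes m. sum_list c = k}" "c' \<in> {c \<in> codes m. sum_list c = k}" and e: "?f c = ?f c'"
      have nz: "count (mset c) x = count (mset c') x" if "x \<noteq> 0" for x
        using arg_cong[OF e, of "\<lambda>M. count M x"] that by simp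
      have p: "mset c = ?f c + filter_mset (\<lambda>x. x = 0) (mset c)" for c :: "nat list"
        using multiset_partition[of "mset c" "\<lambda>x. x \<noteq> 0"] by simp
      have z: "filter_mset (\<lambda>x. x = 0) (mset c) = replicate_mset (count (mset c) 0) 0" for c :: "nat list"
        by (rule multiset_eqI) auto
      have sz: "size (mset c) = m" "size (mset c') = m" using h by (simp_all add: codes_def)
      have "size (mset c) = size (?f c) + count (mset c) 0" for c :: "nat list"
        by (subst p, subst z) simp
      then have "count (mset c) 0 = count (mset c') 0" using sz e by (metis add_left_cancel)
      then have "mset c = mset c'" using p[of c] p[of c'] z[of c] z[of c'] e by simp
      then have "mset (rev c) = mset (rev c')" by simp
      moreover have "sorted (rev c)" "sorted (rev c')"
        using h by (simp_all add: codes_def sorted_wrt_rev)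
      ultimately have "rev c = rev c'" using properties_for_sort by metis
      then show "c = c'" by simp
    qed
    show "?f ` {c \<in> codes m. sum_list c = k} = {M. 0 \<notin># M \<and> sum_mset M = k}"
    proof (intro equalityI subsetI)
      fix M assume "M \<in> ?f ` {c \<in> codes m. sum_list c = k}"
      then obtain c where c: "sum_list c = k" "M = ?f c" by auto
      have "sum_list c = sum_mset (?f c)" for c :: "nat list" by (induction c) auto
      then show "M \<in> {M. 0 \<notin># M \<and> sum_mset M = k}" using c by auto
    next
      fix M :: "nat multiset" assume "M \<in> {M. 0 \<notin># M \<and> sum_mset M = k}"
      then have M: "0 \<notin># M" "sum_mset M = k" by auto
      have "size M \<le> sum_mset M" using M(1)
      proof (induction M)
        case (add x M)
        then show ?case by (cases x) auto
      qed simp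
      then have sz: "size M \<le> m" using M k by simp
      define l where "l = sorted_list_of_multiset M"
      \<comment> \<open>Pad with empty rows up to length \<open>m\<close>; there are enough of them because all parts are positive.\<close>
      define c where "c = rev l @ replicate (m - size M) 0"
      have ml: "mset l = M" by (simp add: l_def)
      have ll: "length l = size M" using ml by (metis size_mset)
      have len: "length c = m" using sz ll by (simp add: c_def)
      have s: "sorted_wrt (\<ge>) c" unfolding c_def
      proof -
        have "sorted l" by (simp add: l_def)
        then have "sorted_wrt (\<ge>) (rev l)" by (simp add: sorted_wrt_rev)
        moreover have "sorted_wrt (\<ge>) (replicate q (0::nat))" for q by (induction q) auto
        ultimately show "sorted_wrt (\<ge>) (rev l @ replicate (m - size M) 0)" by (auto simp: sorted_wrt_append)
      qed
      have sum: "sum_list c = k" using M ml by (simp add: c_def sum_list_replicate sum_mset_sum_list[symmetric])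
      have "c \<in> codes m"
        unfolding codes_def
      proof (intro CollectI conjI allI impI)
        fix i assume i: "i < m"
        have "Suc i * c ! i \<le> k" using sorted_sum_bound[OF s, of i] i len sum by simp
        then show "c ! i + i < m" using k i by (cases "c ! i") auto
      qed (use len s in auto)
      moreover have "?f c = M"
      proof -
        have "filter_mset (\<lambda>x. x \<noteq> 0) M = M" using M(1) by (auto simp: filter_mset_eq_conv intro!: gr0I)
        then show ?thesis by (simp add: c_def ml)
      qed
      ultimately show "M \<in> ?f ` {c \<in> codes m. sum_list c = k}" using sum by (intro image_eqI[of _ _ c]) auto
    qed
  qed
  then show ?thesis unfolding partition_number_def by (simp add: bij_betw_same_card)
qed

lemma P_sum_B:
  assumes "1 \<le> m"
  shows "fps_X ^ m dvd P - (\<Sum>a\<in>{1..m}. B a)"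
  unfolding X_power_dvd_iff sum_B[OF assms]
proof (intro allI impI)
  fix k assume k: "k < m"
  have "fps_nth (\<Sum>c\<in>codes m. fps_X ^ sum_list c) k = (\<Sum>c\<in>codes m. if sum_list c = k then 1 else (0::rat))"
    unfolding fps_sum_nth by (rule sum.cong) auto
  also have "\<dots> = of_nat (card {c \<in> codes m. sum_list c = k})" by (simp add: sum.If_cases Int_def)
  finally show "fps_nth (P - (\<Sum>c\<in>codes m. fps_X ^ sum_list c)) k = 0"
    by (simp add: P_def partition_codes[OF k])
qed

section \<open>Evaluating the generating function\<close>

text \<open>
  Congruence modulo \<open>x^N\<close>.
\<close>

definition congX :: "nat \<Rightarrow> rat fps \<Rightarrow> rat fps \<Rightarrow> bool" where
  "congX N f g \<longleftrightarrow> fps_X ^ N dvd f - g"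

lemma congX_refl [simp]: "congX N f f" by (simp add: congX_def)

lemma congX_eq: "f = g \<Longrightarrow> congX N f g" by simp

lemma congX_trans: "congX N f g \<Longrightarrow> congX N g h \<Longrightarrow> congX N f h"
  unfolding congX_def using dvd_add[of "fps_X ^ N" "f - g" "g - h"] by simp

lemma congX_add: "congX N f g \<Longrightarrow> congX N f' g' \<Longrightarrow> congX N (f + f') (g + g')"
  unfolding congX_def using dvd_add[of "fps_X ^ N" "f - g" "f' - g'"] by (simp add: algebra_simps)

lemma congX_diff: "congX N f g \<Longrightarrow> congX N f' g' \<Longrightarrow> congX N (f - f') (g - g')"
  unfolding congX_def using dvd_diff[of "fps_X ^ N" "f - g" "f' - g'"] by (simp add: algebra_simps)

lemma congX_mult: "congX N f g \<Longrightarrow> congX N (h * f) (h * g)"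
  unfolding congX_def by (metis dvd_mult right_diff_distrib)

lemma congX_sum: "(\<And>i. i \<in> I \<Longrightarrow> congX N (f i) (g i)) \<Longrightarrow> congX N (\<Sum>i\<in>I. f i) (\<Sum>i\<in>I. g i)"
  unfolding congX_def sum_subtractf[symmetric] by (rule dvd_sum)

lemma congX_nth: "congX N f g \<Longrightarrow> k < N \<Longrightarrow> fps_nth f k = fps_nth g k"
  unfolding congX_def X_power_dvd_iff by simp

lemma X_dvd_mult:
  fixes f g :: "rat fps"
  assumes "fps_X ^ p dvd f" "fps_X ^ q dvd g" "N \<le> p + q"
  shows "fps_X ^ N dvd f * g"
proof -
  have "fps_X ^ (p + q) dvd f * g" unfolding power_add by (rule mult_dvd_mono[OF assms(1,2)])
  then show ?thesis using le_imp_power_dvd[OF assms(3)] dvd_trans by blast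
qed

text \<open>
  By \<open>B_row_col\<close>, \<open>B a\<close> is congruent to twice this series modulo
  \<open>x^(2 a - 4)\<close>.
\<close>

definition halfB :: "nat \<Rightarrow> rat fps" where "halfB a = fps_X ^ (a - 1) * (\<Sum>i\<in>{1..<a}. B i)"

lemma E_dvd: "1 \<le> a \<Longrightarrow> fps_X ^ (2 * a - 4) dvd B a - 2 * halfB a"
proof -
  assume "1 \<le> a"
  show ?thesis
  proof (cases "a = 1")
    case False
    define m where "m = a - 1"
    have 2: "a = Suc m" "1 \<le> m" using \<open>1 \<le> a\<close> False by (auto simp: m_def)
    have "{1..<Suc m} = {1..m}" by auto
    then show ?thesis using B_row_col[OF 2(2)] 2 by (simp add: halfB_def mult.assoc)
  qed simp
qed

text \<open>
  Substituting the definition of \<open>halfB\<close> and exchanging the sums, with \<open>b = d +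
  1\<close>.
\<close>

lemma sum_halfB:
  "(\<Sum>b\<in>{1..M}. halfB b * g b) = (\<Sum>j\<in>{1..M}. B j * (\<Sum>d\<in>{j..<M}. fps_X ^ d * g (Suc d)))"
proof -
  have "(\<Sum>b\<in>{1..M}. halfB b * g b) = (\<Sum>b\<in>{1..M}. \<Sum>j\<in>{j \<in> {1..M}. j < b}. B j * (fps_X ^ (b - 1) * g b))"
  proof (rule sum.cong[OF refl])
    fix b assume "b \<in> {1..M}"
    then have "{j \<in> {1..M}. j < b} = {1..<b}" by auto
    then show "halfB b * g b = (\<Sum>j\<in>{j \<in> {1..M}. j < b}. B j * (fps_X ^ (b - 1) * g b))"
      by (simp add: halfB_def sum_distrib_left sum_distrib_right algebra_simps)
  qed
  also have "\<dots> = (\<Sum>j\<in>{1..M}. \<Sum>b\<in>{b \<in> {1..M}. j < b}. B j * (fps_X ^ (b - 1) * g b))"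
    by (rule sum.swap_restrict) auto
  also have "\<dots> = (\<Sum>j\<in>{1..M}. B j * (\<Sum>d\<in>{j..<M}. fps_X ^ d * g (Suc d)))"
  proof (rule sum.cong[OF refl])
    fix j assume j: "j \<in> {1..M}"
    have "{b \<in> {1..M}. j < b} = Suc ` {j..<M}"
    proof (intro equalityI subsetI)
      fix b assume "b \<in> {b \<in> {1..M}. j < b}"
      then show "b \<in> Suc ` {j..<M}" by (intro image_eqI[of _ _ "b - 1"]) auto
    qed auto
    then show "(\<Sum>b\<in>{b \<in> {1..M}. j < b}. B j * (fps_X ^ (b - 1) * g b)) = B j * (\<Sum>d\<in>{j..<M}. fps_X ^ d * g (Suc d))"
      by (simp only: sum.reindex inj_Suc comp_def diff_Suc_1 sum_distrib_left mult.assoc cong: sum.cong)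
  qed
  finally show ?thesis .
qed

abbreviation ind :: "bool \<Rightarrow> rat fps" where "ind b \<equiv> (if b then 1 else 0)"

text \<open>
  All generating functions are brought into this form, with a weight for each pair of block sizes.
  The bound \<open>2 n\<close> is large enough for the sum with weight one to agree with the square
  of \<open>P\<close> to the required precision.
\<close>

definition pair_sum :: "nat \<Rightarrow> (nat \<Rightarrow> nat \<Rightarrow> rat fps) \<Rightarrow> rat fps" where
  "pair_sum n f = (\<Sum>a\<in>{1..2 * n}. \<Sum>b\<in>{1..2 * n}. B a * B b * f a b)"

lemma pair_sum_add: "pair_sum n (\<lambda>a b. f a b + g a b) = pair_sum n f + pair_sum n g"
  by (simp add: pair_sum_def distrib_left sum.distrib)
lemma pair_sum_diff: "pair_sum n (\<lambda>a b. f a b - g a b) = pair_sum n f - pair_sum n g"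
  by (simp add: pair_sum_def right_diff_distrib sum_subtractf)
lemma pair_sum_cmult: "pair_sum n (\<lambda>a b. c * f a b) = c * pair_sum n f"
  by (simp add: pair_sum_def sum_distrib_left algebra_simps)

lemma pair_sum_Pr:
  assumes "m \<le> 2 * n"
  shows "(\<Sum>(a, b)\<in>Pr m. B a * B b * g a b) = pair_sum n (\<lambda>a b. ind (a + b \<le> m) * g a b)"
proof -
  have "Pr m = {u \<in> {1..2 * n} \<times> {1..2 * n}. fst u + snd u \<le> m}" using assms by (auto simp: Pr_def)
  then have "(\<Sum>(a, b)\<in>Pr m. B a * B b * g a b)
     = (\<Sum>u\<in>{1..2 * n} \<times> {1..2 * n}. if fst u + snd u \<le> m then B (fst u) * B (snd u) * g (fst u) (snd u) else 0)"
    by (simp add: sum.inter_filter case_prod_unfold)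
  also have "\<dots> = pair_sum n (\<lambda>a b. ind (a + b \<le> m) * g a b)"
    unfolding pair_sum_def sum.cartesian_product by (rule sum.cong) auto
  finally show ?thesis .
qed

text \<open>
  The factors \<open>B a\<close> and \<open>B b\<close> contribute \<open>a + b - 2\<close> to the
  precision.
\<close>

lemma pair_sum_congX:
  assumes "\<And>a b. 1 \<le> a \<Longrightarrow> 1 \<le> b \<Longrightarrow> congX (N - (a + b - 2)) (f a b) (g a b)"
  shows "congX N (pair_sum n f) (pair_sum n g)"
  unfolding pair_sum_def
proof (intro congX_sum)
  fix a b assume ab: "a \<in> {1..2 * n}" "b \<in> {1..2 * n}"
  have "fps_X ^ (a + b - 2) dvd B a * B b"
    by (rule X_dvd_mult[OF B_dvd B_dvd]) (use ab in auto)
  then have "fps_X ^ N dvd (B a * B b) * (f a b - g a b)"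
    by (rule X_dvd_mult) (use assms[of a b] ab in \<open>auto simp: congX_def\<close>)
  then show "congX N (B a * B b * f a b) (B a * B b * g a b)" by (simp add: congX_def right_diff_distrib)
qed

text \<open>
  The weights in this group arise when \<open>B\<close> is replaced by \<open>halfB\<close> in one
  or both factors of a sum over pairs.
\<close>

definition wt_BC :: "nat \<Rightarrow> nat \<Rightarrow> nat \<Rightarrow> rat fps" where
  "wt_BC n i b = (\<Sum>d\<in>{i..<2 * n}. fps_X ^ d * ind (n < Suc d + b))"
definition wt_CC :: "nat \<Rightarrow> nat \<Rightarrow> nat \<Rightarrow> rat fps" where
  "wt_CC n i j = (\<Sum>d\<in>{i..<2 * n}. \<Sum>d'\<in>{j..<2 * n}. fps_X ^ d * (fps_X ^ d' * ind (n < Suc d + Suc d')))"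
definition wt_edge_C :: "nat \<Rightarrow> nat \<Rightarrow> nat \<Rightarrow> rat fps" where
  "wt_edge_C n i j = (\<Sum>d\<in>{i..<n}. \<Sum>d'\<in>{j..<2 * n}. fps_X ^ d * (fps_X ^ d' * ind (n \<le> i + Suc d')))"
text \<open>
  The part of \<open>wt_BC\<close> beyond \<open>wt_low + high_powers\<close>; it occurs only for
  \<open>a + b \<ge> n\<close>.
\<close>

definition wt_edge :: "nat \<Rightarrow> nat \<Rightarrow> nat \<Rightarrow> rat fps" where
  "wt_edge n i b = (\<Sum>d\<in>{i..<n}. fps_X ^ d * ind (n \<le> i + b))"
definition high_powers :: "nat \<Rightarrow> rat fps" where "high_powers n = (\<Sum>d\<in>{n..<2 * n}. fps_X ^ d)"
text \<open>
  The weight for avoiders whose lowest point is removable, as in \<open>Mlow_sum\<close> for length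
  \<open>n\<close>.
\<close>

definition wt_low :: "nat \<Rightarrow> nat \<Rightarrow> nat \<Rightarrow> rat fps" where
  "wt_low n a b = ind (a + b \<le> n - 1) * (\<Sum>d\<in>{n - 1 - b<..n - 1}. fps_X ^ d)"
text \<open>
  This weight and the next one belong to the pairs low-right and low-high, from the corresponding
  sums for length \<open>n\<close>.
\<close>

definition wt_low_right :: "nat \<Rightarrow> nat \<Rightarrow> nat \<Rightarrow> rat fps" where
  "wt_low_right n a b = ind (a + b \<le> n - 1) * fps_X ^ (n - 1) +
     ind (a + b \<le> n - 2) * (\<Sum>(c, d)\<in>{(c, d). a \<le> c \<and> c < d \<and> d \<le> n - 2 - b}. fps_X ^ (n - 2 - c + d))"
definition wt_low_high :: "nat \<Rightarrow> nat \<Rightarrow> nat \<Rightarrow> rat fps" where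
  "wt_low_high n a b = ind (a + b \<le> n - 2) * (\<Sum>(c, d)\<in>{(c, d). a \<le> c \<and> c \<le> d \<and> d \<le> n - 2 - b}. fps_X ^ (n - 2 - c + d + 1))"

lemma pair_sum_CB:
  "(\<Sum>a\<in>{1..2 * n}. \<Sum>b\<in>{1..2 * n}. halfB a * B b * ind (n < a + b)) = pair_sum n (wt_BC n)"
proof -
  have "(\<Sum>a\<in>{1..2 * n}. \<Sum>b\<in>{1..2 * n}. halfB a * B b * ind (n < a + b))
     = (\<Sum>a\<in>{1..2 * n}. halfB a * (\<Sum>b\<in>{1..2 * n}. B b * ind (n < a + b)))"
    by (simp add: sum_distrib_left algebra_simps)
  also have "\<dots> = (\<Sum>i\<in>{1..2 * n}. B i * (\<Sum>d\<in>{i..<2 * n}. fps_X ^ d * (\<Sum>b\<in>{1..2 * n}. B b * ind (n < Suc d + b))))"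
    by (rule sum_halfB)
  also have "\<dots> = pair_sum n (wt_BC n)"
    unfolding pair_sum_def wt_BC_def
  proof (rule sum.cong[OF refl])
    fix i
    have "(\<Sum>d\<in>{i..<2 * n}. fps_X ^ d * (\<Sum>b\<in>{1..2 * n}. B b * ind (n < Suc d + b)))
      = (\<Sum>b\<in>{1..2 * n}. B b * (\<Sum>d\<in>{i..<2 * n}. fps_X ^ d * ind (n < Suc d + b)))"
      unfolding sum_distrib_left by (subst sum.swap) (simp add: mult.left_commute)
    then show "B i * (\<Sum>d\<in>{i..<2 * n}. fps_X ^ d * (\<Sum>b\<in>{1..2 * n}. B b * ind (n < Suc d + b)))
      = (\<Sum>b\<in>{1..2 * n}. B i * B b * (\<Sum>d\<in>{i..<2 * n}. fps_X ^ d * ind (n < Suc d + b)))"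
      by (simp only: sum_distrib_left mult.assoc)
  qed
  finally show ?thesis .
qed

lemma pair_sum_BC:
  "(\<Sum>a\<in>{1..2 * n}. \<Sum>b\<in>{1..2 * n}. B a * halfB b * ind (n < a + b)) = pair_sum n (wt_BC n)"
proof -
  have "(\<Sum>a\<in>{1..2 * n}. \<Sum>b\<in>{1..2 * n}. B a * halfB b * ind (n < a + b))
      = (\<Sum>b\<in>{1..2 * n}. \<Sum>a\<in>{1..2 * n}. B a * halfB b * ind (n < a + b))" by (rule sum.swap)
  also have "\<dots> = (\<Sum>a\<in>{1..2 * n}. \<Sum>b\<in>{1..2 * n}. halfB a * B b * ind (n < a + b))"
    by (simp only: mult.commute[of "B _" "halfB _"] add.commute)
  finally show ?thesis using pair_sum_CB by simp
qed

lemma pair_sum_CC: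
  "(\<Sum>a\<in>{1..2 * n}. \<Sum>b\<in>{1..2 * n}. halfB a * halfB b * ind (n < a + b)) = pair_sum n (wt_CC n)"
proof -
  let ?I = "{1..2 * n}"
  have "(\<Sum>a\<in>?I. \<Sum>b\<in>?I. halfB a * halfB b * ind (n < a + b)) = (\<Sum>a\<in>?I. halfB a * (\<Sum>b\<in>?I. halfB b * ind (n < a + b)))"
    by (simp only: sum_distrib_left mult.assoc)
  also have "\<dots> = (\<Sum>i\<in>?I. B i * (\<Sum>d\<in>{i..<2 * n}. fps_X ^ d * (\<Sum>b\<in>?I. halfB b * ind (n < Suc d + b))))"
    by (rule sum_halfB)
  also have "\<dots> = (\<Sum>i\<in>?I. B i * (\<Sum>d\<in>{i..<2 * n}. fps_X ^ d *
       (\<Sum>j\<in>?I. B j * (\<Sum>d'\<in>{j..<2 * n}. fps_X ^ d' * ind (n < Suc d + Suc d')))))"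
    by (simp only: sum_halfB)
  also have "\<dots> = pair_sum n (wt_CC n)"
    unfolding pair_sum_def wt_CC_def
  proof (rule sum.cong[OF refl])
    fix i
    have "(\<Sum>d\<in>{i..<2 * n}. fps_X ^ d * (\<Sum>j\<in>?I. B j * (\<Sum>d'\<in>{j..<2 * n}. fps_X ^ d' * ind (n < Suc d + Suc d'))))
      = (\<Sum>j\<in>?I. B j * (\<Sum>d\<in>{i..<2 * n}. \<Sum>d'\<in>{j..<2 * n}. fps_X ^ d * (fps_X ^ d' * ind (n < Suc d + Suc d'))))"
      unfolding sum_distrib_left by (subst sum.swap) (simp only: mult.left_commute)
    then show "B i * (\<Sum>d\<in>{i..<2 * n}. fps_X ^ d * (\<Sum>j\<in>?I. B j * (\<Sum>d'\<in>{j..<2 * n}. fps_X ^ d' * ind (n < Suc d + Suc d'))))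
      = (\<Sum>j\<in>?I. B i * B j * (\<Sum>d\<in>{i..<2 * n}. \<Sum>d'\<in>{j..<2 * n}. fps_X ^ d * (fps_X ^ d' * ind (n < Suc d + Suc d'))))"
      by (simp only: sum_distrib_left mult.assoc)
  qed
  finally show ?thesis .
qed

text \<open>
  For \<open>n < a + b\<close>, the product of the errors \<open>B a - 2 * halfB a\<close> and
  \<open>B b - 2 * halfB b\<close> is divisible by \<open>x^(2 a + 2 b - 8)\<close>, hence vanishes
  modulo \<open>x^(2 n - 6)\<close>. Expanding that product expresses \<open>B a * B b\<close> by
  terms with at least one factor \<open>halfB\<close>. Although a single replacement of
  \<open>B\<close> by \<open>2 * halfB\<close> would not be precise enough, this combination is.
\<close>

lemma large_pairs:
  "congX (2 * n - 6) (pair_sum n (\<lambda>a b. ind (n < a + b))) (4 * pair_sum n (wt_BC n) - 4 * pair_sum n (wt_CC n))"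
proof -
  let ?I = "{1..2 * n}"
  have eq: "4 * pair_sum n (wt_BC n) - 4 * pair_sum n (wt_CC n) = (\<Sum>a\<in>?I. \<Sum>b\<in>?I. (2 * halfB a * B b + 2 * B a * halfB b - 4 * halfB a * halfB b) * ind (n < a + b))"
    (is "?L = ?R")
  proof -
    have "?R = 2 * (\<Sum>a\<in>?I. \<Sum>b\<in>?I. halfB a * B b * ind (n < a + b)) + 2 * (\<Sum>a\<in>?I. \<Sum>b\<in>?I. B a * halfB b * ind (n < a + b))
       - 4 * (\<Sum>a\<in>?I. \<Sum>b\<in>?I. halfB a * halfB b * ind (n < a + b))"
      by (simp only: left_diff_distrib distrib_right sum.distrib sum_subtractf sum_distrib_left mult.assoc)
    then show ?thesis unfolding pair_sum_CB pair_sum_BC pair_sum_CC by simp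
  qed
  show ?thesis unfolding eq unfolding pair_sum_def
  proof (intro congX_sum)
    fix a b assume ab: "a \<in> ?I" "b \<in> ?I"
    show "congX (2 * n - 6) (B a * B b * ind (n < a + b)) ((2 * halfB a * B b + 2 * B a * halfB b - 4 * halfB a * halfB b) * ind (n < a + b))"
    proof (cases "n < a + b")
      case True
      have "fps_X ^ (2 * n - 6) dvd (B a - 2 * halfB a) * (B b - 2 * halfB b)"
        by (rule X_dvd_mult[OF E_dvd E_dvd]) (use ab True in auto)
      moreover have "(B a - 2 * halfB a) * (B b - 2 * halfB b) = B a * B b - (2 * halfB a * B b + 2 * B a * halfB b - 4 * halfB a * halfB b)"
        by (simp add: algebra_simps)
      ultimately show ?thesis using True by (simp add: congX_def)
    qed simp
  qed
qed

lemma X_dvd_sum_tail: "fps_X ^ p dvd (\<Sum>d\<in>{i..<k}. fps_X ^ d * g d :: rat fps)" if "p \<le> i"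
  by (intro dvd_sum dvd_mult2 le_imp_power_dvd) (use that in auto)

text \<open>
  The part \<open>wt_low\<close> is what the term \<open>4 L\<close> of the inclusion-exclusion
  formula cancels.
\<close>

lemma wt_BC_split:
  assumes "1 \<le> i" "1 \<le> b" "1 \<le> n"
  shows "congX (2 * n - 6 - (i + b - 2)) (wt_BC n i b) (wt_low n i b + high_powers n + wt_edge n i b)"
proof -
  consider "i + b \<le> n - 1" | "n \<le> i + b" "i \<le> n" | "n < i" by linarith
  then show ?thesis
  proof cases
    case 1
    have "wt_BC n i b = (\<Sum>d\<in>{i..<2 * n}. if n < Suc d + b then fps_X ^ d else 0)"
      unfolding wt_BC_def by (rule sum.cong) auto
    also have "\<dots> = (\<Sum>d\<in>{d \<in> {i..<2 * n}. n < Suc d + b}. fps_X ^ d)"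
      by (rule sum.inter_filter[symmetric]) simp
    also have "{d \<in> {i..<2 * n}. n < Suc d + b} = {n - 1 - b<..n - 1} \<union> {n..<2 * n}"
      using 1 assms by auto
    also have "(\<Sum>d\<in>{n - 1 - b<..n - 1} \<union> {n..<2 * n}. fps_X ^ d) = wt_low n i b + high_powers n + wt_edge n i b"
      using 1 assms by (subst sum.union_disjoint) (auto simp: wt_low_def high_powers_def wt_edge_def)
    finally show ?thesis by (rule congX_eq)
  next
    case 2
    have "wt_BC n i b = (\<Sum>d\<in>{i..<2 * n}. fps_X ^ d)"
      unfolding wt_BC_def by (rule sum.cong) (use 2 in auto)
    also have "{i..<2 * n} = {i..<n} \<union> {n..<2 * n}" using 2 by auto
    also have "(\<Sum>d\<in>{i..<n} \<union> {n..<2 * n}. fps_X ^ d) = wt_low n i b + high_powers n + wt_edge n i b"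
      using 2 assms by (subst sum.union_disjoint) (auto simp: wt_low_def high_powers_def wt_edge_def)
    finally show ?thesis by (rule congX_eq)
  next
    case 3
    have "2 * n - 6 - (i + b - 2) \<le> n" using 3 by simp
    then have "fps_X ^ (2 * n - 6 - (i + b - 2)) dvd wt_BC n i b" "fps_X ^ (2 * n - 6 - (i + b - 2)) dvd high_powers n"
      using X_dvd_sum_tail[where i = i and k = "2 * n" and g = "\<lambda>d. ind (n < Suc d + b)"]
        X_dvd_sum_tail[where i = n and k = "2 * n" and g = "\<lambda>d. 1"] 3
      by (simp_all add: wt_BC_def high_powers_def)
    then show ?thesis using 3 by (simp add: congX_def wt_low_def wt_edge_def dvd_diff)
  qed
qed

text \<open>
  Here a single replacement of \<open>B b\<close> suffices, because all exponents in \<open>wt_edge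
  n a b\<close> are at least \<open>a\<close>.
\<close>

lemma wt_edge_halve: "congX (2 * n - 6) (pair_sum n (wt_edge n)) (2 * pair_sum n (wt_edge_C n))"
proof -
  let ?I = "{1..2 * n}"
  have eq: "2 * pair_sum n (wt_edge_C n) = (\<Sum>a\<in>?I. \<Sum>b\<in>?I. B a * (2 * halfB b) * wt_edge n a b)"
  proof -
    have "(\<Sum>b\<in>?I. halfB b * wt_edge n a b) = (\<Sum>j\<in>?I. B j * wt_edge_C n a j)" for a
    proof -
      have "(\<Sum>d'\<in>{j..<2 * n}. fps_X ^ d' * wt_edge n a (Suc d')) = wt_edge_C n a j" for j
        unfolding wt_edge_def wt_edge_C_def sum_distrib_left by (subst sum.swap) (simp only: mult.left_commute)
      then show ?thesis by (simp only: sum_halfB)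
    qed
    then have "(\<Sum>a\<in>?I. B a * (\<Sum>b\<in>?I. halfB b * wt_edge n a b)) = pair_sum n (wt_edge_C n)"
      unfolding pair_sum_def by (simp only: sum_distrib_left mult.assoc)
    then have "2 * pair_sum n (wt_edge_C n) = 2 * (\<Sum>a\<in>?I. B a * (\<Sum>b\<in>?I. halfB b * wt_edge n a b))" by simp
    then show ?thesis by (simp only: sum_distrib_left mult_ac)
  qed
  show ?thesis unfolding eq unfolding pair_sum_def
  proof (intro congX_sum)
    fix a b assume ab: "a \<in> ?I" "b \<in> ?I"
    show "congX (2 * n - 6) (B a * B b * wt_edge n a b) (B a * (2 * halfB b) * wt_edge n a b)"
    proof (cases "n \<le> a + b")
      case True
      have "fps_X ^ (a - 1 + (2 * b - 4)) dvd B a * (B b - 2 * halfB b)"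
        by (rule X_dvd_mult[OF B_dvd E_dvd]) (use ab in auto)
      moreover have "fps_X ^ a dvd wt_edge n a b" unfolding wt_edge_def by (rule X_dvd_sum_tail) simp
      ultimately have "fps_X ^ (2 * n - 6) dvd (B a * (B b - 2 * halfB b)) * wt_edge n a b"
        by (rule X_dvd_mult) (use ab True in auto)
      then show ?thesis by (simp add: congX_def algebra_simps)
    qed (simp add: wt_edge_def)
  qed
qed

lemma coeff_sum_X:
  assumes "finite S"
  shows "fps_nth (\<Sum>u\<in>S. fps_X ^ h u :: rat fps) m = of_nat (card {u \<in> S. h u = m})"
proof -
  have "fps_nth (\<Sum>u\<in>S. fps_X ^ h u :: rat fps) m = (\<Sum>u\<in>S. if h u = m then 1 else 0)"
    unfolding fps_sum_nth by (rule sum.cong) auto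
  also have "\<dots> = of_nat (card {u \<in> S. h u = m})" using assms by (simp add: sum.If_cases Int_def)
  finally show ?thesis .
qed

text \<open>
  The coefficients count lattice points on a line.
\<close>

lemma coeff_double:
  fixes Q :: "nat \<Rightarrow> nat \<Rightarrow> bool"
  assumes "finite S" "finite S'"
  shows "fps_nth (\<Sum>d\<in>S. \<Sum>d'\<in>S'. fps_X ^ d * (fps_X ^ d' * ind (Q d d'))) m
     = of_nat (card {d \<in> S. d \<le> m \<and> m - d \<in> S' \<and> Q d (m - d)})"
proof -
  have "fps_nth (\<Sum>d'\<in>S'. fps_X ^ d * (fps_X ^ d' * ind (Q d d'))) m
      = (if d \<le> m \<and> m - d \<in> S' \<and> Q d (m - d) then 1 else 0)" for d
  proof -
    have "fps_nth (\<Sum>d'\<in>S'. fps_X ^ d * (fps_X ^ d' * ind (Q d d'))) m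
       = (\<Sum>d'\<in>S'. if d' = m - d then (if d \<le> m \<and> Q d (m - d) then 1 else 0) else 0)"
      unfolding fps_sum_nth by (rule sum.cong) (auto simp: fps_X_power_mult_nth)
    then show ?thesis using assms(2) by (simp add: sum.delta)
  qed
  then show ?thesis using assms(1) by (simp add: fps_sum_nth sum.If_cases Int_def)
qed

definition geometric :: "rat fps" where "geometric = Abs_fps (\<lambda>_. 1)"

lemma geometric: "geometric * (1 - fps_X) = 1"
proof (rule fps_ext)
  fix k
  show "fps_nth (geometric * (1 - fps_X)) k = fps_nth 1 k"
    by (cases k) (simp_all add: geometric_def algebra_simps)
qed

text \<open>
  This is \<open>R n / (1 - x)\<close> without its factor \<open>P\<^sup>2\<close>.
\<close>

definition deficit :: "nat \<Rightarrow> rat fps" where "deficit n = (4 * fps_X ^ (n - 1) + 2 * fps_X ^ n) * geometric"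

lemma deficit_nth: "fps_nth (deficit n) m = (if n - 1 \<le> m then 4 else 0) + (if n \<le> m then 2 else 0)"
proof -
  have "deficit n = fps_const 4 * (fps_X ^ (n - 1) * geometric) + fps_const 2 * (fps_X ^ n * geometric)"
    by (simp add: deficit_def algebra_simps numeral_fps_const)
  then show ?thesis by (simp add: fps_X_power_mult_nth geometric_def not_less)
qed

text \<open>
  Compare coefficients of \<open>x^m\<close>. For \<open>m < n - 1\<close> all of them vanish.
  Otherwise the precision forces \<open>m + a + b + 5 \<le> 2 n\<close>, so each of the four lattice
  point sets is an interval with a length that is linear in \<open>m\<close>, \<open>n\<close>,
  \<open>a\<close>, \<open>b\<close>, and the linear terms cancel, leaving \<open>4\<close> or
  \<open>6\<close>.
\<close>

lemma pair_identity:
  assumes ab: "1 \<le> a" "1 \<le> b" and n: "4 \<le> n"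
  shows "congX (2 * n - 6 - (a + b - 2)) (4 * high_powers n + 8 * wt_edge_C n a b - 4 * wt_CC n a b + 2 * wt_low_right n a b + 2 * wt_low_high n a b) (deficit n)"
  unfolding congX_def X_power_dvd_iff
proof (intro allI impI)
  fix m assume m: "m < 2 * n - 6 - (a + b - 2)"
  have num: "fps_nth (numeral v * f) m = numeral v * fps_nth f m" for v and f :: "rat fps"
    by (simp add: numeral_fps_const)
  let ?S3 = "{d \<in> {a..<n}. d \<le> m \<and> m - d \<in> {b..<2 * n} \<and> n \<le> a + Suc (m - d)}"
  let ?S2 = "{d \<in> {a..<2 * n}. d \<le> m \<and> m - d \<in> {b..<2 * n} \<and> n < Suc d + Suc (m - d)}"
  let ?CA = "{(c, d). a \<le> c \<and> c < d \<and> d \<le> n - 2 - b}"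
  let ?CB = "{(c, d). a \<le> c \<and> c \<le> d \<and> d \<le> n - 2 - b}"
  have fin: "finite ?CA" "finite ?CB"
    by (rule finite_subset[of _ "{..n} \<times> {..n}"]; auto)+
  define SA :: "rat fps" where "SA = (\<Sum>(c, d)\<in>?CA. fps_X ^ (n - 2 - c + d))"
  define SB :: "rat fps" where "SB = (\<Sum>(c, d)\<in>?CB. fps_X ^ (n - 2 - c + d + 1))"
  have fAB: "wt_low_right n a b = ind (a + b \<le> n - 1) * fps_X ^ (n - 1) + ind (a + b \<le> n - 2) * SA"
    "wt_low_high n a b = ind (a + b \<le> n - 2) * SB"
    by (simp_all only: wt_low_right_def wt_low_high_def SA_def SB_def)
  have high_powers: "fps_nth (high_powers n) m = (if n \<le> m then 1 else 0)"
  proof -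
    have "{d \<in> {n..<2 * n}. d = m} = (if n \<le> m then {m} else {})" using m by auto
    then show ?thesis unfolding high_powers_def using coeff_sum_X[of "{n..<2 * n}" "\<lambda>d. d" m] by (cases "n \<le> m") simp_all
  qed
  have c3: "fps_nth (wt_edge_C n a b) m = of_nat (card ?S3)" unfolding wt_edge_C_def by (rule coeff_double) auto
  have c2: "fps_nth (wt_CC n a b) m = of_nat (card ?S2)" unfolding wt_CC_def by (rule coeff_double) auto
  have cA: "fps_nth SA m = of_nat (card {u \<in> ?CA. n - 2 - fst u + snd u = m})"
    using coeff_sum_X[OF fin(1), of "\<lambda>u. n - 2 - fst u + snd u" m] by (simp only: SA_def case_prod_unfold)
  have cB: "fps_nth SB m = of_nat (card {u \<in> ?CB. n - 2 - fst u + snd u + 1 = m})"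
    using coeff_sum_X[OF fin(2), of "\<lambda>u. n - 2 - fst u + snd u + 1" m] by (simp only: SB_def case_prod_unfold)
  show "fps_nth (4 * high_powers n + 8 * wt_edge_C n a b - 4 * wt_CC n a b + 2 * wt_low_right n a b + 2 * wt_low_high n a b - deficit n) m = 0"
  proof (cases "n - 1 \<le> m")
    case False
    have "?S3 = {}" "?S2 = {}" using False by auto
    moreover have "{u \<in> ?CA. n - 2 - fst u + snd u = m} = {}" "{u \<in> ?CB. n - 2 - fst u + snd u + 1 = m} = {}"
      using False n by auto
    ultimately have z: "fps_nth (wt_edge_C n a b) m = 0" "fps_nth (wt_CC n a b) m = 0" "fps_nth SA m = 0" "fps_nth SB m = 0"
      unfolding c3 c2 cA cB by (simp_all only: card.empty of_nat_0)
    have "fps_nth (wt_low_right n a b) m = 0" "fps_nth (wt_low_high n a b) m = 0"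
      unfolding fAB using z(3,4) False by (cases "a + b \<le> n - 1"; cases "a + b \<le> n - 2"; simp)+
    then show ?thesis using False high_powers z(1,2) by (simp add: num deficit_nth)
  next
    case True
    then have abn: "a + b + 4 \<le> n" and mm: "m + a + b + 5 \<le> 2 * n" using m ab n by linarith+
    have "?S3 = {a..m + 1 + a - n}" using True abn mm by auto
    then have k3: "card ?S3 + n = m + 2" using True by simp
    have "?S2 = {a..m - b}" using True abn mm by auto
    then have k2: "card ?S2 + a + b = m + 1" using True abn by simp
    have "{u \<in> ?CA. n - 2 - fst u + snd u = m} = (\<lambda>c. (c, c + (m + 2 - n))) ` {a..<2 * n - 3 - b - m}"
    proof (intro equalityI subsetI)
      fix u assume u: "u \<in> {u \<in> ?CA. n - 2 - fst u + snd u = m}"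
      then obtain c d where cd: "u = (c, d)" "a \<le> c" "c < d" "d \<le> n - 2 - b" "n - 2 - c + d = m" by auto
      then have "d = c + (m + 2 - n)" "c < 2 * n - 3 - b - m" using abn by linarith+
      then show "u \<in> (\<lambda>c. (c, c + (m + 2 - n))) ` {a..<2 * n - 3 - b - m}" using cd by auto
    next
      fix u assume "u \<in> (\<lambda>c. (c, c + (m + 2 - n))) ` {a..<2 * n - 3 - b - m}"
      then obtain c where c: "u = (c, c + (m + 2 - n))" "a \<le> c" "c < 2 * n - 3 - b - m" by auto
      have "c < c + (m + 2 - n)" "c + (m + 2 - n) \<le> n - 2 - b" "n - 2 - c + (c + (m + 2 - n)) = m"
        using True c abn mm n by linarith+
      then show "u \<in> {u \<in> ?CA. n - 2 - fst u + snd u = m}" using c by simp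
    qed
    then have "card {u \<in> ?CA. n - 2 - fst u + snd u = m} = 2 * n - 3 - b - m - a"
      by (simp add: card_image inj_on_def)
    then have kA: "card {u \<in> ?CA. n - 2 - fst u + snd u = m} + a + b + m + 3 = 2 * n" using mm by simp
    have "{u \<in> ?CB. n - 2 - fst u + snd u + 1 = m} = (\<lambda>c. (c, c + (m + 1 - n))) ` {a..<2 * n - 2 - b - m}"
    proof (intro equalityI subsetI)
      fix u assume u: "u \<in> {u \<in> ?CB. n - 2 - fst u + snd u + 1 = m}"
      then obtain c d where cd: "u = (c, d)" "a \<le> c" "c \<le> d" "d \<le> n - 2 - b" "n - 2 - c + d + 1 = m" by auto
      then have "d = c + (m + 1 - n)" "c < 2 * n - 2 - b - m" using abn by linarith+
      then show "u \<in> (\<lambda>c. (c, c + (m + 1 - n))) ` {a..<2 * n - 2 - b - m}" using cd by auto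
    next
      fix u assume "u \<in> (\<lambda>c. (c, c + (m + 1 - n))) ` {a..<2 * n - 2 - b - m}"
      then obtain c where c: "u = (c, c + (m + 1 - n))" "a \<le> c" "c < 2 * n - 2 - b - m" by auto
      have "c \<le> c + (m + 1 - n)" "c + (m + 1 - n) \<le> n - 2 - b" "n - 2 - c + (c + (m + 1 - n)) + 1 = m"
        using True c abn mm n by linarith+
      then show "u \<in> {u \<in> ?CB. n - 2 - fst u + snd u + 1 = m}" using c by simp
    qed
    then have "card {u \<in> ?CB. n - 2 - fst u + snd u + 1 = m} = 2 * n - 2 - b - m - a"
      by (simp add: card_image inj_on_def)
    then have kB: "card {u \<in> ?CB. n - 2 - fst u + snd u + 1 = m} + a + b + m + 2 = 2 * n" using mm by simp
    have le: "a + b \<le> n - 1" "a + b \<le> n - 2" using abn by linarith+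
    have A: "fps_nth (wt_low_right n a b) m = (if m = n - 1 then 1 else 0) + of_nat (card {u \<in> ?CA. n - 2 - fst u + snd u = m})"
      unfolding fAB cA[symmetric] using le by simp
    have B: "fps_nth (wt_low_high n a b) m = of_nat (card {u \<in> ?CB. n - 2 - fst u + snd u + 1 = m})"
      unfolding fAB cB[symmetric] using le by simp
    define x3 where "x3 = card ?S3"
    define x2 where "x2 = card ?S2"
    define xA where "xA = card {u \<in> ?CA. n - 2 - fst u + snd u = m}"
    define xB where "xB = card {u \<in> ?CB. n - 2 - fst u + snd u + 1 = m}"
    note xs = x3_def x2_def xA_def xB_def
    have "of_nat x3 + of_nat n = (of_nat m + 2 :: rat)" "of_nat x2 + of_nat a + of_nat b = (of_nat m + 1 :: rat)"
      "of_nat xA + of_nat a + of_nat b + of_nat m + 3 = (2 * of_nat n :: rat)"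
      "of_nat xB + of_nat a + of_nat b + of_nat m + 2 = (2 * of_nat n :: rat)"
      using arg_cong[OF k3, of "of_nat :: nat \<Rightarrow> rat"] arg_cong[OF k2, of "of_nat :: nat \<Rightarrow> rat"]
        arg_cong[OF kA, of "of_nat :: nat \<Rightarrow> rat"] arg_cong[OF kB, of "of_nat :: nat \<Rightarrow> rat"]
      unfolding xs by simp_all
    moreover have "m = n - 1 \<longleftrightarrow> \<not> n \<le> m" using True n by auto
    ultimately show ?thesis
      using True unfolding fps_sub_nth fps_add_nth num high_powers c3 c2 A B deficit_nth xs[symmetric]
      by (cases "n \<le> m") simp_all
  qed
qed

text \<open>
  Starting from the square of \<open>B 1 + \<dots> + B (2 n)\<close>, which is congruent to
  \<open>P\<^sup>2\<close>, the pairs with \<open>a + b \<le> n\<close> make up \<open>D\<close>;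
  the large pairs are rewritten by \<open>large_pairs\<close>, and what is missing to the left-hand
  side then has weight \<open>deficit n\<close> for every pair.
\<close>

lemma gf_identity:
  assumes n: "4 \<le> n"
  defines "D \<equiv> \<Sum>(a, b)\<in>Pr n. B a * B b"
    and "GL \<equiv> \<Sum>(a, b)\<in>Pr (n - 1). B a * B b * (\<Sum>d\<in>{n - 1 - b<..n - 1}. fps_X ^ d)"
    and "GR \<equiv> (\<Sum>(a, b)\<in>Pr (n - 1). B a * B b * fps_X ^ (n - 1)) + (\<Sum>(a, b)\<in>Pr (n - 2). B a * B b *
       (\<Sum>(c, d)\<in>{(c, d). a \<le> c \<and> c < d \<and> d \<le> n - 2 - b}. fps_X ^ (n - 2 - c + d)))"
    and "GH \<equiv> \<Sum>(a, b)\<in>Pr (n - 2). B a * B b *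
       (\<Sum>(c, d)\<in>{(c, d). a \<le> c \<and> c \<le> d \<and> d \<le> n - 2 - b}. fps_X ^ (n - 2 - c + d + 1))"
  shows "congX (2 * n - 6) (D + 4 * GL - 2 * GR - 2 * GH) (P\<^sup>2 - R n / (1 - fps_X))"
proof -
  let ?N = "2 * n - 6"
  let ?A = "\<Sum>a\<in>{1..2 * n}. B a"
  let ?F = "\<lambda>a b. 4 * high_powers n + 8 * wt_edge_C n a b - 4 * wt_CC n a b + 2 * wt_low_right n a b + 2 * wt_low_high n a b"
  have D: "D = pair_sum n (\<lambda>a b. ind (a + b \<le> n))"
    unfolding D_def using pair_sum_Pr[of n n "\<lambda>_ _. 1"] by simp
  have GL: "GL = pair_sum n (wt_low n)" unfolding GL_def wt_low_def by (rule pair_sum_Pr) simp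
  have GR: "GR = pair_sum n (wt_low_right n)" unfolding GR_def wt_low_right_def pair_sum_add
    using pair_sum_Pr[of "n - 1" n "\<lambda>_ _. fps_X ^ (n - 1)"]
      pair_sum_Pr[of "n - 2" n "\<lambda>a b. \<Sum>(c, d)\<in>{(c, d). a \<le> c \<and> c < d \<and> d \<le> n - 2 - b}. fps_X ^ (n - 2 - c + d)"] by simp
  have GH: "GH = pair_sum n (wt_low_high n)" unfolding GH_def wt_low_high_def by (rule pair_sum_Pr) simp
  have sq: "?A * ?A = pair_sum n (\<lambda>_ _. 1)" by (simp add: pair_sum_def sum_product)
  have split: "pair_sum n (\<lambda>_ _. 1) = D + pair_sum n (\<lambda>a b. ind (n < a + b))"
    unfolding D pair_sum_add[symmetric] by (rule arg_cong[of _ _ "pair_sum n"]) (auto simp: fun_eq_iff)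
  have s1: "congX ?N (pair_sum n (wt_BC n)) (pair_sum n (wt_low n) + pair_sum n (\<lambda>_ _. high_powers n) + pair_sum n (wt_edge n))"
    unfolding pair_sum_add[symmetric] by (rule pair_sum_congX) (use wt_BC_split n in auto)
  have s2: "congX ?N (pair_sum n (wt_BC n)) (pair_sum n (wt_low n) + pair_sum n (\<lambda>_ _. high_powers n) + 2 * pair_sum n (wt_edge_C n))"
    by (rule congX_trans[OF s1]) (intro congX_add congX_refl wt_edge_halve)
  have s3: "congX ?N (pair_sum n (\<lambda>a b. ind (n < a + b))) (4 * (pair_sum n (wt_low n) + pair_sum n (\<lambda>_ _. high_powers n) + 2 * pair_sum n (wt_edge_C n)) - 4 * pair_sum n (wt_CC n))"
    by (rule congX_trans[OF large_pairs]) (intro congX_diff congX_mult congX_refl s2)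
  have F: "pair_sum n ?F = 4 * pair_sum n (\<lambda>_ _. high_powers n) + 8 * pair_sum n (wt_edge_C n) - 4 * pair_sum n (wt_CC n) + 2 * pair_sum n (wt_low_right n) + 2 * pair_sum n (wt_low_high n)"
    by (simp only: pair_sum_add pair_sum_diff pair_sum_cmult)
  have G: "D + 4 * GL - 2 * GR - 2 * GH = ?A * ?A - (pair_sum n (\<lambda>a b. ind (n < a + b)) - 4 * pair_sum n (wt_low n) + 2 * pair_sum n (wt_low_right n) + 2 * pair_sum n (wt_low_high n))"
    unfolding sq split GL GR GH by (simp add: algebra_simps)
  have "congX ?N (pair_sum n (\<lambda>a b. ind (n < a + b)) - 4 * pair_sum n (wt_low n) + 2 * pair_sum n (wt_low_right n) + 2 * pair_sum n (wt_low_high n))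
     ((4 * (pair_sum n (wt_low n) + pair_sum n (\<lambda>_ _. high_powers n) + 2 * pair_sum n (wt_edge_C n)) - 4 * pair_sum n (wt_CC n)) - 4 * pair_sum n (wt_low n) + 2 * pair_sum n (wt_low_right n) + 2 * pair_sum n (wt_low_high n))"
    by (intro congX_add congX_diff congX_refl s3)
  also have "(4 * (pair_sum n (wt_low n) + pair_sum n (\<lambda>_ _. high_powers n) + 2 * pair_sum n (wt_edge_C n)) - 4 * pair_sum n (wt_CC n)) - 4 * pair_sum n (wt_low n) + 2 * pair_sum n (wt_low_right n) + 2 * pair_sum n (wt_low_high n) = pair_sum n ?F"
    unfolding F by (simp add: algebra_simps)
  finally have "congX ?N (pair_sum n (\<lambda>a b. ind (n < a + b)) - 4 * pair_sum n (wt_low n) + 2 * pair_sum n (wt_low_right n) + 2 * pair_sum n (wt_low_high n)) (pair_sum n ?F)" .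
  moreover have "congX ?N (pair_sum n ?F) (pair_sum n (\<lambda>_ _. deficit n))"
    by (rule pair_sum_congX) (use pair_identity n in auto)
  ultimately have 1: "congX ?N (pair_sum n (\<lambda>a b. ind (n < a + b)) - 4 * pair_sum n (wt_low n) + 2 * pair_sum n (wt_low_right n) + 2 * pair_sum n (wt_low_high n)) (pair_sum n (\<lambda>_ _. deficit n))"
    by (rule congX_trans)
  have "pair_sum n (\<lambda>_ _. deficit n) = deficit n * (?A * ?A)" unfolding sq using pair_sum_cmult[of n "deficit n" "\<lambda>_ _. 1"] by simp
  then have 2: "congX ?N (D + 4 * GL - 2 * GR - 2 * GH) (?A * ?A - deficit n * (?A * ?A))"
    unfolding G using 1 by (intro congX_diff congX_refl) simp
  \<comment> \<open>Finally \<open>?A\<close> is replaced by \<open>P\<close>; for the square this works since the difference of squares factors.\<close>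
  have "fps_X ^ (2 * n) dvd P - ?A" by (rule P_sum_B) (use n in simp)
  moreover have "(fps_X :: rat fps) ^ ?N dvd fps_X ^ (2 * n)" by (rule le_imp_power_dvd) simp
  ultimately have "fps_X ^ ?N dvd P - ?A" using dvd_trans by blast
  then have "fps_X ^ ?N dvd (?A - P) * ((?A + P) * (1 - deficit n))"
    by (metis dvd_mult2 dvd_minus_iff minus_diff_eq)
  moreover have "(?A - P) * ((?A + P) * (1 - deficit n)) = (?A * ?A - deficit n * (?A * ?A)) - (P\<^sup>2 - deficit n * P\<^sup>2)"
    by (simp add: algebra_simps power2_eq_square)
  ultimately have 3: "congX ?N (?A * ?A - deficit n * (?A * ?A)) (P\<^sup>2 - deficit n * P\<^sup>2)" by (simp add: congX_def)
  have "R n = (deficit n * P\<^sup>2) * (1 - fps_X)"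
  proof -
    have "(fps_X :: rat fps) ^ n = fps_X * fps_X ^ (n - 1)" using n by (cases n) auto
    then have "R n = (4 * fps_X ^ (n - 1) + 2 * fps_X ^ n) * P\<^sup>2" by (simp add: R_def algebra_simps)
    moreover have "(deficit n * P\<^sup>2) * (1 - fps_X) = (4 * fps_X ^ (n - 1) + 2 * fps_X ^ n) * P\<^sup>2 * (geometric * (1 - fps_X))"
      by (simp only: deficit_def mult_ac)
    ultimately show ?thesis unfolding geometric by (simp only: mult_1_right)
  qed
  moreover have "(1 - fps_X :: rat fps) \<noteq> 0" using geometric by auto
  ultimately have "R n / (1 - fps_X) = deficit n * P\<^sup>2" by (metis nonzero_mult_div_cancel_right)
  then show ?thesis using congX_trans[OF 2 3] by simp
qed

lemma of_nat_cnt: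
  "of_nat (cnt n k Q) = fps_nth (\<Sum>\<pi>\<in>{\<pi> \<in> Ind n. Q (pts n \<pi>)}. wt n \<pi>) k"
proof -
  have "finite {\<pi> \<in> Ind n. Q (pts n \<pi>)}" by simp
  moreover have "{\<pi> \<in> {\<pi> \<in> Ind n. Q (pts n \<pi>)}. ninv (pts n \<pi>) = k} = {\<pi> \<in> Ind n. ninv (pts n \<pi>) = k \<and> Q (pts n \<pi>)}"
    by auto
  ultimately show ?thesis unfolding cnt_def using gf_coeff[of "{\<pi> \<in> Ind n. Q (pts n \<pi>)}" n k] by metis
qed

text \<open>
  The combination of \<open>av_split\<close>, \<open>Ind_count\<close> and the four generating
  functions.
\<close>

lemma av_formula:
  assumes "k + 7 \<le> 2 * n"
  shows "of_nat (av n k 4 pattern_1324) = fps_nth (P\<^sup>2 - R n / (1 - fps_X)) k"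
proof -
  have n: "4 \<le> n" using assms by simp
  have "n = Suc (Suc (n - 2))" using n by simp
  then obtain m where m: "n = Suc (Suc m)" ..
  define D where "D = (\<Sum>(a, b)\<in>Pr n. B a * B b)"
  define GL where "GL = (\<Sum>(a, b)\<in>Pr (n - 1). B a * B b * (\<Sum>d\<in>{n - 1 - b<..n - 1}. fps_X ^ d :: rat fps))"
  define GR where "GR = (\<Sum>(a, b)\<in>Pr (n - 1). B a * B b * fps_X ^ (n - 1)) + (\<Sum>(a, b)\<in>Pr (n - 2). B a * B b *
       (\<Sum>(c, d)\<in>{(c, d). a \<le> c \<and> c < d \<and> d \<le> n - 2 - b}. fps_X ^ (n - 2 - c + d)))"
  define GH where "GH = (\<Sum>(a, b)\<in>Pr (n - 2). B a * B b *
       (\<Sum>(c, d)\<in>{(c, d). a \<le> c \<and> c \<le> d \<and> d \<le> n - 2 - b}. fps_X ^ (n - 2 - c + d + 1)))"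
  have dec: "of_nat (card {\<pi> \<in> Dec n. ninv (pts n \<pi>) = k}) = fps_nth D k"
    unfolding D_def using gf_coeff[of "Dec n" n k] Dec_gf[of n] by (simp add: B'_eq_B)
  have low: "of_nat (cnt n k Mlow) = fps_nth GL k"
    unfolding of_nat_cnt GL_def unfolding m Mlow_sum B'_eq_B by simp
  have high: "of_nat (cnt n k (\<lambda>T. Mlow T \<and> Mhigh T)) = fps_nth GH k"
    unfolding of_nat_cnt GH_def unfolding m Mlow_Mhigh_sum B'_eq_B by simp
  have right: "of_nat (cnt n k (\<lambda>T. Mlow T \<and> Mright T)) = fps_nth GR k"
  proof -
    have "{\<pi> \<in> Ind n. Mlow (pts n \<pi>) \<and> Mright (pts n \<pi>)}
      = {\<pi> \<in> Ind n. Mlow (pts n \<pi>) \<and> Mright (pts n \<pi>) \<and> \<pi> n = 1} \<union> {\<pi> \<in> Ind n. Mlow (pts n \<pi>) \<and> Mright (pts n \<pi>) \<and> \<pi> n \<noteq> 1}"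
      by auto
    then have "(\<Sum>\<pi>\<in>{\<pi> \<in> Ind n. Mlow (pts n \<pi>) \<and> Mright (pts n \<pi>)}. wt n \<pi>)
      = (\<Sum>\<pi>\<in>{\<pi> \<in> Ind n. Mlow (pts n \<pi>) \<and> Mright (pts n \<pi>) \<and> \<pi> n = 1}. wt n \<pi>)
        + (\<Sum>\<pi>\<in>{\<pi> \<in> Ind n. Mlow (pts n \<pi>) \<and> Mright (pts n \<pi>) \<and> \<pi> n \<noteq> 1}. wt n \<pi>)"
      by (simp only:) (rule sum.union_disjoint; auto)
    then show ?thesis
      unfolding of_nat_cnt GR_def unfolding m Mlow_Mright_same_sum Mlow_Mright_distinct_sum B'_eq_B by simp
  qed
  define x where "x = card {\<pi> \<in> Ind n. ninv (pts n \<pi>) = k}"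
  have "of_nat x + 2 * fps_nth GH k + 2 * fps_nth GR k = 4 * fps_nth GL k"
    using arg_cong[OF Ind_count[OF assms], of "of_nat :: nat \<Rightarrow> rat"]
    unfolding x_def low[symmetric] high[symmetric] right[symmetric] by simp
  then have "of_nat (av n k 4 pattern_1324) = fps_nth D k + 4 * fps_nth GL k - 2 * fps_nth GR k - 2 * fps_nth GH k"
    unfolding av_split dec[symmetric] x_def by simp
  also have "\<dots> = fps_nth (D + 4 * GL - 2 * GR - 2 * GH) k" by (simp add: numeral_fps_const)
  also have "\<dots> = fps_nth (P\<^sup>2 - R n / (1 - fps_X)) k"
    by (rule congX_nth[OF gf_identity[OF n, folded D_def GL_def GR_def GH_def]]) (use assms in simp)
  finally show ?thesis .
qed

theorem theorem1p2:
  fixes n k :: nat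
  assumes "real n \<ge> (real k + 7) / 2"
  shows "of_nat (av n k 4 pattern_1324) = fps_nth (P\<^sup>2 - R n / (1 - fps_X)) k \<and>
         of_nat (av (n + 1) k 4 pattern_1324) - of_nat (av n k 4 pattern_1324) = fps_nth (R n) k \<and>
         fps_nth (R n) k \<ge> 0"
proof -
  have "real (k + 7) \<le> real (2 * n)" using assms by simp
  then have kn: "k + 7 \<le> 2 * n" by (simp only: of_nat_le_iff)
  have av: "of_nat (av n k 4 pattern_1324) = fps_nth (P\<^sup>2 - R n / (1 - fps_X)) k" by (rule av_formula[OF kn])
  have av': "of_nat (av (n + 1) k 4 pattern_1324) = fps_nth (P\<^sup>2 - R (n + 1) / (1 - fps_X)) k"
    by (rule av_formula) (use kn in simp)
  have ne: "(1 - fps_X :: rat fps) \<noteq> 0" using geometric by auto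
  have div: "f / (1 - fps_X) = f * geometric" for f :: "rat fps"
  proof -
    have "f * geometric * (1 - fps_X) = f" by (simp only: mult.assoc geometric mult_1_right)
    then show ?thesis using nonzero_mult_div_cancel_right[OF ne, of "f * geometric"] by (simp only:)
  qed
  have "(fps_X :: rat fps) ^ n = fps_X * fps_X ^ (n - 1)" using kn by (cases n) auto
  \<comment> \<open>So the two correction terms differ by \<open>R n / (1 - x)\<close> times \<open>1 - x\<close>.\<close>
  then have R': "R (n + 1) = fps_X * R n" by (simp add: R_def algebra_simps)
  have "(P\<^sup>2 - R (n + 1) / (1 - fps_X)) - (P\<^sup>2 - R n / (1 - fps_X)) = R n * (geometric * (1 - fps_X))"
    unfolding div R' by (simp add: algebra_simps)
  then have "of_nat (av (n + 1) k 4 pattern_1324) - of_nat (av n k 4 pattern_1324) = fps_nth (R n) k"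
    unfolding av av' geometric fps_sub_nth[symmetric] by (simp only: mult_1_right)
  moreover have "fps_nth (R n) k \<ge> 0"
  proof -
    have P2: "fps_nth (P\<^sup>2) i \<ge> 0" for i
      unfolding power2_eq_square fps_mult_nth by (intro sum_nonneg mult_nonneg_nonneg) (simp_all add: P_def)
    have "R n = fps_const 4 * (fps_X ^ (n - 1) * P\<^sup>2) + fps_const 2 * (fps_X ^ n * P\<^sup>2)"
      using \<open>fps_X ^ n = fps_X * fps_X ^ (n - 1)\<close> by (simp add: R_def algebra_simps numeral_fps_const)
    then show ?thesis using P2 by (simp add: fps_X_power_mult_nth)
  qed
  ultimately show ?thesis using av by blast
qed

end
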